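(* Fix integers $d \geq 2$ and $1 \le r \leq \binom{d}{2}$ with $r \geq \binom{d-2}{2} + 1$. For each prime $p > 2$ let $W = \bigwedge^2 \mathbb{F}_p^d$ and let $\mathrm{Gr}(r, \binom{d}{2})$ denote the (finite) set of $r$-dimensional $\mathbb{F}_p$-subspaces $L \leq W$. Then $$\liminf_{p \to \infty} \frac{|\{ L \in \mathrm{Gr}(r, \binom{d}{2}) \mid B_0(G_L) = 0 \}|}{|\mathrm{Gr}(r, \binom{d}{2})|} \geq \left( \frac{1}{C_{d-2}} \right)^r,$$ where $C_{d-2} = \frac{1}{d-1}\binom{2(d-2)}{d-2}$ is the Catalan number and $p$ runs over primes.
   Context: For a prime $p>2$, put $V = \mathbb{F}_p^d$, $W = V \wedge V$, and let $F$ be the free group of nilpotency class $2$ and exponent $p$ on $d$ generators, so that $F/[F,F] \cong V$ and the commutator map identifies $[F,F]$ with $W$. For a subspace $L \leq W$, $G_L = F/L$ (the group obtained by imposing precisely the relations of $L$ between commutators); it is a finite group of exponent $p$, nilpotency class at most $2$ and order $p^{d + \binom{d}{2} - \dim L}$. For a finite group $G$, the Bogomolov multiplier is $B_0(G) = \bigcap_{A} \ker( \mathrm{res}^G_A \colon H^2(G, \mathbb{Q}/\mathbb{Z}) \to H^2(A, \mathbb{Q}/\mathbb{Z}))$, the intersection over all abelian subgroups $A \leq G$. For the groups $G_L$ one has $B_0(G_L) \cong L / \langle v \wedge w \mid v, w \in V,\ v \wedge w \in L \rangle$, so $B_0(G_L)=0$ if and only if $L$ is spanned by decomposable wedges $v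 \wedge w$. *)

theory Defs
  imports
    "Jordan_Normal_Form.Missing_VectorSpace"
    "HOL-Number_Theory.Residues"
    "HOL-Algebra.Product_Groups"
    "HOL-Algebra.Generated_Groups"
    "HOL-Library.Extended_Real"
    "HOL-Library.Liminf_Limsup"
begin

section \<open>Second cohomology with trivial coefficients and the Bogomolov multiplier\<close>

definition cocycles2 :: "('g, 'x) monoid_scheme \<Rightarrow> ('m, 'y) monoid_scheme \<Rightarrow> ('g \<times> 'g \<Rightarrow> 'm) set" where
  "cocycles2 G M = {f \<in> carrier G \<times> carrier G \<rightarrow>\<^sub>E carrier M.
     \<forall>g\<in>carrier G. \<forall>h\<in>carrier G. \<forall>k\<in>carrier G.
       f (h, k) \<otimes>\<^bsub>M\<^esub> f (g, h \<otimes>\<^bsub>G\<^esub> k) = f (g \<otimes>\<^bsub>G\<^esub> h, k) \<otimes>\<^bsub>M\<^esub> f (g, h)}"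

definition coboundaries2 :: "('g, 'x) monoid_scheme \<Rightarrow> ('m, 'y) monoid_scheme \<Rightarrow> ('g \<times> 'g \<Rightarrow> 'm) set" where
  "coboundaries2 G M =
     {\<lambda>(g, h)\<in>carrier G \<times> carrier G. c g \<otimes>\<^bsub>M\<^esub> c h \<otimes>\<^bsub>M\<^esub> inv\<^bsub>M\<^esub> (c (g \<otimes>\<^bsub>G\<^esub> h)) | c.
        c \<in> carrier G \<rightarrow> carrier M}"

definition Z2 :: "('g, 'x) monoid_scheme \<Rightarrow> ('m, 'y) monoid_scheme \<Rightarrow> ('g \<times> 'g \<Rightarrow> 'm) monoid" where
  "Z2 G M = (product_group (carrier G \<times> carrier G) (\<lambda>_. M))\<lparr>carrier := cocycles2 G M\<rparr>"

definition H2 :: "('g, 'x) monoid_scheme \<Rightarrow> ('m, 'y) monoid_scheme \<Rightarrow> ('g \<times> 'g \<Rightarrow> 'm) set monoid" where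
  "H2 G M = Z2 G M Mod coboundaries2 G M"

text \<open>The restriction map on cohomology classes. The classes are cosets, and the union below
  is over equal cosets when \<open>A\<close> is a subgroup.\<close>
definition res2 :: "('g, 'x) monoid_scheme \<Rightarrow> ('m, 'y) monoid_scheme \<Rightarrow> 'g set
    \<Rightarrow> ('g \<times> 'g \<Rightarrow> 'm) set \<Rightarrow> ('g \<times> 'g \<Rightarrow> 'm) set" where
  "res2 G M A \<xi> = (\<Union>f\<in>\<xi>. coboundaries2 (G\<lparr>carrier := A\<rparr>) M
     #>\<^bsub>Z2 (G\<lparr>carrier := A\<rparr>) M\<^esub> restrict f (A \<times> A))"

definition rat_add_group :: "rat monoid" where
  "rat_add_group = \<lparr>carrier = UNIV, monoid.mult = (+), one = 0\<rparr>"

definition QmodZ :: "rat set monoid" where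
  "QmodZ = rat_add_group Mod \<int>"

definition bogomolov_multiplier :: "('g, 'x) monoid_scheme \<Rightarrow> ('g \<times> 'g \<Rightarrow> rat set) set monoid" where
  "bogomolov_multiplier G = (H2 G QmodZ)\<lparr>carrier :=
     {\<xi> \<in> carrier (H2 G QmodZ).
        \<forall>A. subgroup A G \<and> comm_group (G\<lparr>carrier := A\<rparr>) \<longrightarrow>
          res2 G QmodZ A \<xi> = \<one>\<^bsub>H2 (G\<lparr>carrier := A\<rparr>) QmodZ\<^esub>}\<rparr>"

lemma comm_group_QmodZ: "comm_group QmodZ"
proof -
  interpret comm_group rat_add_group
    by (rule comm_groupI) (auto simp: rat_add_group_def intro: exI[of _ "- x" for x])
  have "inv\<^bsub>rat_add_group\<^esub> x = - x" for x :: rat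
    by (rule inv_equality) (auto simp: rat_add_group_def)
  then have "subgroup \<int> rat_add_group"
    by (intro subgroupI) (auto simp: rat_add_group_def)
  then show ?thesis unfolding QmodZ_def by (rule abelian_FactGroup)
qed

context
  fixes G :: "('g, 'x) monoid_scheme" and M :: "('m, 'y) monoid_scheme"
  assumes G: "group G" and M: "comm_group M"
begin

interpretation G: group G by (rule G)
interpretation M: comm_group M by (rule M)

private abbreviation P where "P \<equiv> product_group (carrier G \<times> carrier G) (\<lambda>_. M)"

private lemma comm_group_P: "comm_group P"
  by (rule group.group_comm_groupI) (auto simp: PiE_iff M.m_comm intro!: restrict_ext)

interpretation P: comm_group P by (rule comm_group_P)

private lemma m_inter:
  "a \<in> carrier M \<Longrightarrow> b \<in> carrier M \<Longrightarrow> c \<in> carrier M \<Longrightarrow> d \<in> carrier M \<Longrightarrow>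
   (a \<otimes>\<^bsub>M\<^esub> b) \<otimes>\<^bsub>M\<^esub> (c \<otimes>\<^bsub>M\<^esub> d) = (a \<otimes>\<^bsub>M\<^esub> c) \<otimes>\<^bsub>M\<^esub> (b \<otimes>\<^bsub>M\<^esub> d)"
  by (simp add: M.m_ac)

private lemma cocycle_app: "f \<in> cocycles2 G M \<Longrightarrow> g \<in> carrier G \<Longrightarrow> h \<in> carrier G \<Longrightarrow> f (g, h) \<in> carrier M"
  by (auto simp: cocycles2_def)

private lemma subgroup_cocycles: "subgroup (cocycles2 G M) P"
proof (rule P.subgroupI)
  show "cocycles2 G M \<subseteq> carrier P" by (auto simp: cocycles2_def)
  have "(\<lambda>_\<in>carrier G \<times> carrier G. \<one>\<^bsub>M\<^esub>) \<in> cocycles2 G M" by (auto simp: cocycles2_def)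
  then show "cocycles2 G M \<noteq> {}" by blast
next
  fix f assume f: "f \<in> cocycles2 G M"
  then have "inv\<^bsub>P\<^esub> f = (\<lambda>z\<in>carrier G \<times> carrier G. inv\<^bsub>M\<^esub> f z)"
    by (intro inv_product_group) (auto simp: cocycles2_def)
  also have "\<dots> \<in> cocycles2 G M"
    using f cocycle_app[OF f] by (auto simp: cocycles2_def M.inv_mult[symmetric] simp del: M.inv_mult)
  finally show "inv\<^bsub>P\<^esub> f \<in> cocycles2 G M" .
next
  fix f f' assume f: "f \<in> cocycles2 G M" "f' \<in> cocycles2 G M"
  have "f (h, k) \<otimes>\<^bsub>M\<^esub> f' (h, k) \<otimes>\<^bsub>M\<^esub> (f (g, h \<otimes>\<^bsub>G\<^esub> k) \<otimes>\<^bsub>M\<^esub> f' (g, h \<otimes>\<^bsub>G\<^esub> k)) =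
      f (g \<otimes>\<^bsub>G\<^esub> h, k) \<otimes>\<^bsub>M\<^esub> f' (g \<otimes>\<^bsub>G\<^esub> h, k) \<otimes>\<^bsub>M\<^esub> (f (g, h) \<otimes>\<^bsub>M\<^esub> f' (g, h))"
    if "g \<in> carrier G" "h \<in> carrier G" "k \<in> carrier G" for g h k
  proof -
    note cl = cocycle_app[OF f(1)] cocycle_app[OF f(2)] that G.m_closed
    have "f (h, k) \<otimes>\<^bsub>M\<^esub> f' (h, k) \<otimes>\<^bsub>M\<^esub> (f (g, h \<otimes>\<^bsub>G\<^esub> k) \<otimes>\<^bsub>M\<^esub> f' (g, h \<otimes>\<^bsub>G\<^esub> k)) =
      f (h, k) \<otimes>\<^bsub>M\<^esub> f (g, h \<otimes>\<^bsub>G\<^esub> k) \<otimes>\<^bsub>M\<^esub> (f' (h, k) \<otimes>\<^bsub>M\<^esub> f' (g, h \<otimes>\<^bsub>G\<^esub> k))"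
      by (rule m_inter) (simp_all add: cl)
    also have "f (h, k) \<otimes>\<^bsub>M\<^esub> f (g, h \<otimes>\<^bsub>G\<^esub> k) = f (g \<otimes>\<^bsub>G\<^esub> h, k) \<otimes>\<^bsub>M\<^esub> f (g, h)"
      using f that by (simp add: cocycles2_def)
    also have "f' (h, k) \<otimes>\<^bsub>M\<^esub> f' (g, h \<otimes>\<^bsub>G\<^esub> k) = f' (g \<otimes>\<^bsub>G\<^esub> h, k) \<otimes>\<^bsub>M\<^esub> f' (g, h)"
      using f that by (simp add: cocycles2_def)
    also have "f (g \<otimes>\<^bsub>G\<^esub> h, k) \<otimes>\<^bsub>M\<^esub> f (g, h) \<otimes>\<^bsub>M\<^esub> (f' (g \<otimes>\<^bsub>G\<^esub> h, k) \<otimes>\<^bsub>M\<^esub> f' (g, h))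
      = f (g \<otimes>\<^bsub>G\<^esub> h, k) \<otimes>\<^bsub>M\<^esub> f' (g \<otimes>\<^bsub>G\<^esub> h, k) \<otimes>\<^bsub>M\<^esub> (f (g, h) \<otimes>\<^bsub>M\<^esub> f' (g, h))"
      by (rule m_inter) (simp_all add: cl)
    finally show ?thesis .
  qed
  then show "f \<otimes>\<^bsub>P\<^esub> f' \<in> cocycles2 G M"
    using cocycle_app[OF f(1)] cocycle_app[OF f(2)] by (auto simp: cocycles2_def)
qed

private lemma coboundaries_cocycles: "coboundaries2 G M \<subseteq> cocycles2 G M"
proof
  fix f assume "f \<in> coboundaries2 G M"
  then obtain c where c: "c \<in> carrier G \<rightarrow> carrier M"
    and f: "f = (\<lambda>(g, h)\<in>carrier G \<times> carrier G. c g \<otimes>\<^bsub>M\<^esub> c h \<otimes>\<^bsub>M\<^esub> inv\<^bsub>M\<^esub> (c (g \<otimes>\<^bsub>G\<^esub> h)))"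
    by (auto simp: coboundaries2_def)
  have "(c h \<otimes>\<^bsub>M\<^esub> c k \<otimes>\<^bsub>M\<^esub> inv\<^bsub>M\<^esub> u) \<otimes>\<^bsub>M\<^esub> (c g \<otimes>\<^bsub>M\<^esub> u \<otimes>\<^bsub>M\<^esub> inv\<^bsub>M\<^esub> w)
      = (v \<otimes>\<^bsub>M\<^esub> c k \<otimes>\<^bsub>M\<^esub> inv\<^bsub>M\<^esub> w) \<otimes>\<^bsub>M\<^esub> (c g \<otimes>\<^bsub>M\<^esub> c h \<otimes>\<^bsub>M\<^esub> inv\<^bsub>M\<^esub> v)"
    if "c g \<in> carrier M" "c h \<in> carrier M" "c k \<in> carrier M" "u \<in> carrier M" "v \<in> carrier M" "w \<in> carrier M"
    for g h k u v w
  proof -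
    have "(c h \<otimes>\<^bsub>M\<^esub> c k \<otimes>\<^bsub>M\<^esub> inv\<^bsub>M\<^esub> u) \<otimes>\<^bsub>M\<^esub> (c g \<otimes>\<^bsub>M\<^esub> u \<otimes>\<^bsub>M\<^esub> inv\<^bsub>M\<^esub> w)
       = (inv\<^bsub>M\<^esub> u \<otimes>\<^bsub>M\<^esub> u) \<otimes>\<^bsub>M\<^esub> (c g \<otimes>\<^bsub>M\<^esub> c h \<otimes>\<^bsub>M\<^esub> c k \<otimes>\<^bsub>M\<^esub> inv\<^bsub>M\<^esub> w)"
      using that by (simp only: M.m_ac M.m_closed M.inv_closed)
    also have "\<dots> = (inv\<^bsub>M\<^esub> v \<otimes>\<^bsub>M\<^esub> v) \<otimes>\<^bsub>M\<^esub> (c g \<otimes>\<^bsub>M\<^esub> c h \<otimes>\<^bsub>M\<^esub> c k \<otimes>\<^bsub>M\<^esub> inv\<^bsub>M\<^esub> w)"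
      using that by simp
    also have "\<dots> = (v \<otimes>\<^bsub>M\<^esub> c k \<otimes>\<^bsub>M\<^esub> inv\<^bsub>M\<^esub> w) \<otimes>\<^bsub>M\<^esub> (c g \<otimes>\<^bsub>M\<^esub> c h \<otimes>\<^bsub>M\<^esub> inv\<^bsub>M\<^esub> v)"
      using that by (simp only: M.m_ac M.m_closed M.inv_closed)
    finally show ?thesis .
  qed
  then show "f \<in> cocycles2 G M"
    using c unfolding f cocycles2_def by (auto simp: Pi_iff G.m_assoc)
qed

private lemma subgroup_coboundaries: "subgroup (coboundaries2 G M) P"
proof (rule P.subgroupI)
  show "coboundaries2 G M \<subseteq> carrier P"
    using coboundaries_cocycles subgroup.subset[OF subgroup_cocycles] by blast
  show "coboundaries2 G M \<noteq> {}" unfolding coboundaries2_def by (auto intro: exI[of _ "\<lambda>_. \<one>\<^bsub>M\<^esub>"])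
next
  fix f assume f: "f \<in> coboundaries2 G M"
  then obtain c where c: "c \<in> carrier G \<rightarrow> carrier M"
    and f': "f = (\<lambda>(g, h)\<in>carrier G \<times> carrier G. c g \<otimes>\<^bsub>M\<^esub> c h \<otimes>\<^bsub>M\<^esub> inv\<^bsub>M\<^esub> (c (g \<otimes>\<^bsub>G\<^esub> h)))"
    by (auto simp: coboundaries2_def)
  have "inv\<^bsub>P\<^esub> f = (\<lambda>z\<in>carrier G \<times> carrier G. inv\<^bsub>M\<^esub> f z)"
    using f coboundaries_cocycles by (intro inv_product_group) (auto simp: cocycles2_def)
  also have "\<dots> = (\<lambda>(g, h)\<in>carrier G \<times> carrier G. inv\<^bsub>M\<^esub> c g \<otimes>\<^bsub>M\<^esub> inv\<^bsub>M\<^esub> c h \<otimes>\<^bsub>M\<^esub> inv\<^bsub>M\<^esub> (inv\<^bsub>M\<^esub> c (g \<otimes>\<^bsub>G\<^esub> h)))"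
    using c unfolding f' by (intro restrict_ext) (auto simp: Pi_iff M.inv_mult)
  also have "\<dots> \<in> coboundaries2 G M"
    using c unfolding coboundaries2_def by (auto intro!: exI[of _ "\<lambda>g. inv\<^bsub>M\<^esub> c g"])
  finally show "inv\<^bsub>P\<^esub> f \<in> coboundaries2 G M" .
next
  fix f f' assume "f \<in> coboundaries2 G M" "f' \<in> coboundaries2 G M"
  then obtain c c' where c: "c \<in> carrier G \<rightarrow> carrier M" "c' \<in> carrier G \<rightarrow> carrier M"
    and f: "f = (\<lambda>(g, h)\<in>carrier G \<times> carrier G. c g \<otimes>\<^bsub>M\<^esub> c h \<otimes>\<^bsub>M\<^esub> inv\<^bsub>M\<^esub> (c (g \<otimes>\<^bsub>G\<^esub> h)))"
    "f' = (\<lambda>(g, h)\<in>carrier G \<times> carrier G. c' g \<otimes>\<^bsub>M\<^esub> c' h \<otimes>\<^bsub>M\<^esub> inv\<^bsub>M\<^esub> (c' (g \<otimes>\<^bsub>G\<^esub> h)))"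
    by (auto simp: coboundaries2_def)
  have "f \<otimes>\<^bsub>P\<^esub> f' = (\<lambda>(g, h)\<in>carrier G \<times> carrier G. (c g \<otimes>\<^bsub>M\<^esub> c' g) \<otimes>\<^bsub>M\<^esub> (c h \<otimes>\<^bsub>M\<^esub> c' h)
      \<otimes>\<^bsub>M\<^esub> inv\<^bsub>M\<^esub> (c (g \<otimes>\<^bsub>G\<^esub> h) \<otimes>\<^bsub>M\<^esub> c' (g \<otimes>\<^bsub>G\<^esub> h)))"
    using c unfolding f mult_product_group
    by (intro restrict_ext) (auto simp: Pi_iff M.inv_mult m_inter)
  also have "\<dots> \<in> coboundaries2 G M"
    using c unfolding coboundaries2_def by (auto intro!: exI[of _ "\<lambda>g. c g \<otimes>\<^bsub>M\<^esub> c' g"])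
  finally show "f \<otimes>\<^bsub>P\<^esub> f' \<in> coboundaries2 G M" .
qed

lemma comm_group_Z2: "comm_group (Z2 G M)"
proof (rule group.group_comm_groupI)
  show "group (Z2 G M)" unfolding Z2_def
    by (rule subgroup.subgroup_is_group[OF subgroup_cocycles P.group_axioms])
  fix f f' assume "f \<in> carrier (Z2 G M)" "f' \<in> carrier (Z2 G M)"
  then have "f \<in> carrier P" "f' \<in> carrier P"
    using subgroup.subset[OF subgroup_cocycles] by (auto simp: Z2_def)
  then show "f \<otimes>\<^bsub>Z2 G M\<^esub> f' = f' \<otimes>\<^bsub>Z2 G M\<^esub> f"
    using P.m_comm by (simp add: Z2_def)
qed

lemma subgroup_coboundaries2: "subgroup (coboundaries2 G M) (Z2 G M)"
  unfolding Z2_def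
  by (rule P.subgroup_incl[OF subgroup_coboundaries subgroup_cocycles coboundaries_cocycles])

lemma comm_group_H2: "comm_group (H2 G M)"
  unfolding H2_def by (rule comm_group.abelian_FactGroup[OF comm_group_Z2 subgroup_coboundaries2])

end

lemma res2_coset:
  assumes G: "group G" and M: "comm_group M" and A: "subgroup A G" and f: "f \<in> cocycles2 G M"
  shows "res2 G M A (coboundaries2 G M #>\<^bsub>Z2 G M\<^esub> f)
    = coboundaries2 (G\<lparr>carrier := A\<rparr>) M #>\<^bsub>Z2 (G\<lparr>carrier := A\<rparr>) M\<^esub> restrict f (A \<times> A)"
proof -
  let ?A = "G\<lparr>carrier := A\<rparr>"
  have GA: "group ?A" by (rule subgroup.subgroup_is_group[OF A G])
  interpret ZA: comm_group "Z2 ?A M" by (rule comm_group_Z2[OF GA M])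
  interpret ZG: comm_group "Z2 G M" by (rule comm_group_Z2[OF G M])
  have sub: "A \<subseteq> carrier G" by (rule subgroup.subset[OF A])
  have cl: "x \<in> A \<Longrightarrow> y \<in> A \<Longrightarrow> x \<otimes>\<^bsub>G\<^esub> y \<in> A" for x y by (rule subgroup.m_closed[OF A])
  have r: "restrict f' (A \<times> A) \<in> carrier (Z2 ?A M)" if "f' \<in> cocycles2 G M" for f'
    using that sub cl by (auto simp: Z2_def cocycles2_def subset_iff)
  have b: "restrict f' (A \<times> A) \<in> coboundaries2 ?A M" if "f' \<in> coboundaries2 G M" for f'
  proof -
    obtain c where c: "c \<in> carrier G \<rightarrow> carrier M"
      and f': "f' = (\<lambda>(g, h)\<in>carrier G \<times> carrier G. c g \<otimes>\<^bsub>M\<^esub> c h \<otimes>\<^bsub>M\<^esub> inv\<^bsub>M\<^esub> (c (g \<otimes>\<^bsub>G\<^esub> h)))"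
      using \<open>f' \<in> coboundaries2 G M\<close> by (auto simp: coboundaries2_def)
    have "restrict f' (A \<times> A) = (\<lambda>(g, h)\<in>A \<times> A. c g \<otimes>\<^bsub>M\<^esub> c h \<otimes>\<^bsub>M\<^esub> inv\<^bsub>M\<^esub> (c (g \<otimes>\<^bsub>G\<^esub> h)))"
      using sub unfolding f' by (intro restrict_ext) auto
    then show ?thesis using c sub unfolding coboundaries2_def by (auto intro!: exI[of _ c])
  qed
  have sB: "subgroup (coboundaries2 ?A M) (Z2 ?A M)" by (rule subgroup_coboundaries2[OF GA M])
  have eq: "coboundaries2 ?A M #>\<^bsub>Z2 ?A M\<^esub> restrict f' (A \<times> A) = coboundaries2 ?A M #>\<^bsub>Z2 ?A M\<^esub> restrict f (A \<times> A)"
    if ff: "f' \<in> coboundaries2 G M #>\<^bsub>Z2 G M\<^esub> f" for f'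
  proof -
    obtain k where k: "k \<in> coboundaries2 G M" "f' = k \<otimes>\<^bsub>Z2 G M\<^esub> f"
      using ff unfolding r_coset_def by blast
    have "restrict f' (A \<times> A) = restrict k (A \<times> A) \<otimes>\<^bsub>Z2 ?A M\<^esub> restrict f (A \<times> A)"
      using sub unfolding k(2) by (auto simp: Z2_def restrict_def fun_eq_iff)
    then have "restrict f' (A \<times> A) \<in> coboundaries2 ?A M #>\<^bsub>Z2 ?A M\<^esub> restrict f (A \<times> A)"
      using b[OF k(1)] by (auto simp: r_coset_def)
    from ZA.repr_independence[OF this r[OF f] sB] show ?thesis by simp
  qed
  have "f \<in> coboundaries2 G M #>\<^bsub>Z2 G M\<^esub> f"
    using f by (intro ZG.rcos_self subgroup_coboundaries2[OF G M]) (simp add: Z2_def)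
  with eq show ?thesis unfolding res2_def by blast
qed

lemma res2_hom:
  assumes G: "group G" and M: "comm_group M" and A: "subgroup A G"
  shows "res2 G M A \<in> hom (H2 G M) (H2 (G\<lparr>carrier := A\<rparr>) M)"
proof -
  let ?A = "G\<lparr>carrier := A\<rparr>"
  have GA: "group ?A" by (rule subgroup.subgroup_is_group[OF A G])
  interpret NG: normal "coboundaries2 G M" "Z2 G M"
    by (rule comm_group.subgroup_imp_normal[OF comm_group_Z2[OF G M] subgroup_coboundaries2[OF G M]])
  interpret NA: normal "coboundaries2 ?A M" "Z2 ?A M"
    by (rule comm_group.subgroup_imp_normal[OF comm_group_Z2[OF GA M] subgroup_coboundaries2[OF GA M]])
  have sub: "A \<subseteq> carrier G" by (rule subgroup.subset[OF A])
  have cl: "x \<in> A \<Longrightarrow> y \<in> A \<Longrightarrow> x \<otimes>\<^bsub>G\<^esub> y \<in> A" for x y by (rule subgroup.m_closed[OF A])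
  have r: "restrict f (A \<times> A) \<in> carrier (Z2 ?A M)" if "f \<in> carrier (Z2 G M)" for f
    using that sub cl by (auto simp: Z2_def cocycles2_def subset_iff)
  have c: "f \<in> carrier (Z2 G M) \<longleftrightarrow> f \<in> cocycles2 G M" for f by (simp add: Z2_def)
  show ?thesis
  proof (rule homI)
    fix x assume "x \<in> carrier (H2 G M)"
    then obtain f where f: "f \<in> carrier (Z2 G M)" "x = coboundaries2 G M #>\<^bsub>Z2 G M\<^esub> f"
      by (auto simp: H2_def carrier_FactGroup)
    show "res2 G M A x \<in> carrier (H2 ?A M)"
      using f r res2_coset[OF G M A, of f] by (auto simp: H2_def carrier_FactGroup c)
  next
    fix x y assume "x \<in> carrier (H2 G M)" "y \<in> carrier (H2 G M)"
    then obtain f g where f: "f \<in> carrier (Z2 G M)" "x = coboundaries2 G M #>\<^bsub>Z2 G M\<^esub> f"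
      and g: "g \<in> carrier (Z2 G M)" "y = coboundaries2 G M #>\<^bsub>Z2 G M\<^esub> g"
      by (auto simp: H2_def carrier_FactGroup)
    have fg: "f \<otimes>\<^bsub>Z2 G M\<^esub> g \<in> carrier (Z2 G M)" using f g by simp
    have "restrict (f \<otimes>\<^bsub>Z2 G M\<^esub> g) (A \<times> A) = restrict f (A \<times> A) \<otimes>\<^bsub>Z2 ?A M\<^esub> restrict g (A \<times> A)"
      using sub by (auto simp: Z2_def restrict_def fun_eq_iff)
    then show "res2 G M A (x \<otimes>\<^bsub>H2 G M\<^esub> y) = res2 G M A x \<otimes>\<^bsub>H2 ?A M\<^esub> res2 G M A y"
      using f g fg r[OF f(1)] r[OF g(1)]
        res2_coset[OF G M A, of f] res2_coset[OF G M A, of g] res2_coset[OF G M A, of "f \<otimes>\<^bsub>Z2 G M\<^esub> g"]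
      by (simp add: H2_def NG.rcos_sum NA.rcos_sum c)
  qed
qed

lemma group_bogomolov_multiplier:
  assumes G: "group G"
  shows "group (bogomolov_multiplier G)"
proof -
  note M = comm_group_QmodZ
  interpret HG: comm_group "H2 G QmodZ" by (rule comm_group_H2[OF G M])
  have gh: "group_hom (H2 G QmodZ) (H2 (G\<lparr>carrier := A\<rparr>) QmodZ) (res2 G QmodZ A)" if "subgroup A G" for A
  proof -
    have "comm_group (H2 (G\<lparr>carrier := A\<rparr>) QmodZ)"
      by (rule comm_group_H2[OF subgroup.subgroup_is_group[OF that G] M])
    then show ?thesis using res2_hom[OF G M that] HG.group_axioms
      by (simp add: group_hom_def group_hom_axioms_def comm_group_def)
  qed
  have "subgroup {\<xi> \<in> carrier (H2 G QmodZ). \<forall>A. subgroup A G \<and> comm_group (G\<lparr>carrier := A\<rparr>) \<longrightarrow>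
          res2 G QmodZ A \<xi> = \<one>\<^bsub>H2 (G\<lparr>carrier := A\<rparr>) QmodZ\<^esub>} (H2 G QmodZ)" (is "subgroup ?K _")
  proof (rule HG.subgroupI)
    show "?K \<noteq> {}" using group_hom.hom_one[OF gh] HG.one_closed by blast
  next
    fix x assume x: "x \<in> ?K"
    have "res2 G QmodZ A (inv\<^bsub>H2 G QmodZ\<^esub> x) = \<one>\<^bsub>H2 (G\<lparr>carrier := A\<rparr>) QmodZ\<^esub>"
      if A: "subgroup A G \<and> comm_group (G\<lparr>carrier := A\<rparr>)" for A
    proof -
      interpret h: group_hom "H2 G QmodZ" "H2 (G\<lparr>carrier := A\<rparr>) QmodZ" "res2 G QmodZ A" using gh A by blast
      have "x \<in> carrier (H2 G QmodZ)" "res2 G QmodZ A x = \<one>\<^bsub>H2 (G\<lparr>carrier := A\<rparr>) QmodZ\<^esub>" using x A by auto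
      then show ?thesis by (simp add: h.hom_inv)
    qed
    then show "inv\<^bsub>H2 G QmodZ\<^esub> x \<in> ?K" using x by auto
  next
    fix x y assume xy: "x \<in> ?K" "y \<in> ?K"
    have "res2 G QmodZ A (x \<otimes>\<^bsub>H2 G QmodZ\<^esub> y) = \<one>\<^bsub>H2 (G\<lparr>carrier := A\<rparr>) QmodZ\<^esub>"
      if A: "subgroup A G \<and> comm_group (G\<lparr>carrier := A\<rparr>)" for A
    proof -
      interpret h: group_hom "H2 G QmodZ" "H2 (G\<lparr>carrier := A\<rparr>) QmodZ" "res2 G QmodZ A" using gh A by blast
      have "x \<in> carrier (H2 G QmodZ)" "res2 G QmodZ A x = \<one>\<^bsub>H2 (G\<lparr>carrier := A\<rparr>) QmodZ\<^esub>"
        "y \<in> carrier (H2 G QmodZ)" "res2 G QmodZ A y = \<one>\<^bsub>H2 (G\<lparr>carrier := A\<rparr>) QmodZ\<^esub>" using xy A by auto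
      then show ?thesis by (simp add: h.hom_mult)
    qed
    then show "x \<otimes>\<^bsub>H2 G QmodZ\<^esub> y \<in> ?K" using xy by auto
  qed auto
  then show ?thesis unfolding bogomolov_multiplier_def
    by (rule subgroup.subgroup_is_group[OF _ HG.group_axioms])
qed


section \<open>The exterior square of a coordinate space over a prime field\<close>

abbreviation Fp :: "nat \<Rightarrow> int ring" where
  "Fp p \<equiv> residue_ring (int p)"

definition Vspace :: "nat \<Rightarrow> nat \<Rightarrow> (int, nat \<Rightarrow> int) module" where
  "Vspace p d = ring.func_space (Fp p) {..<d}"

definition pairs :: "nat \<Rightarrow> (nat \<times> nat) set" where
  "pairs d = {(i, j). i < j \<and> j < d}"

text \<open>An element \<open>a\<close> of the exterior square stands for the sum of
  \<open>a (i, j) (e\<^sub>i \<and> e\<^sub>j)\<close> over \<open>i < j < d\<close>.\<close>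
definition Wspace :: "nat \<Rightarrow> nat \<Rightarrow> (int, nat \<times> nat \<Rightarrow> int) module" where
  "Wspace p d = ring.func_space (Fp p) (pairs d)"

definition wedge :: "nat \<Rightarrow> nat \<Rightarrow> (nat \<Rightarrow> int) \<Rightarrow> (nat \<Rightarrow> int) \<Rightarrow> (nat \<times> nat \<Rightarrow> int)" where
  "wedge p d v w = (\<lambda>(i, j)\<in>pairs d.
     v i \<otimes>\<^bsub>Fp p\<^esub> w j \<ominus>\<^bsub>Fp p\<^esub> v j \<otimes>\<^bsub>Fp p\<^esub> w i)"

definition Gr :: "nat \<Rightarrow> nat \<Rightarrow> nat \<Rightarrow> (nat \<times> nat \<Rightarrow> int) set set" where
  "Gr p d r = {L. VectorSpace.subspace (Fp p) L (Wspace p d) \<and>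
     vectorspace.dim (Fp p) ((Wspace p d)\<lparr>carrier := L\<rparr>) = r}"


section \<open>The free group of class two and odd exponent, and its central quotients\<close>

text \<open>The free group of class two and exponent \<open>p\<close>, for odd \<open>p\<close>, in its Baer model on
  \<open>V \<times> W\<close>: the residue \<open>(p + 1) div 2\<close> is the inverse of two. That this is the relatively free
  group is proved below (\<open>free2_universal\<close>), and the commutator map sends
  \<open>(v, a), (w, b)\<close> to \<open>(0, v \<and> w)\<close> (\<open>free2_commutator\<close>, \<open>free2_derived\<close>).\<close>
definition free2 :: "nat \<Rightarrow> nat \<Rightarrow> ((nat \<Rightarrow> int) \<times> (nat \<times> nat \<Rightarrow> int)) monoid" where
  "free2 p d = \<lparr>carrier = carrier (Vspace p d) \<times> carrier (Wspace p d),
     monoid.mult = (\<lambda>(v, a) (w, b). (v \<oplus>\<^bsub>Vspace p d\<^esub> w,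
        a \<oplus>\<^bsub>Wspace p d\<^esub> b \<oplus>\<^bsub>Wspace p d\<^esub> int ((p + 1) div 2) \<odot>\<^bsub>Wspace p d\<^esub> wedge p d v w)),
     one = (\<zero>\<^bsub>Vspace p d\<^esub>, \<zero>\<^bsub>Wspace p d\<^esub>)\<rparr>"

definition commutator :: "('g, 'x) monoid_scheme \<Rightarrow> 'g \<Rightarrow> 'g \<Rightarrow> 'g" where
  "commutator G x y = x \<otimes>\<^bsub>G\<^esub> y \<otimes>\<^bsub>G\<^esub> inv\<^bsub>G\<^esub> x \<otimes>\<^bsub>G\<^esub> inv\<^bsub>G\<^esub> y"

text \<open>Class at most two and exponent dividing \<open>p\<close>.\<close>
definition class2_exponent :: "nat \<Rightarrow> ('g, 'x) monoid_scheme \<Rightarrow> bool" where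
  "class2_exponent p G \<longleftrightarrow> group G \<and> (\<forall>x\<in>carrier G. x [^]\<^bsub>G\<^esub> p = \<one>\<^bsub>G\<^esub>) \<and>
     (\<forall>x\<in>carrier G. \<forall>y\<in>carrier G. \<forall>z\<in>carrier G.
        commutator G x y \<otimes>\<^bsub>G\<^esub> z = z \<otimes>\<^bsub>G\<^esub> commutator G x y)"

definition free2_gen :: "nat \<Rightarrow> nat \<Rightarrow> nat \<Rightarrow> (nat \<Rightarrow> int) \<times> (nat \<times> nat \<Rightarrow> int)" where
  "free2_gen p d i = (\<lambda>k\<in>{..<d}. if k = i then \<one>\<^bsub>Fp p\<^esub> else \<zero>\<^bsub>Fp p\<^esub>, \<zero>\<^bsub>Wspace p d\<^esub>)"

lemma Fp_simps:
  "carrier (Fp p) = {0..int p - 1}" "x \<oplus>\<^bsub>Fp p\<^esub> y = (x + y) mod int p"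
  "x \<otimes>\<^bsub>Fp p\<^esub> y = (x * y) mod int p" "\<zero>\<^bsub>Fp p\<^esub> = 0" "\<one>\<^bsub>Fp p\<^esub> = 1"
  by (simp_all add: residue_ring_def)

lemma Fp_minus: "p > 1 \<Longrightarrow> x \<ominus>\<^bsub>Fp p\<^esub> y = (x - y) mod int p"
proof -
  assume "p > 1"
  then interpret residues "int p" "Fp p" by unfold_locales auto
  show ?thesis by (simp add: a_minus_def res_neg_eq res_add_eq mod_simps)
qed

lemma ring_Fp: "p > 1 \<Longrightarrow> ring (Fp p)"
  using residues.cring[of "int p"] by (simp add: residues_def cring_def)

lemmas space_simps [simp] = Vspace_def Wspace_def

lemma Vspace_simps:
  assumes "p > 1"
  shows "carrier (Vspace p d) = {..<d} \<rightarrow>\<^sub>E {0..int p - 1}"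
    "v \<oplus>\<^bsub>Vspace p d\<^esub> w = (\<lambda>i\<in>{..<d}. (v i + w i) mod int p)"
    "\<zero>\<^bsub>Vspace p d\<^esub> = (\<lambda>i\<in>{..<d}. 0)"
    "c \<odot>\<^bsub>Vspace p d\<^esub> v = (\<lambda>i\<in>{..<d}. (c * v i) mod int p)"
  by (simp_all add: Vspace_def ring.func_space_def[OF ring_Fp[OF assms]] Fp_simps)

lemma Wspace_simps:
  assumes "p > 1"
  shows "carrier (Wspace p d) = pairs d \<rightarrow>\<^sub>E {0..int p - 1}"
    "a \<oplus>\<^bsub>Wspace p d\<^esub> b = (\<lambda>i\<in>pairs d. (a i + b i) mod int p)"
    "\<zero>\<^bsub>Wspace p d\<^esub> = (\<lambda>i\<in>pairs d. 0)"
    "c \<odot>\<^bsub>Wspace p d\<^esub> a = (\<lambda>i\<in>pairs d. (c * a i) mod int p)"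
  by (simp_all add: Wspace_def ring.func_space_def[OF ring_Fp[OF assms]] Fp_simps)

lemma wedge_eq:
  assumes "p > 1"
  shows "wedge p d v w = (\<lambda>(i, j)\<in>pairs d. (v i * w j - v j * w i) mod int p)"
  by (simp add: wedge_def Fp_minus[OF assms] Fp_simps mod_simps split_def restrict_def cong: if_cong)

declare space_simps [simp del]

lemma half_mod: "odd p \<Longrightarrow> (2 * int ((p + 1) div 2) * t) mod int p = t mod int p"
proof -
  assume "odd p"
  then have "2 * int ((p + 1) div 2) = int p + 1" by (auto elim!: oddE)
  then have "2 * int ((p + 1) div 2) * t = t + int p * t" by (simp add: algebra_simps)
  then show ?thesis by simp
qed

lemma free2_carrier: "p > 1 \<Longrightarrow>
  carrier (free2 p d) = ({..<d} \<rightarrow>\<^sub>E {0..int p - 1}) \<times> (pairs d \<rightarrow>\<^sub>E {0..int p - 1})"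
  by (simp add: free2_def Vspace_simps Wspace_simps)

lemma free2_one: "p > 1 \<Longrightarrow> \<one>\<^bsub>free2 p d\<^esub> = (\<lambda>i\<in>{..<d}. 0, \<lambda>i\<in>pairs d. 0)"
  by (simp add: free2_def Vspace_simps Wspace_simps)

lemma pairs_bound: "(i, j) \<in> pairs d \<Longrightarrow> i < d \<and> j < d \<and> i < j"
  by (auto simp: pairs_def)

lemma free2_mult:
  assumes "p > 1"
  shows "(v, a) \<otimes>\<^bsub>free2 p d\<^esub> (w, b) = (\<lambda>i\<in>{..<d}. (v i + w i) mod int p,
     \<lambda>(i, j)\<in>pairs d. (a (i, j) + b (i, j) + int ((p + 1) div 2) * (v i * w j - v j * w i)) mod int p)"
  by (auto simp: free2_def Vspace_simps[OF assms] Wspace_simps[OF assms] wedge_eq[OF assms]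
      mod_simps intro!: restrict_ext)

lemma bil_mod:
  fixes p :: int
  shows "(s mod p + c + h * ((x mod p) * u - (y mod p) * t)) mod p = (s + c + h * (x * u - y * t)) mod p"
    "(c + s mod p + h * (t * (y mod p) - u * (x mod p))) mod p = (c + s + h * (t * y - u * x)) mod p"
  unfolding cong_def[symmetric]
  by (intro cong_add cong_diff cong_mult cong_refl; simp add: cong_def)+

lemma mod_range: "p > 1 \<Longrightarrow> x mod int p \<in> {0..int p - 1}"
  by simp

lemma restrict_mod_id:
  "p > 1 \<Longrightarrow> f \<in> I \<rightarrow>\<^sub>E {0..int p - 1} \<Longrightarrow> (\<lambda>i\<in>I. f i mod int p) = f"
  by (rule ext) (auto simp: PiE_iff extensional_def restrict_def)

lemma free2_group:
  assumes p: "p > 1"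
  shows "group (free2 p d)"
proof (rule groupI)
  fix x y assume "x \<in> carrier (free2 p d)" "y \<in> carrier (free2 p d)"
  then show "x \<otimes>\<^bsub>free2 p d\<^esub> y \<in> carrier (free2 p d)"
    using p by (cases x; cases y)
      (auto simp: free2_mult free2_carrier intro!: restrict_PiE_iff[THEN iffD2] split: prod.split)
next
  show "\<one>\<^bsub>free2 p d\<^esub> \<in> carrier (free2 p d)"
    using p by (auto simp: free2_one free2_carrier)
next
  fix x y z assume "x \<in> carrier (free2 p d)" "y \<in> carrier (free2 p d)" "z \<in> carrier (free2 p d)"
  show "x \<otimes>\<^bsub>free2 p d\<^esub> y \<otimes>\<^bsub>free2 p d\<^esub> z = x \<otimes>\<^bsub>free2 p d\<^esub> (y \<otimes>\<^bsub>free2 p d\<^esub> z)"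
    by (cases x; cases y; cases z)
       (simp only: free2_mult[OF p] prod.inject, intro conjI restrict_ext;
        clarify?; simp add: bil_mod pairs_bound mod_simps; simp add: algebra_simps)
next
  fix x assume "x \<in> carrier (free2 p d)"
  then obtain v a where x: "x = (v, a)" "v \<in> {..<d} \<rightarrow>\<^sub>E {0..int p - 1}" "a \<in> pairs d \<rightarrow>\<^sub>E {0..int p - 1}"
    by (cases x) (auto simp: free2_carrier[OF p])
  have "\<one>\<^bsub>free2 p d\<^esub> \<otimes>\<^bsub>free2 p d\<^esub> x = (\<lambda>i\<in>{..<d}. v i mod int p, \<lambda>x\<in>pairs d. a x mod int p)"
    apply (simp only: x free2_mult[OF p] free2_one[OF p] prod.inject)
    apply (intro conjI restrict_ext; clarify?; simp add: pairs_bound)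
    done
  then show "\<one>\<^bsub>free2 p d\<^esub> \<otimes>\<^bsub>free2 p d\<^esub> x = x"
    by (simp only: restrict_mod_id[OF p x(2)] restrict_mod_id[OF p x(3)] x(1))
next
  fix x assume "x \<in> carrier (free2 p d)"
  then obtain v a where x: "x = (v, a)" "v \<in> {..<d} \<rightarrow>\<^sub>E {0..int p - 1}" "a \<in> pairs d \<rightarrow>\<^sub>E {0..int p - 1}"
    by (cases x) (auto simp: free2_carrier[OF p])
  let ?y = "(\<lambda>i\<in>{..<d}. (- v i) mod int p, \<lambda>i\<in>pairs d. (- a i) mod int p)"
  have "?y \<in> carrier (free2 p d)" using p by (auto simp: free2_carrier)
  moreover have "?y \<otimes>\<^bsub>free2 p d\<^esub> x = \<one>\<^bsub>free2 p d\<^esub>"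
    apply (simp only: x free2_mult[OF p] free2_one[OF p] prod.inject)
    apply (intro conjI restrict_ext; clarify?)
    apply (simp add: mod_simps)
    subgoal for i j
      using bil_mod(1)[of "- a (i, j)" "int p" "a (i, j)" "int ((p + 1) div 2)" "- v i" "v j" "- v j" "v i"]
      by (simp add: pairs_bound algebra_simps)
    done
  ultimately show "\<exists>y\<in>carrier (free2 p d). y \<otimes>\<^bsub>free2 p d\<^esub> x = \<one>\<^bsub>free2 p d\<^esub>" by blast
qed

lemma free2_pow:
  assumes p: "p > 1" and x: "(v, a) \<in> carrier (free2 p d)"
  shows "(v, a) [^]\<^bsub>free2 p d\<^esub> (n::nat)
    = (\<lambda>i\<in>{..<d}. (int n * v i) mod int p, \<lambda>(i, j)\<in>pairs d. (int n * a (i, j)) mod int p)"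
proof (induction n)
  case 0
  then show ?case using group.is_monoid[OF free2_group[OF p]]
    by (auto simp: free2_one[OF p] monoid.nat_pow_0 intro!: restrict_ext)
next
  case (Suc n)
  have "(v, a) [^]\<^bsub>free2 p d\<^esub> Suc n = (v, a) [^]\<^bsub>free2 p d\<^esub> n \<otimes>\<^bsub>free2 p d\<^esub> (v, a)"
    using group.is_monoid[OF free2_group[OF p], of d] by (simp add: monoid.nat_pow_Suc)
  also have "\<dots> = (\<lambda>i\<in>{..<d}. (int (Suc n) * v i) mod int p, \<lambda>(i, j)\<in>pairs d. (int (Suc n) * a (i, j)) mod int p)"
    unfolding Suc.IH
    by (simp only: free2_mult[OF p] prod.inject, intro conjI restrict_ext;
        clarify?; simp add: bil_mod pairs_bound mod_simps; simp add: algebra_simps)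
  finally show ?case .
qed

lemma free2_commutator:
  assumes p: "odd p" "p > 1" and x: "(v, a) \<in> carrier (free2 p d)" and y: "(w, b) \<in> carrier (free2 p d)"
  shows "commutator (free2 p d) (v, a) (w, b) = (\<zero>\<^bsub>Vspace p d\<^esub>, wedge p d v w)"
proof -
  interpret group "free2 p d" by (rule free2_group[OF p(2)])
  let ?c = "(\<zero>\<^bsub>Vspace p d\<^esub>, wedge p d v w)"
  have c: "?c \<in> carrier (free2 p d)"
    using p(2) by (auto simp: Vspace_simps wedge_eq free2_carrier split: prod.split)
  have *: "(s + int ((p + 1) div 2) * t) mod int p = (s + (t - int ((p + 1) div 2) * t)) mod int p" for s t
  proof -
    have "(s + int ((p + 1) div 2) * t) - (s + (t - int ((p + 1) div 2) * t)) = 2 * int ((p + 1) div 2) * t - t"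
      by (simp only: algebra_simps mult_2)
    moreover have "int p dvd 2 * int ((p + 1) div 2) * t - t"
      using half_mod[OF p(1), of t] by (simp only: mod_eq_dvd_iff)
    ultimately show ?thesis by (simp only: mod_eq_dvd_iff)
  qed
  have "(v, a) \<otimes>\<^bsub>free2 p d\<^esub> (w, b) = ?c \<otimes>\<^bsub>free2 p d\<^esub> ((w, b) \<otimes>\<^bsub>free2 p d\<^esub> (v, a))"
    using *[of "a (i, j) + b (i, j)" "v i * w j - v j * w i" for i j]
    apply (simp only: free2_mult[OF p(2)] Vspace_simps[OF p(2)] wedge_eq[OF p(2)] prod.inject)
    apply (intro conjI restrict_ext; clarify?)
     apply (simp add: mod_simps add.commute)
    apply (simp add: pairs_bound mod_simps)
    apply (simp add: algebra_simps)
    done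
  then show ?thesis unfolding commutator_def
    using c x y by (simp add: inv_solve_right' m_assoc)
qed

lemma free2_class2_exponent:
  assumes p: "odd p" "p > 1"
  shows "class2_exponent p (free2 p d)"
  unfolding class2_exponent_def
proof (intro conjI ballI)
  show "group (free2 p d)" by (rule free2_group[OF p(2)])
next
  fix x assume "x \<in> carrier (free2 p d)"
  then show "x [^]\<^bsub>free2 p d\<^esub> p = \<one>\<^bsub>free2 p d\<^esub>"
    by (cases x) (auto simp: free2_pow[OF p(2)] free2_one[OF p(2)])
next
  fix x y z assume "x \<in> carrier (free2 p d)" "y \<in> carrier (free2 p d)" "z \<in> carrier (free2 p d)"
  then show "commutator (free2 p d) x y \<otimes>\<^bsub>free2 p d\<^esub> z = z \<otimes>\<^bsub>free2 p d\<^esub> commutator (free2 p d) x y"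
    apply (cases x; cases y; cases z)
    apply (simp only: free2_commutator[OF p] free2_mult[OF p(2)] Vspace_simps[OF p(2)] prod.inject)
    apply (intro conjI restrict_ext; clarify?; simp add: pairs_bound algebra_simps)
    done
qed

lemma finite_pairs: "finite (pairs d)"
  by (rule finite_subset[of _ "{..<d} \<times> {..<d}"]) (auto simp: pairs_def)

lemma free2_central_gen:
  assumes p: "odd p" "p > 1" and S: "subgroup S (free2 p d)"
    and g: "\<And>i j. (i, j) \<in> pairs d \<Longrightarrow> commutator (free2 p d) (free2_gen p d i) (free2_gen p d j) \<in> S"
    and a: "a \<in> carrier (Wspace p d)"
  shows "(\<zero>\<^bsub>Vspace p d\<^esub>, a) \<in> S"
proof -
  interpret group "free2 p d" by (rule free2_group[OF p(2)])
  have aW: "a \<in> pairs d \<rightarrow>\<^sub>E {0..int p - 1}" using a p by (simp add: Wspace_simps)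
  have e: "(\<zero>\<^bsub>Vspace p d\<^esub>, \<lambda>x\<in>pairs d. if x = y then 1 else 0) \<in> S" if y: "y \<in> pairs d" for y
  proof -
    obtain i j where [simp]: "y = (i, j)" by (cases y)
    have c: "free2_gen p d k \<in> carrier (free2 p d)" if "k < d" for k
      using p(2) that by (auto simp: free2_gen_def free2_carrier Fp_simps Wspace_simps)
    have "i < d" "j < d" "i < j" using y by (auto simp: pairs_def)
    then have "commutator (free2 p d) (free2_gen p d i) (free2_gen p d j) =
       (\<zero>\<^bsub>Vspace p d\<^esub>, wedge p d (\<lambda>k\<in>{..<d}. if k = i then 1 else 0) (\<lambda>k\<in>{..<d}. if k = j then 1 else 0))"
      using c[of i] c[of j] free2_commutator[OF p] unfolding free2_gen_def Fp_simps by simp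
    also have "wedge p d (\<lambda>k\<in>{..<d}. if k = i then 1 else 0) (\<lambda>k\<in>{..<d}. if k = j then 1 else 0)
       = (\<lambda>x\<in>pairs d. if x = y then 1 else 0)"
      unfolding wedge_eq[OF p(2)] using \<open>i < j\<close> p(2)
      by (intro restrict_ext) (auto simp: pairs_def split: if_splits)
    finally have q: "commutator (free2 p d) (free2_gen p d i) (free2_gen p d j) =
       (\<zero>\<^bsub>Vspace p d\<^esub>, \<lambda>x\<in>pairs d. if x = y then 1 else 0)" .
    have "(i, j) \<in> pairs d" using y by simp
    from g[OF this] show ?thesis by (simp only: q)
  qed
  have "(\<zero>\<^bsub>Vspace p d\<^esub>, \<lambda>x\<in>pairs d. if x \<in> J then a x else 0) \<in> S" if "finite J" "J \<subseteq> pairs d" for J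
    using that
  proof (induction J rule: finite_induct)
    case empty
    have "(\<lambda>x\<in>pairs d. if x \<in> {} then a x else 0) = (\<lambda>x\<in>pairs d. 0)" by (intro restrict_ext) simp
    then show ?case using subgroup.one_closed[OF S] unfolding free2_one[OF p(2)] Vspace_simps[OF p(2)] by metis
  next
    case (insert y J)
    have y: "y \<in> pairs d" "0 \<le> a y" "a y < int p" using insert.prems aW by (auto simp: PiE_iff)
    have eF: "(\<zero>\<^bsub>Vspace p d\<^esub>, \<lambda>x\<in>pairs d. if x = y then 1 else 0) \<in> carrier (free2 p d)"
      using e[OF y(1)] subgroup.subset[OF S] by blast
    have "(\<zero>\<^bsub>Vspace p d\<^esub>, \<lambda>x\<in>pairs d. if x = y then 1 else 0) [^]\<^bsub>free2 p d\<^esub> nat (a y) \<in> S"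
      using e[OF y(1)] S by (rule_tac subgroup_int_pow_closed[where k="int (nat (a y))", unfolded int_pow_int])
    also have "(\<zero>\<^bsub>Vspace p d\<^esub>, \<lambda>x\<in>pairs d. if x = y then 1 else 0) [^]\<^bsub>free2 p d\<^esub> nat (a y)
       = (\<zero>\<^bsub>Vspace p d\<^esub>, \<lambda>x\<in>pairs d. if x = y then a y else 0)"
      unfolding free2_pow[OF p(2) eF] using y
      by (auto simp: Vspace_simps[OF p(2)] intro!: restrict_ext)
    finally have 1: "(\<zero>\<^bsub>Vspace p d\<^esub>, \<lambda>x\<in>pairs d. if x = y then a y else 0) \<in> S" .
    have "(\<zero>\<^bsub>Vspace p d\<^esub>, \<lambda>x\<in>pairs d. if x \<in> J then a x else 0) \<otimes>\<^bsub>free2 p d\<^esub>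
      (\<zero>\<^bsub>Vspace p d\<^esub>, \<lambda>x\<in>pairs d. if x = y then a y else 0) \<in> S"
      using insert.IH insert.prems by (intro subgroup.m_closed[OF S _ 1]) blast
    also have "(\<zero>\<^bsub>Vspace p d\<^esub>, \<lambda>x\<in>pairs d. if x \<in> J then a x else 0) \<otimes>\<^bsub>free2 p d\<^esub>
      (\<zero>\<^bsub>Vspace p d\<^esub>, \<lambda>x\<in>pairs d. if x = y then a y else 0)
      = (\<zero>\<^bsub>Vspace p d\<^esub>, \<lambda>x\<in>pairs d. if x \<in> insert y J then a x else 0)"
      unfolding free2_mult[OF p(2)] Vspace_simps[OF p(2)] prod.inject
      using insert.hyps aW p(2) by (intro conjI restrict_ext; clarify?) (auto simp: pairs_bound PiE_iff)
    finally show ?case .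
  qed
  note this[OF finite_pairs order.refl]
  also have "(\<lambda>x\<in>pairs d. if x \<in> pairs d then a x else 0) = a"
    using aW by (intro ext) (auto simp: PiE_iff extensional_def)
  finally show ?thesis .
qed

lemma free2_gen_carrier: "p > 1 \<Longrightarrow> i < d \<Longrightarrow> free2_gen p d i \<in> carrier (free2 p d)"
  by (auto simp: free2_gen_def free2_carrier Fp_simps Wspace_simps)

lemma free2_generated:
  assumes p: "odd p" "p > 1"
  shows "generate (free2 p d) (free2_gen p d ` {..<d}) = carrier (free2 p d)"
proof
  interpret group "free2 p d" by (rule free2_group[OF p(2)])
  let ?S = "generate (free2 p d) (free2_gen p d ` {..<d})"
  have G: "free2_gen p d ` {..<d} \<subseteq> carrier (free2 p d)" using free2_gen_carrier[OF p(2)] by auto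
  have S: "subgroup ?S (free2 p d)" by (rule generate_is_subgroup[OF G])
  show "?S \<subseteq> carrier (free2 p d)" by (rule subgroup.subset[OF S])
  have gS: "free2_gen p d i \<in> ?S" if "i < d" for i using that by (auto intro: generate.incl)
  have "commutator (free2 p d) (free2_gen p d i) (free2_gen p d j) \<in> ?S" if "(i, j) \<in> pairs d" for i j
    unfolding commutator_def using that
    by (intro subgroup.m_closed[OF S] subgroup.m_inv_closed[OF S] gS) (auto simp: pairs_def)
  note Z = free2_central_gen[OF p S this]
  show "carrier (free2 p d) \<subseteq> ?S"
  proof
    fix y assume y: "y \<in> carrier (free2 p d)"
    obtain v a where va: "y = (v, a)" by (cases y)
    have v: "v \<in> {..<d} \<rightarrow>\<^sub>E {0..int p - 1}" and a: "a \<in> pairs d \<rightarrow>\<^sub>E {0..int p - 1}"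
      using y va p by (auto simp: free2_carrier)
    have "\<exists>b. (\<lambda>i\<in>{..<d}. if i < n then v i else 0, b) \<in> ?S" if "n \<le> d" for n
      using that
    proof (induction n)
      case 0
      have "(\<lambda>i\<in>{..<d}. if i < 0 then v i else 0) = (\<lambda>i\<in>{..<d}. 0)"
        by (intro restrict_ext) simp
      then show ?case using subgroup.one_closed[OF S] unfolding free2_one[OF p(2)] by metis
    next
      case (Suc n)
      have "n \<le> d" using Suc.prems by simp
      from Suc.IH[OF this] obtain b where b: "(\<lambda>i\<in>{..<d}. if i < n then v i else 0, b) \<in> ?S" by blast
      have n: "n < d" "0 \<le> v n" using Suc.prems v by (auto simp: PiE_iff)
      have gc: "(\<lambda>k\<in>{..<d}. if k = n then 1 else 0, \<zero>\<^bsub>Wspace p d\<^esub>) \<in> carrier (free2 p d)"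
        using free2_gen_carrier[OF p(2) n(1)] unfolding free2_gen_def Fp_simps .
      have "free2_gen p d n [^]\<^bsub>free2 p d\<^esub> nat (v n) \<in> ?S"
        using gS[OF n(1)] S by (rule_tac subgroup_int_pow_closed[where k="int (nat (v n))", unfolded int_pow_int])
      then obtain b' where b': "(\<lambda>i\<in>{..<d}. int (nat (v n)) * (\<lambda>k\<in>{..<d}. if k = n then 1 else 0) i mod int p, b') \<in> ?S"
        unfolding free2_gen_def Fp_simps free2_pow[OF p(2) gc] by blast
      from subgroup.m_closed[OF S b b'] obtain b'' where b'': "(\<lambda>i\<in>{..<d}. ((\<lambda>i\<in>{..<d}. if i < n then v i else 0) i
         + (\<lambda>i\<in>{..<d}. int (nat (v n)) * (\<lambda>k\<in>{..<d}. if k = n then 1 else 0) i mod int p) i) mod int p, b'') \<in> ?S"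
        unfolding free2_mult[OF p(2)] by blast
      also have "(\<lambda>i\<in>{..<d}. ((\<lambda>i\<in>{..<d}. if i < n then v i else 0) i
         + (\<lambda>i\<in>{..<d}. int (nat (v n)) * (\<lambda>k\<in>{..<d}. if k = n then 1 else 0) i mod int p) i) mod int p)
        = (\<lambda>i\<in>{..<d}. if i < Suc n then v i else 0)"
        using v p(2) n by (intro restrict_ext) (auto simp: PiE_iff less_Suc_eq)
      finally show ?case by blast
    qed
    from this[of d] obtain b where b: "(\<lambda>i\<in>{..<d}. if i < d then v i else 0, b) \<in> ?S" by auto
    have "(\<lambda>i\<in>{..<d}. if i < d then v i else 0) = v"
      using v by (intro ext) (auto simp: PiE_iff extensional_def)
    with b have b: "(v, b) \<in> ?S" by simp
    have "(\<lambda>x\<in>pairs d. (a x - b x) mod int p) \<in> carrier (Wspace p d)"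
      using p(2) by (auto simp: Wspace_simps)
    from subgroup.m_closed[OF S b Z[OF _ this]]
    have "(v, b) \<otimes>\<^bsub>free2 p d\<^esub> (\<zero>\<^bsub>Vspace p d\<^esub>, \<lambda>x\<in>pairs d. (a x - b x) mod int p) \<in> ?S" by blast
    also have "(v, b) \<otimes>\<^bsub>free2 p d\<^esub> (\<zero>\<^bsub>Vspace p d\<^esub>, \<lambda>x\<in>pairs d. (a x - b x) mod int p)
       = (\<lambda>i\<in>{..<d}. v i mod int p, \<lambda>x\<in>pairs d. a x mod int p)"
      unfolding free2_mult[OF p(2)] Vspace_simps[OF p(2)] prod.inject
      by (intro conjI restrict_ext; clarify?; simp add: pairs_bound mod_simps)
    also have "\<dots> = y" by (simp only: va restrict_mod_id[OF p(2) v] restrict_mod_id[OF p(2) a])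
    finally show "y \<in> ?S" .
  qed
qed

lemma free2_derived:
  assumes p: "odd p" "p > 1"
  shows "derived (free2 p d) (carrier (free2 p d)) = {\<zero>\<^bsub>Vspace p d\<^esub>} \<times> carrier (Wspace p d)"
proof
  interpret group "free2 p d" by (rule free2_group[OF p(2)])
  let ?D = "derived (free2 p d) (carrier (free2 p d))"
  have D: "subgroup ?D (free2 p d)"
    unfolding derived_def by (intro generate_is_subgroup derived_set_in_carrier) simp
  have "commutator (free2 p d) (free2_gen p d i) (free2_gen p d j) \<in> ?D" if "(i, j) \<in> pairs d" for i j
    using that free2_gen_carrier[OF p(2)] unfolding derived_def commutator_def
    by (intro generate.incl) (auto dest!: pairs_bound)
  from free2_central_gen[OF p D this]
  show "{\<zero>\<^bsub>Vspace p d\<^esub>} \<times> carrier (Wspace p d) \<subseteq> ?D" by auto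
  have "subgroup ({\<zero>\<^bsub>Vspace p d\<^esub>} \<times> carrier (Wspace p d)) (free2 p d)"
  proof (rule subgroupI)
    show "{\<zero>\<^bsub>Vspace p d\<^esub>} \<times> carrier (Wspace p d) \<subseteq> carrier (free2 p d)"
      using p(2) by (auto simp: free2_carrier Wspace_simps Vspace_simps split: if_splits)
    show "{\<zero>\<^bsub>Vspace p d\<^esub>} \<times> carrier (Wspace p d) \<noteq> {}" using p(2) by (auto simp: Wspace_simps PiE_eq_empty_iff)
  next
    fix x assume x: "x \<in> {\<zero>\<^bsub>Vspace p d\<^esub>} \<times> carrier (Wspace p d)"
    then obtain a where a: "x = (\<zero>\<^bsub>Vspace p d\<^esub>, a)" "a \<in> pairs d \<rightarrow>\<^sub>E {0..int p - 1}"
      using p(2) by (auto simp: Wspace_simps)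
    let ?y = "(\<zero>\<^bsub>Vspace p d\<^esub>, \<lambda>x\<in>pairs d. (- a x) mod int p)"
    have "?y \<otimes>\<^bsub>free2 p d\<^esub> x = \<one>\<^bsub>free2 p d\<^esub>"
      unfolding a free2_mult[OF p(2)] Vspace_simps[OF p(2)] free2_one[OF p(2)] prod.inject
      by (intro conjI restrict_ext; clarify?; simp add: pairs_bound mod_simps)
    moreover have "?y \<in> carrier (free2 p d)" "x \<in> carrier (free2 p d)"
      using p(2) a by (auto simp: free2_carrier Vspace_simps)
    ultimately have "inv\<^bsub>free2 p d\<^esub> x = ?y" by (intro inv_equality)
    then show "inv\<^bsub>free2 p d\<^esub> x \<in> {\<zero>\<^bsub>Vspace p d\<^esub>} \<times> carrier (Wspace p d)"
      using p(2) by (auto simp: Wspace_simps)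
  next
    fix x y assume "x \<in> {\<zero>\<^bsub>Vspace p d\<^esub>} \<times> carrier (Wspace p d)" "y \<in> {\<zero>\<^bsub>Vspace p d\<^esub>} \<times> carrier (Wspace p d)"
    then obtain a b where xy: "x = (\<zero>\<^bsub>Vspace p d\<^esub>, a)" "y = (\<zero>\<^bsub>Vspace p d\<^esub>, b)" by auto
    have "x \<otimes>\<^bsub>free2 p d\<^esub> y = (\<zero>\<^bsub>Vspace p d\<^esub>, \<lambda>x\<in>pairs d. (a x + b x) mod int p)"
      unfolding xy free2_mult[OF p(2)] Vspace_simps[OF p(2)] prod.inject
      by (intro conjI restrict_ext; clarify?; simp add: pairs_bound)
    then show "x \<otimes>\<^bsub>free2 p d\<^esub> y \<in> {\<zero>\<^bsub>Vspace p d\<^esub>} \<times> carrier (Wspace p d)"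
      using p(2) by (auto simp: Wspace_simps)
  qed
  moreover have "commutator (free2 p d) x y \<in> {\<zero>\<^bsub>Vspace p d\<^esub>} \<times> carrier (Wspace p d)"
    if "x \<in> carrier (free2 p d)" "y \<in> carrier (free2 p d)" for x y
    using that p(2) by (cases x; cases y)
      (auto simp: free2_commutator[OF p] Wspace_simps wedge_eq split: prod.split)
  ultimately show "?D \<subseteq> {\<zero>\<^bsub>Vspace p d\<^esub>} \<times> carrier (Wspace p d)"
    unfolding derived_def commutator_def by (intro generate_subgroup_incl) blast+
qed

context
  fixes p :: nat and H :: "('h, 'x) monoid_scheme" (structure)
  assumes p: "odd p" "p > 1" and H: "class2_exponent p H"
begin

interpretation group H using H by (simp add: class2_exponent_def)

private abbreviation c where "c \<equiv> commutator H"

private lemma c_closed [simp]: "x \<in> carrier H \<Longrightarrow> y \<in> carrier H \<Longrightarrow> c x y \<in> carrier H"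
  by (simp add: commutator_def)

private lemma c_central: "x \<in> carrier H \<Longrightarrow> y \<in> carrier H \<Longrightarrow> z \<in> carrier H \<Longrightarrow> z \<otimes> c x y = c x y \<otimes> z"
  using H by (simp add: class2_exponent_def)

private lemma c_swap: "x \<in> carrier H \<Longrightarrow> y \<in> carrier H \<Longrightarrow> x \<otimes> y = c x y \<otimes> (y \<otimes> x)"
  by (simp add: commutator_def m_assoc inv_solve_right inv_solve_left l_inv_ex)
     (simp add: m_assoc[symmetric])

private lemma c_unique: "x \<in> carrier H \<Longrightarrow> y \<in> carrier H \<Longrightarrow> z \<in> carrier H \<Longrightarrow> x \<otimes> y = z \<otimes> (y \<otimes> x) \<Longrightarrow> c x y = z"
  using c_swap[of x y] by (metis c_closed m_closed right_cancel)

private lemma c_self [simp]: "x \<in> carrier H \<Longrightarrow> c x x = \<one>"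
  by (rule c_unique) auto

private lemma c_inv: "x \<in> carrier H \<Longrightarrow> y \<in> carrier H \<Longrightarrow> c x y \<otimes> c y x = \<one>"
proof -
  assume "x \<in> carrier H" "y \<in> carrier H"
  note xy = this
  have "(c x y \<otimes> c y x) \<otimes> (x \<otimes> y) = \<one> \<otimes> (x \<otimes> y)"
    using c_swap[OF xy] c_swap[OF xy(2,1)] xy by (metis c_closed m_assoc m_closed l_one)
  then show ?thesis using xy by (meson c_closed m_closed one_closed right_cancel)
qed

private definition Z where "Z = {z \<in> carrier H. \<forall>x\<in>carrier H. z \<otimes> x = x \<otimes> z}"

private lemma Z_carrier: "z \<in> Z \<Longrightarrow> z \<in> carrier H" by (simp add: Z_def)
private lemma Z_comm: "z \<in> Z \<Longrightarrow> x \<in> carrier H \<Longrightarrow> x \<otimes> z = z \<otimes> x" by (simp add: Z_def)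
private lemma Z_c [simp]: "x \<in> carrier H \<Longrightarrow> y \<in> carrier H \<Longrightarrow> c x y \<in> Z" by (simp add: Z_def c_central)
private lemma Z_one [simp]: "\<one> \<in> Z" by (simp add: Z_def)
private lemma Z_mult [simp]:
  assumes z: "x \<in> Z" "y \<in> Z"
  shows "x \<otimes> y \<in> Z"
proof -
  have a: "x \<in> carrier H" "y \<in> carrier H" using z Z_carrier by auto
  have "x \<otimes> y \<otimes> w = w \<otimes> (x \<otimes> y)" if w: "w \<in> carrier H" for w
  proof -
    have "x \<otimes> y \<otimes> w = x \<otimes> (y \<otimes> w)" using a w by (simp only: m_assoc)
    also have "y \<otimes> w = w \<otimes> y" using Z_comm[OF z(2) w] by (rule sym)
    also have "x \<otimes> (w \<otimes> y) = x \<otimes> w \<otimes> y" using a w by (simp only: m_assoc)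
    also have "x \<otimes> w = w \<otimes> x" using Z_comm[OF z(1) w] by (rule sym)
    finally show ?thesis using a w by (simp only: m_assoc)
  qed
  then show ?thesis using a unfolding Z_def by blast
qed

private lemma Z_pow [simp]: "x \<in> Z \<Longrightarrow> x [^] (n::nat) \<in> Z"
  by (induction n) auto

private lemma c_mult_left:
  assumes "x \<in> carrier H" "y \<in> carrier H" "z \<in> carrier H"
  shows "c (x \<otimes> y) z = c x z \<otimes> c y z"
proof (rule c_unique)
  have cc: "c x z \<in> carrier H" "c y z \<in> carrier H" using assms by auto
  have "x \<otimes> y \<otimes> z = x \<otimes> (y \<otimes> z)" using assms by (simp only: m_assoc)
  also have "y \<otimes> z = c y z \<otimes> (z \<otimes> y)" using assms by (intro c_swap)
  also have "x \<otimes> (c y z \<otimes> (z \<otimes> y)) = (x \<otimes> c y z) \<otimes> (z \<otimes> y)"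
    using assms cc by (simp only: m_assoc m_closed)
  also have "x \<otimes> c y z = c y z \<otimes> x" using assms by (intro c_central)
  also have "c y z \<otimes> x \<otimes> (z \<otimes> y) = c y z \<otimes> ((x \<otimes> z) \<otimes> y)"
    using assms cc by (simp only: m_assoc m_closed)
  also have "x \<otimes> z = c x z \<otimes> (z \<otimes> x)" using assms by (intro c_swap)
  also have "c y z \<otimes> (c x z \<otimes> (z \<otimes> x) \<otimes> y) = (c y z \<otimes> c x z) \<otimes> (z \<otimes> (x \<otimes> y))"
    using assms cc by (simp only: m_assoc m_closed)
  also have "c y z \<otimes> c x z = c x z \<otimes> c y z" using assms cc by (intro c_central)
  finally show "x \<otimes> y \<otimes> z = c x z \<otimes> c y z \<otimes> (z \<otimes> (x \<otimes> y))" .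
qed (use assms in auto)

private lemma c_Z: "z \<in> Z \<Longrightarrow> x \<in> carrier H \<Longrightarrow> c z x = \<one>"
  by (rule c_unique) (auto simp: Z_def)

private lemma c_Z': "z \<in> Z \<Longrightarrow> x \<in> carrier H \<Longrightarrow> c x z = \<one>"
  by (rule c_unique) (auto simp: Z_def)

private lemma c_mult_right:
  assumes "x \<in> carrier H" "y \<in> carrier H" "z \<in> carrier H"
  shows "c z (x \<otimes> y) = c z x \<otimes> c z y"
proof -
  have a: "c z u = inv (c u z)" if "u \<in> carrier H" for u
    using c_inv[of z u] that assms by (simp add: inv_equality)
  show ?thesis
    using assms c_central[of y z "c x z"] by (simp only: a m_closed c_mult_left inv_mult_group c_closed)
qed

private definition h where "h = (p + 1) div 2"

private lemma hh: "x \<in> carrier H \<Longrightarrow> x [^] h \<otimes> x [^] h = x"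
proof -
  assume x: "x \<in> carrier H"
  have "h + h = p + 1" using p(1) by (auto simp: h_def elim!: oddE)
  then have "x [^] h \<otimes> x [^] h = x [^] (p + 1)" using x by (simp only: nat_pow_mult)
  also have "\<dots> = x" using H x by (simp add: class2_exponent_def)
  finally show ?thesis .
qed

private definition A where
  "A = \<lparr>carrier = carrier H, monoid.mult = (\<lambda>x y. x \<otimes> y \<otimes> (c y x) [^] h), one = \<one>\<rparr>"

private lemma A_simps: "carrier A = carrier H" "x \<otimes>\<^bsub>A\<^esub> y = x \<otimes> y \<otimes> (c y x) [^] h" "\<one>\<^bsub>A\<^esub> = \<one>"
  by (simp_all add: A_def)

private lemma pow_mult_Z: "x \<in> Z \<Longrightarrow> y \<in> Z \<Longrightarrow> (x \<otimes> y) [^] (n::nat) = x [^] n \<otimes> y [^] n"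
  by (rule pow_mult_distrib) (auto simp: Z_comm Z_carrier)

private lemma c_A_left:
  assumes "x \<in> carrier H" "y \<in> carrier H" "z \<in> carrier H"
  shows "c (x \<otimes>\<^bsub>A\<^esub> y) z = c x z \<otimes> c y z"
proof -
  have "(c y x) [^] h \<in> Z" using assms by simp
  then show ?thesis using assms by (simp add: A_simps c_mult_left c_Z)
qed

private lemma c_A_right:
  assumes "x \<in> carrier H" "y \<in> carrier H" "z \<in> carrier H"
  shows "c z (x \<otimes>\<^bsub>A\<^esub> y) = c z x \<otimes> c z y"
proof -
  have "(c y x) [^] h \<in> Z" using assms by simp
  then show ?thesis using assms by (simp add: A_simps c_mult_right c_Z')
qed

private lemma A_Z: "z \<in> Z \<Longrightarrow> x \<in> carrier H \<Longrightarrow> x \<otimes>\<^bsub>A\<^esub> z = x \<otimes> z"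
  by (simp add: A_simps c_Z Z_carrier)

private lemma A_comm_group: "comm_group A"
proof (rule comm_groupI; unfold A_simps(1,3))
  fix x y assume xy: "x \<in> carrier H" "y \<in> carrier H"
  then show "x \<otimes>\<^bsub>A\<^esub> y \<in> carrier H" by (simp add: A_simps)
  have cyx: "c y x = inv (c x y)" using c_inv[of y x] xy by (simp add: inv_equality)
  have "x \<otimes>\<^bsub>A\<^esub> y = (c x y) [^] h \<otimes> (c x y) [^] h \<otimes> (y \<otimes> x) \<otimes> (c y x) [^] h"
    using xy by (simp add: A_simps hh flip: c_swap)
  also have "\<dots> = (c x y) [^] h \<otimes> ((c x y) [^] h \<otimes> (c y x) [^] h) \<otimes> (y \<otimes> x)"
    using xy Z_comm[of "(c y x) [^] h" "y \<otimes> x"] by (simp add: m_assoc)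
  also have "(c x y) [^] h \<otimes> (c y x) [^] h = \<one>"
    using xy c_inv[of x y] by (simp flip: pow_mult_Z)
  also have "(c x y) [^] h \<otimes> \<one> \<otimes> (y \<otimes> x) = y \<otimes>\<^bsub>A\<^esub> x"
    using xy Z_comm[of "(c x y) [^] h" "y \<otimes> x"] by (simp add: A_simps)
  finally show "x \<otimes>\<^bsub>A\<^esub> y = y \<otimes>\<^bsub>A\<^esub> x" .
next
  fix x y z assume xyz: "x \<in> carrier H" "y \<in> carrier H" "z \<in> carrier H"
  have k: "u \<in> Z \<Longrightarrow> x \<otimes> u = u \<otimes> x" "u \<in> Z \<Longrightarrow> y \<otimes> u = u \<otimes> y" "u \<in> Z \<Longrightarrow> z \<otimes> u = u \<otimes> z" for u
    using xyz Z_comm by auto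
  have "x \<otimes>\<^bsub>A\<^esub> y \<otimes>\<^bsub>A\<^esub> z = (x \<otimes> y \<otimes> (c y x) [^] h) \<otimes> z \<otimes> (c z x \<otimes> c z y) [^] h"
    using xyz c_A_right[of x y z] by (simp add: A_simps)
  also have "\<dots> = (x \<otimes> y \<otimes> ((c y x) [^] h \<otimes> z)) \<otimes> ((c z x) [^] h \<otimes> (c z y) [^] h)"
    using xyz by (simp add: pow_mult_Z m_assoc)
  also have "(c y x) [^] h \<otimes> z = z \<otimes> (c y x) [^] h" using xyz k by simp
  also have "(x \<otimes> y \<otimes> (z \<otimes> (c y x) [^] h)) \<otimes> ((c z x) [^] h \<otimes> (c z y) [^] h) =
     (x \<otimes> y \<otimes> z) \<otimes> ((c y x) [^] h \<otimes> (c z x) [^] h \<otimes> (c z y) [^] h)"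
    using xyz by (simp add: m_assoc)
  also have "(c y x) [^] h \<otimes> (c z x) [^] h \<otimes> (c z y) [^] h = (c z y) [^] h \<otimes> ((c y x) [^] h \<otimes> (c z x) [^] h)"
    using xyz Z_comm[of "(c z y) [^] h"] by simp
  also have "(x \<otimes> y \<otimes> z) \<otimes> \<dots> = x \<otimes> (y \<otimes> z \<otimes> (c z y) [^] h) \<otimes> (c y x \<otimes> c z x) [^] h"
    using xyz by (simp add: pow_mult_Z m_assoc)
  also have "\<dots> = x \<otimes>\<^bsub>A\<^esub> (y \<otimes>\<^bsub>A\<^esub> z)"
    using xyz c_A_left[of y z x] by (simp add: A_simps)
  finally show "x \<otimes>\<^bsub>A\<^esub> y \<otimes>\<^bsub>A\<^esub> z = x \<otimes>\<^bsub>A\<^esub> (y \<otimes>\<^bsub>A\<^esub> z)" .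
next
  fix x assume x: "x \<in> carrier H"
  then show "\<one> \<otimes>\<^bsub>A\<^esub> x = x" by (simp add: A_simps c_Z')
  have "c x (inv x) = \<one>" using x by (intro c_unique) auto
  then show "\<exists>y\<in>carrier H. y \<otimes>\<^bsub>A\<^esub> x = \<one>"
    using x by (intro bexI[of _ "inv x"]) (auto simp: A_simps)
qed simp

interpretation A: comm_group A by (rule A_comm_group)

private lemma A_pow: "x \<in> carrier H \<Longrightarrow> x [^]\<^bsub>A\<^esub> (n::nat) = x [^] n"
proof (induction n)
  case (Suc n)
  have "x [^] n \<otimes> x = x \<otimes> x [^] n" using Suc.prems by (metis nat_pow_Suc nat_pow_Suc2)
  then have "c x (x [^] n) = \<one>" using Suc.prems by (intro c_unique) auto
  then show ?case using Suc by (simp add: A_simps)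
qed (simp add: A_simps)

private lemma A_pow_p: "x \<in> carrier H \<Longrightarrow> x [^]\<^bsub>A\<^esub> p = \<one>"
  using H by (simp add: A_pow class2_exponent_def)

private lemma A_mod: "x \<in> carrier H \<Longrightarrow> x [^]\<^bsub>A\<^esub> (n mod int p) = x [^]\<^bsub>A\<^esub> n"
proof -
  assume x: "x \<in> carrier H"
  then have x': "x \<in> carrier A" by (simp add: A_simps)
  have "x [^]\<^bsub>A\<^esub> (int p * (n div int p)) = \<one>\<^bsub>A\<^esub>"
    using A.int_pow_pow[OF x', of "int p" "n div int p"] A_pow_p[OF x]
    by (simp add: int_pow_int) (simp flip: A_simps(3))
  moreover have "n = int p * (n div int p) + n mod int p" by simp
  ultimately show ?thesis
    using A.int_pow_mult[OF x', of "int p * (n div int p)" "n mod int p"] x' by simp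
qed

private lemma c_homL: "y \<in> carrier H \<Longrightarrow> (\<lambda>x. c x y) \<in> hom A A"
  by (rule homI) (simp_all add: A_simps(1) c_A_left, simp add: A_Z)

private lemma c_homR: "y \<in> carrier H \<Longrightarrow> (\<lambda>x. c y x) \<in> hom A A"
  by (rule homI) (simp_all add: A_simps(1) c_A_right, simp add: A_Z)

private lemma hom_finprod:
  assumes "f \<in> hom A A" "finite I" "g \<in> I \<rightarrow> carrier A"
  shows "f (finprod A g I) = finprod A (\<lambda>i. f (g i)) I"
  using assms(2,3)
proof (induction I rule: finite_induct)
  case empty
  then show ?case using hom_one[OF assms(1) A.group_axioms A.group_axioms] by simp
next
  case (insert i I)
  then show ?case using assms(1) by (auto simp: hom_mult hom_in_carrier Pi_iff)
qed

private lemma hom_ipow: "f \<in> hom A A \<Longrightarrow> x \<in> carrier A \<Longrightarrow> f (x [^]\<^bsub>A\<^esub> (n::int)) = f x [^]\<^bsub>A\<^esub> n"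
  by (rule hom_int_pow) (auto simp: A.group_axioms)

private lemma hom_Z_ipow: "z \<in> Z \<Longrightarrow> z [^]\<^bsub>A\<^esub> (n::int) \<in> Z"
proof -
  assume z: "z \<in> Z"
  then have zc: "z \<in> carrier H" by (rule Z_carrier)
  have "z [^]\<^bsub>A\<^esub> n = z [^]\<^bsub>A\<^esub> nat (n mod int p)"
    using A_mod[OF zc, of n] p int_pow_int[of A z "nat (n mod int p)"] by simp
  then show ?thesis using z by (simp add: A_pow zc)
qed

private lemma A_Z_finprod: "finite I \<Longrightarrow> (\<And>i. i \<in> I \<Longrightarrow> g i \<in> Z) \<Longrightarrow> finprod A g I \<in> Z"
proof (induction I rule: finite_induct)
  case (insert i I)
  then have "g \<in> I \<rightarrow> carrier A" "g i \<in> carrier A" by (auto simp: A_simps(1) Z_carrier)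
  then show ?case using insert by (simp add: A_Z Z_carrier)
qed (simp add: A_simps)

lemma free2_universal_aux:
  assumes x: "\<And>i. i < d \<Longrightarrow> x i \<in> carrier H"
  shows "\<exists>\<phi>\<in>hom (free2 p d) H. \<forall>i<d. \<phi> (free2_gen p d i) = x i"
proof -
  define lam where "lam v = finprod A (\<lambda>i. x i [^]\<^bsub>A\<^esub> (v i :: int)) {..<d}" for v
  define \<mu> where "\<mu> a = finprod A (\<lambda>ij. c (x (fst ij)) (x (snd ij)) [^]\<^bsub>A\<^esub> (a ij :: int)) (pairs d)" for a
  have fin: "finite (pairs d)" by (rule finite_subset[of _ "{..<d} \<times> {..<d}"]) (auto simp: pairs_def)
  have xA: "i < d \<Longrightarrow> x i \<in> carrier A" for i by (simp add: A_simps x)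
  have cA: "i < d \<Longrightarrow> j < d \<Longrightarrow> c (x i) (x j) \<in> carrier A" for i j by (simp add: A_simps x)
  have lam_closed [simp]: "lam v \<in> carrier A" for v unfolding lam_def by (intro A.finprod_closed) (auto simp: xA)
  have \<mu>_Z [simp]: "\<mu> a \<in> Z" for a unfolding \<mu>_def
    by (intro A_Z_finprod fin hom_Z_ipow Z_c) (auto simp: x pairs_def)
  have \<mu>_closed [simp]: "\<mu> a \<in> carrier A" for a using Z_carrier[of "\<mu> a"] by (simp add: A_simps)
  have lam_add: "lam (\<lambda>i\<in>{..<d}. (v i + w i) mod int p) = lam v \<otimes>\<^bsub>A\<^esub> lam w" for v w
  proof -
    have "lam v \<otimes>\<^bsub>A\<^esub> lam w = finprod A (\<lambda>i. x i [^]\<^bsub>A\<^esub> v i \<otimes>\<^bsub>A\<^esub> x i [^]\<^bsub>A\<^esub> w i) {..<d}"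
      unfolding lam_def by (subst A.finprod_multf) (auto simp: xA)
    also have "\<dots> = lam (\<lambda>i\<in>{..<d}. (v i + w i) mod int p)" unfolding lam_def
      by (rule A.finprod_cong') (auto simp: xA x A_mod A.int_pow_mult)
    finally show ?thesis by simp
  qed
  have \<mu>_add: "\<mu> (\<lambda>ij\<in>pairs d. (a ij + b ij) mod int p) = \<mu> a \<otimes>\<^bsub>A\<^esub> \<mu> b" for a b
  proof -
    have "\<mu> a \<otimes>\<^bsub>A\<^esub> \<mu> b = finprod A (\<lambda>ij. c (x (fst ij)) (x (snd ij)) [^]\<^bsub>A\<^esub> a ij \<otimes>\<^bsub>A\<^esub> c (x (fst ij)) (x (snd ij)) [^]\<^bsub>A\<^esub> b ij) (pairs d)"
      unfolding \<mu>_def by (subst A.finprod_multf) (auto simp: cA pairs_def)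
    also have "\<dots> = \<mu> (\<lambda>ij\<in>pairs d. (a ij + b ij) mod int p)" unfolding \<mu>_def
      by (rule A.finprod_cong') (auto simp: cA x A_mod A.int_pow_mult pairs_def)
    finally show ?thesis by simp
  qed
  have \<mu>_smult: "\<mu> (\<lambda>ij\<in>pairs d. (k * a ij) mod int p) = \<mu> a [^]\<^bsub>A\<^esub> k" for a k
  proof -
    have hk: "(\<lambda>z. z [^]\<^bsub>A\<^esub> k) \<in> hom A A"
      by (rule homI) (simp_all add: A.int_pow_distrib)
    have "\<mu> a [^]\<^bsub>A\<^esub> k = finprod A (\<lambda>ij. (c (x (fst ij)) (x (snd ij)) [^]\<^bsub>A\<^esub> a ij) [^]\<^bsub>A\<^esub> k) (pairs d)"
      unfolding \<mu>_def by (rule hom_finprod[OF hk fin]) (auto simp: cA pairs_def)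
    also have "\<dots> = \<mu> (\<lambda>ij\<in>pairs d. (k * a ij) mod int p)" unfolding \<mu>_def
      by (rule A.finprod_cong') (auto simp: cA x A_mod A.int_pow_pow pairs_def mult.commute)
    finally show ?thesis by simp
  qed
  have clam: "c (lam v) (lam w) = \<mu> (\<lambda>(i, j)\<in>pairs d. (v i * w j - v j * w i) mod int p)" for v w
  proof -
    define g where "g ij = c (x (fst ij)) (x (snd ij)) [^]\<^bsub>A\<^esub> (v (fst ij) * w (snd ij))" for ij
    have gA: "g \<in> {..<d} \<times> {..<d} \<rightarrow> carrier A" by (auto simp: g_def cA)
    define P' where "P' = (\<lambda>(i, j). (j, i)) ` pairs d"
    define D where "D = (\<lambda>i. (i, i)) ` {..<d}"
    have sub: "pairs d \<subseteq> {..<d} \<times> {..<d}" "P' \<subseteq> {..<d} \<times> {..<d}" "D \<subseteq> {..<d} \<times> {..<d}"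
      by (auto simp: pairs_def P'_def D_def)
    have gs: "g \<in> pairs d \<rightarrow> carrier A" "g \<in> P' \<rightarrow> carrier A" "g \<in> D \<rightarrow> carrier A"
      using gA sub by blast+
    have "c (lam v) (lam w) = finprod A (\<lambda>i. c (x i [^]\<^bsub>A\<^esub> v i) (lam w)) {..<d}"
    proof -
      have "lam w \<in> carrier H" using lam_closed[of w] by (simp only: A_simps)
      from hom_finprod[OF c_homL[OF this], of "{..<d}" "\<lambda>i. x i [^]\<^bsub>A\<^esub> v i"]
      show ?thesis by (simp add: lam_def[of v] xA)
    qed
    also have "\<dots> = finprod A (\<lambda>i. finprod A (\<lambda>j. g (i, j)) {..<d}) {..<d}"
    proof (rule A.finprod_cong')
      fix i assume "i \<in> {..<d}"
      then have i: "x i \<in> carrier A" "x i \<in> carrier H" by (auto simp: xA x)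
      then have xi: "x i [^]\<^bsub>A\<^esub> v i \<in> carrier H" using A.int_pow_closed[of "x i" "v i"] by (simp only: A_simps)
      have "c (x i [^]\<^bsub>A\<^esub> v i) (lam w) = finprod A (\<lambda>j. c (x i [^]\<^bsub>A\<^esub> v i) (x j [^]\<^bsub>A\<^esub> w j)) {..<d}"
        using hom_finprod[OF c_homR[OF xi], of "{..<d}" "\<lambda>i. x i [^]\<^bsub>A\<^esub> w i"] by (simp add: lam_def xA)
      also have "\<dots> = finprod A (\<lambda>j. g (i, j)) {..<d}"
      proof (rule A.finprod_cong')
        fix j assume "j \<in> {..<d}"
        then have j: "x j \<in> carrier A" "x j \<in> carrier H" by (auto simp: xA x)
        have cc: "c (x i) (x j) \<in> carrier A" using i j by (simp add: A_simps)
        show "c (x i [^]\<^bsub>A\<^esub> v i) (x j [^]\<^bsub>A\<^esub> w j) = g (i, j)"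
          using hom_ipow[OF c_homR[OF xi] j(1), of "w j"] hom_ipow[OF c_homL[OF j(2)] i(1), of "v i"]
          by (simp add: g_def A.int_pow_pow[OF cc])
      qed (use \<open>i \<in> {..<d}\<close> gA in auto)
      finally show "c (x i [^]\<^bsub>A\<^esub> v i) (lam w) = finprod A (\<lambda>j. g (i, j)) {..<d}" .
    next
      show "(\<lambda>i. finprod A (\<lambda>j. g (i, j)) {..<d}) \<in> {..<d} \<rightarrow> carrier A"
        using gA by (auto intro!: A.finprod_closed)
    qed simp
    also have "\<dots> = finprod A g (\<Union>i\<in>{..<d}. (\<lambda>j. (i, j)) ` {..<d})"
    proof (subst A.finprod_UN_disjoint)
      show "finprod A (\<lambda>i. finprod A (\<lambda>j. g (i, j)) {..<d}) {..<d}
         = finprod A (\<lambda>i. finprod A g ((\<lambda>j. (i, j)) ` {..<d})) {..<d}"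
      proof (rule A.finprod_cong')
        fix i assume "i \<in> {..<d}"
        then show "finprod A (\<lambda>j. g (i, j)) {..<d} = finprod A g ((\<lambda>j. (i, j)) ` {..<d})"
          using gA by (subst A.finprod_reindex) (auto simp: inj_on_def)
      next
        show "(\<lambda>i. finprod A g ((\<lambda>j. (i, j)) ` {..<d})) \<in> {..<d} \<rightarrow> carrier A"
          using gA by (auto intro!: A.finprod_closed)
      qed simp
    qed (use gA in \<open>auto simp: pairwise_def disjnt_def\<close>)
    also have "(\<Union>i\<in>{..<d}. (\<lambda>j. (i, j)) ` {..<d}) = (pairs d \<union> P') \<union> D"
      by (auto simp: pairs_def P'_def D_def image_iff)
    also have "finprod A g ((pairs d \<union> P') \<union> D) = finprod A g (pairs d \<union> P') \<otimes>\<^bsub>A\<^esub> finprod A g D"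
      using gs fin by (intro A.finprod_Un_disjoint) (auto simp: P'_def D_def pairs_def)
    also have "finprod A g D = \<one>\<^bsub>A\<^esub>"
    proof (rule A.finprod_one_eqI)
      fix ij assume "ij \<in> D"
      then obtain i where i: "ij = (i, i)" "i < d" by (auto simp: D_def)
      have "c (x i) (x i) = \<one>\<^bsub>A\<^esub>" using i x by (simp add: A_simps)
      then show "g ij = \<one>\<^bsub>A\<^esub>" using i by (simp add: g_def)
    qed
    also have "finprod A g (pairs d \<union> P') = finprod A g (pairs d) \<otimes>\<^bsub>A\<^esub> finprod A g P'"
      using gs fin by (intro A.finprod_Un_disjoint) (auto simp: P'_def pairs_def)
    also have "finprod A g P' = finprod A (\<lambda>ij. g (snd ij, fst ij)) (pairs d)"
      unfolding P'_def using gs(2)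
      by (subst A.finprod_reindex) (auto simp: inj_on_def P'_def split_def)
    also have "finprod A g (pairs d) \<otimes>\<^bsub>A\<^esub> \<dots> = finprod A (\<lambda>ij. g ij \<otimes>\<^bsub>A\<^esub> g (snd ij, fst ij)) (pairs d)"
      using gs gA by (subst A.finprod_multf) (auto simp: pairs_def Pi_iff)
    also have "\<dots> = \<mu> (\<lambda>(i, j)\<in>pairs d. (v i * w j - v j * w i) mod int p)"
      unfolding \<mu>_def
    proof (rule A.finprod_cong')
      fix ij assume ij: "ij \<in> pairs d"
      obtain i j where [simp]: "ij = (i, j)" by (cases ij)
      have d: "i < d" "j < d" using ij by (auto simp: pairs_def)
      have cc: "c (x i) (x j) \<in> carrier A" "c (x j) (x i) \<in> carrier A" using d cA by auto
      have "c (x j) (x i) \<otimes>\<^bsub>A\<^esub> c (x i) (x j) = \<one>\<^bsub>A\<^esub>"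
        using d x c_inv[of "x j" "x i"] by (simp add: A_Z) (simp add: A_simps)
      then have *: "c (x j) (x i) = inv\<^bsub>A\<^esub> c (x i) (x j)" using cc by (simp add: A.inv_equality)
      have "g ij \<otimes>\<^bsub>A\<^esub> g (snd ij, fst ij) =
          c (x i) (x j) [^]\<^bsub>A\<^esub> (v i * w j) \<otimes>\<^bsub>A\<^esub> c (x i) (x j) [^]\<^bsub>A\<^esub> (- (v j * w i))"
        using cc by (simp add: g_def * A.int_pow_inv A.int_pow_neg)
      also have "\<dots> = c (x i) (x j) [^]\<^bsub>A\<^esub> (v i * w j - v j * w i)"
        using cc by (simp flip: A.int_pow_mult)
      also have "\<dots> = c (x i) (x j) [^]\<^bsub>A\<^esub> ((v i * w j - v j * w i) mod int p)"
        using d x by (simp add: A_mod)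
      finally show "g ij \<otimes>\<^bsub>A\<^esub> g (snd ij, fst ij) = c (x (fst ij)) (x (snd ij)) [^]\<^bsub>A\<^esub>
          (\<lambda>(i, j)\<in>pairs d. (v i * w j - v j * w i) mod int p) ij"
        using ij by simp
    qed (auto simp: cA pairs_def)
    finally show ?thesis by simp
  qed
  define \<phi> where "\<phi> z = lam (fst z) \<otimes>\<^bsub>A\<^esub> \<mu> (snd z)" for z
  have lamH: "lam v \<in> carrier H" for v using lam_closed[of v] by (simp only: A_simps)
  have \<mu>H: "\<mu> v \<in> carrier H" for v using \<mu>_closed[of v] by (simp only: A_simps)
  have tri: "y \<otimes> z = y \<otimes>\<^bsub>A\<^esub> z \<otimes>\<^bsub>A\<^esub> (c y z) [^]\<^bsub>A\<^esub> (int h)" if "y \<in> carrier H" "z \<in> carrier H" for y z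
  proof -
    have "y \<otimes>\<^bsub>A\<^esub> z \<otimes>\<^bsub>A\<^esub> (c y z) [^]\<^bsub>A\<^esub> (int h) = y \<otimes> z \<otimes> ((c z y) [^] h \<otimes> (c y z) [^] h)"
    proof -
      have "y \<otimes>\<^bsub>A\<^esub> z \<in> carrier H" using that by (simp add: A_simps)
      then have "y \<otimes>\<^bsub>A\<^esub> z \<otimes>\<^bsub>A\<^esub> (c y z) [^]\<^bsub>A\<^esub> (int h) = y \<otimes>\<^bsub>A\<^esub> z \<otimes> (c y z) [^] h"
        using that by (simp add: int_pow_int A_pow A_Z)
      then show ?thesis using that by (simp add: A_simps m_assoc)
    qed
    also have "(c z y) [^] h \<otimes> (c y z) [^] h = \<one>"
      using that c_inv[of z y] by (simp flip: pow_mult_Z)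
    finally show ?thesis using that by simp
  qed
  have "\<phi> \<in> hom (free2 p d) H"
  proof (rule homI)
    fix y assume "y \<in> carrier (free2 p d)"
    show "\<phi> y \<in> carrier H" unfolding \<phi>_def
      using A.m_closed[OF lam_closed \<mu>_closed] by (simp only: A_simps(1))
  next
    fix y z :: "(nat \<Rightarrow> int) \<times> (nat \<times> nat \<Rightarrow> int)"
    obtain v a w b where [simp]: "y = (v, a)" "z = (w, b)" by (cases y; cases z)
    have m: "y \<otimes>\<^bsub>free2 p d\<^esub> z = (\<lambda>i\<in>{..<d}. (v i + w i) mod int p,
      \<lambda>ij\<in>pairs d. ((\<lambda>ij\<in>pairs d. (a ij + b ij) mod int p) ij + (\<lambda>ij\<in>pairs d. (int h *
       (\<lambda>(i, j)\<in>pairs d. (v i * w j - v j * w i) mod int p) ij) mod int p) ij) mod int p)"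
      by (simp only: \<open>y = _\<close> \<open>z = _\<close> free2_mult[OF p(2)] prod.inject, intro conjI refl restrict_ext;
          clarify?; simp add: mod_simps h_def)
    have "\<phi> (y \<otimes>\<^bsub>free2 p d\<^esub> z) = (lam v \<otimes>\<^bsub>A\<^esub> lam w) \<otimes>\<^bsub>A\<^esub> ((\<mu> a \<otimes>\<^bsub>A\<^esub> \<mu> b) \<otimes>\<^bsub>A\<^esub> c (lam v) (lam w) [^]\<^bsub>A\<^esub> int h)"
      by (simp only: m \<phi>_def fst_conv snd_conv lam_add \<mu>_add \<mu>_smult clam)
    also have "c (lam v) (lam w) = c (\<phi> y) (\<phi> z)"
      using c_Z[OF \<mu>_Z] c_Z'[OF \<mu>_Z] lamH \<mu>H A.m_closed[OF lam_closed[of w] \<mu>_closed[of b], unfolded A_simps(1)]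
      by (simp add: \<phi>_def c_A_left c_A_right)
    also have "(lam v \<otimes>\<^bsub>A\<^esub> lam w) \<otimes>\<^bsub>A\<^esub> ((\<mu> a \<otimes>\<^bsub>A\<^esub> \<mu> b) \<otimes>\<^bsub>A\<^esub> c (\<phi> y) (\<phi> z) [^]\<^bsub>A\<^esub> int h)
       = \<phi> y \<otimes>\<^bsub>A\<^esub> \<phi> z \<otimes>\<^bsub>A\<^esub> c (\<phi> y) (\<phi> z) [^]\<^bsub>A\<^esub> int h"
    proof -
      have "\<phi> y \<in> carrier A" "\<phi> z \<in> carrier A" by (simp_all add: \<phi>_def)
      then have "c (\<phi> y) (\<phi> z) \<in> carrier A" by (simp add: A_simps(1))
      then have "c (\<phi> y) (\<phi> z) [^]\<^bsub>A\<^esub> int h \<in> carrier A" by simp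
      then show ?thesis by (simp add: \<phi>_def A.m_ac)
    qed
    also have "\<dots> = \<phi> y \<otimes> \<phi> z"
      using A.m_closed[OF lam_closed \<mu>_closed, unfolded A_simps(1)] by (simp add: \<phi>_def flip: tri)
    finally show "\<phi> (y \<otimes>\<^bsub>free2 p d\<^esub> z) = \<phi> y \<otimes> \<phi> z" .
  qed
  moreover have "\<phi> (free2_gen p d i) = x i" if i: "i < d" for i
  proof -
    have 1: "\<mu> (\<zero>\<^bsub>Wspace p d\<^esub>) = \<one>\<^bsub>A\<^esub>"
      unfolding \<mu>_def Wspace_simps[OF p(2)] by (rule A.finprod_one_eqI) simp
    have "lam (\<lambda>k\<in>{..<d}. if k = i then 1 else 0) = finprod A (\<lambda>k. if i = k then x k else \<one>\<^bsub>A\<^esub>) {..<d}"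
      unfolding lam_def by (rule A.finprod_cong') (auto simp: xA)
    also have "\<dots> = x i"
      using A.finprod_singleton[of i "{..<d}" x] i by (auto simp: xA Pi_iff)
    finally show ?thesis using 1 i unfolding \<phi>_def free2_gen_def Fp_simps fst_conv snd_conv
      by (simp only: A.r_one xA)
  qed
  ultimately show ?thesis by blast
qed

end

text \<open>The universal property of \<^term>\<open>free2 p d\<close>, whose
  free generators are \<^term>\<open>free2_gen p d i\<close> for \<open>i < d\<close>.\<close>
lemma free2_universal:
  fixes H :: "('h, 'x) monoid_scheme"
  assumes p: "odd p" "p > 1" and H: "class2_exponent p H" and x: "\<And>i. i < d \<Longrightarrow> x i \<in> carrier H"
  shows "\<exists>!\<phi>. \<phi> \<in> hom (free2 p d) H \<inter> extensional (carrier (free2 p d)) \<and> (\<forall>i<d. \<phi> (free2_gen p d i) = x i)"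
proof (rule ex_ex1I)
  obtain \<psi> where \<psi>: "\<psi> \<in> hom (free2 p d) H" "\<forall>i<d. \<psi> (free2_gen p d i) = x i"
    using free2_universal_aux[OF p H, of d x] x by blast
  interpret group "free2 p d" by (rule free2_group[OF p(2)])
  have "restrict \<psi> (carrier (free2 p d)) \<in> hom (free2 p d) H"
    using \<psi>(1) by (auto simp: hom_def)
  then show "\<exists>\<phi>. \<phi> \<in> hom (free2 p d) H \<inter> extensional (carrier (free2 p d)) \<and> (\<forall>i<d. \<phi> (free2_gen p d i) = x i)"
    using \<psi>(2) free2_gen_carrier[OF p(2)]
    by (intro exI[of _ "restrict \<psi> (carrier (free2 p d))"]) auto
next
  fix \<phi> \<psi>
  assume \<phi>: "\<phi> \<in> hom (free2 p d) H \<inter> extensional (carrier (free2 p d)) \<and> (\<forall>i<d. \<phi> (free2_gen p d i) = x i)"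
    and \<psi>: "\<psi> \<in> hom (free2 p d) H \<inter> extensional (carrier (free2 p d)) \<and> (\<forall>i<d. \<psi> (free2_gen p d i) = x i)"
  have "group H" using H by (simp add: class2_exponent_def)
  then have gh: "group_hom (free2 p d) H \<phi>" "group_hom (free2 p d) H \<psi>"
    using \<phi> \<psi> free2_group[OF p(2)] by (auto simp: group_hom_def group_hom_axioms_def)
  have "y \<in> carrier (free2 p d) \<and> \<phi> y = \<psi> y" if "y \<in> generate (free2 p d) (free2_gen p d ` {..<d})" for y
    using that
  proof (induction rule: generate.induct)
    case one
    then show ?case using group_hom.hom_one[OF gh(1)] group_hom.hom_one[OF gh(2)]
      by (simp add: group.is_monoid[OF free2_group[OF p(2)]])
  next
    case (incl h)
    then show ?case using \<phi> \<psi> free2_gen_carrier[OF p(2)] by auto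
  next
    case (inv h)
    then obtain i where i: "i < d" "h = free2_gen p d i" by auto
    then show ?case using \<phi> \<psi> free2_gen_carrier[OF p(2), of i d] free2_group[OF p(2), of d]
      by (simp add: group_hom.hom_inv[OF gh(1)] group_hom.hom_inv[OF gh(2)] group.inv_closed)
  next
    case (eng h1 h2)
    then show ?case using free2_group[OF p(2), of d]
      by (simp add: group_hom.hom_mult[OF gh(1)] group_hom.hom_mult[OF gh(2)] group.is_monoid monoid.m_closed)
  qed
  then have "\<phi> y = \<psi> y" if "y \<in> carrier (free2 p d)" for y
    using that free2_generated[OF p] by blast
  then show "\<phi> = \<psi>" using \<phi> \<psi> by (intro extensionalityI[of _ "carrier (free2 p d)"]) auto
qed


definition GL :: "nat \<Rightarrow> nat \<Rightarrow> (nat \<times> nat \<Rightarrow> int) set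
    \<Rightarrow> ((nat \<Rightarrow> int) \<times> (nat \<times> nat \<Rightarrow> int)) set monoid" where
  "GL p d L = free2 p d Mod ({\<zero>\<^bsub>Vspace p d\<^esub>} \<times> L)"

lemma central_normal:
  assumes p: "odd p" "p > 1" and L: "VectorSpace.subspace (Fp p) L (Wspace p d)"
  shows "({\<zero>\<^bsub>Vspace p d\<^esub>} \<times> L) \<lhd> free2 p d"
proof -
  interpret group "free2 p d" by (rule free2_group[OF p(2)])
  have sm: "submodule (Fp p) L (Wspace p d)" using L by (rule subspace.submod)
  have LW: "L \<subseteq> carrier (Wspace p d)" by (rule submodule.subset[OF sm])
  have LF: "{\<zero>\<^bsub>Vspace p d\<^esub>} \<times> L \<subseteq> carrier (free2 p d)"
    using LW p(2) free2_derived[OF p, of d] derived_in_carrier[of "carrier (free2 p d)"] by blast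
  have m: "(\<zero>\<^bsub>Vspace p d\<^esub>, a) \<otimes>\<^bsub>free2 p d\<^esub> (\<zero>\<^bsub>Vspace p d\<^esub>, b) = (\<zero>\<^bsub>Vspace p d\<^esub>, a \<oplus>\<^bsub>Wspace p d\<^esub> b)" for a b
    unfolding free2_mult[OF p(2)] Vspace_simps[OF p(2)] Wspace_simps[OF p(2)] prod.inject
    by (intro conjI restrict_ext; clarify?; simp add: pairs_bound)
  have comm: "x \<otimes>\<^bsub>free2 p d\<^esub> y = y \<otimes>\<^bsub>free2 p d\<^esub> x"
    if "x \<in> {\<zero>\<^bsub>Vspace p d\<^esub>} \<times> L" "y \<in> carrier (free2 p d)" for x y
    using that(1) apply (cases x; cases y)
    apply (clarify, simp only: free2_mult[OF p(2)] Vspace_simps[OF p(2)] prod.inject)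
    apply (intro conjI restrict_ext; clarify?; simp add: pairs_bound algebra_simps)
    done
  have "subgroup ({\<zero>\<^bsub>Vspace p d\<^esub>} \<times> L) (free2 p d)"
  proof (rule subgroupI)
    show "{\<zero>\<^bsub>Vspace p d\<^esub>} \<times> L \<subseteq> carrier (free2 p d)" by (rule LF)
    show "{\<zero>\<^bsub>Vspace p d\<^esub>} \<times> L \<noteq> {}" using submodule.zero_closed[OF sm] by blast
  next
    fix x assume x: "x \<in> {\<zero>\<^bsub>Vspace p d\<^esub>} \<times> L"
    then obtain a where a: "x = (\<zero>\<^bsub>Vspace p d\<^esub>, a)" "a \<in> L" by auto
    let ?b = "(int p - 1) \<odot>\<^bsub>Wspace p d\<^esub> a"
    have b: "?b \<in> L" using a(2) p(2) by (intro submodule.smult_closed[OF sm]) (auto simp: Fp_simps)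
    have "?b \<oplus>\<^bsub>Wspace p d\<^esub> a = \<zero>\<^bsub>Wspace p d\<^esub>"
      unfolding Wspace_simps[OF p(2)] by (intro restrict_ext) (simp add: mod_simps algebra_simps)
    then have "(\<zero>\<^bsub>Vspace p d\<^esub>, ?b) \<otimes>\<^bsub>free2 p d\<^esub> x = \<one>\<^bsub>free2 p d\<^esub>" by (simp add: a m) (simp add: free2_def)
    then have "inv\<^bsub>free2 p d\<^esub> x = (\<zero>\<^bsub>Vspace p d\<^esub>, ?b)" using LF x b by (intro inv_equality) auto
    then show "inv\<^bsub>free2 p d\<^esub> x \<in> {\<zero>\<^bsub>Vspace p d\<^esub>} \<times> L" using b by simp
  next
    fix x y assume "x \<in> {\<zero>\<^bsub>Vspace p d\<^esub>} \<times> L" "y \<in> {\<zero>\<^bsub>Vspace p d\<^esub>} \<times> L"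
    then show "x \<otimes>\<^bsub>free2 p d\<^esub> y \<in> {\<zero>\<^bsub>Vspace p d\<^esub>} \<times> L"
      using submodule.m_closed[OF sm] by (auto simp: m)
  qed
  then show ?thesis
  proof (rule normal_invI)
    fix x h assume h: "h \<in> {\<zero>\<^bsub>Vspace p d\<^esub>} \<times> L" and x: "x \<in> carrier (free2 p d)"
    then have "h \<in> carrier (free2 p d)" using LF by blast
    then have "x \<otimes>\<^bsub>free2 p d\<^esub> h \<otimes>\<^bsub>free2 p d\<^esub> inv\<^bsub>free2 p d\<^esub> x = h"
      using x by (simp add: comm[OF h x, symmetric] m_assoc)
    then show "x \<otimes>\<^bsub>free2 p d\<^esub> h \<otimes>\<^bsub>free2 p d\<^esub> inv\<^bsub>free2 p d\<^esub> x \<in> {\<zero>\<^bsub>Vspace p d\<^esub>} \<times> L"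
      using h by simp
  qed
qed

lemma group_GL:
  assumes "odd p" "p > 1" "L \<in> Gr p d r"
  shows "group (GL p d L)"
  using assms central_normal[OF assms(1,2)] by (auto simp: GL_def Gr_def intro: normal.factorgroup_is_group)


definition catalan :: "nat \<Rightarrow> real" where
  "catalan n = real ((2 * n) choose n) / real (n + 1)"

end

theory Submission
  imports Defs
begin

text \<open>Let \<open>n\<close> be the dimension of \<open>W\<close>, let \<open>c = ((d - 2) choose 2) + 1\<close>, so that \<open>n + 4 = 2 d + c\<close>, and
  draw \<open>r\<close> pairs \<open>(v\<^sub>k, w\<^sub>k)\<close> of vectors at random. With probability tending to one the wedges
  \<open>v\<^sub>k \<and> w\<^sub>k\<close> are independent, and they then span a subspace \<open>L\<close> of dimension \<open>r\<close> with \<open>B\<^sub>0(G\<^sub>L) = 0\<close>.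
  If \<open>X(L)\<close> denotes the number of pairs with a nonzero wedge in \<open>L\<close>, then \<open>L\<close> arises from at most
  \<open>X(L)\<^sup>r\<close> choices, so by Jensen's inequality the number of good \<open>L\<close> is at least the number of choices
  divided by \<open>(E X)\<^sup>r\<close>. Hence no intersection theory on the Grassmannian is needed, but only the first
  moment of \<open>X\<close>. It is found by counting the solutions of \<open>v \<and> w = \<Sum> a\<^sub>k (v\<^sub>k \<and> w\<^sub>k)\<close>: coefficient
  vectors \<open>a\<close> with one nonzero entry contribute \<open>r p\<^sup>4\<close> to \<open>E X\<close>, all others together
  \<open>p\<close> to the power \<open>r - c + 4\<close>, up to a factor tending to one. For \<open>r > c\<close> the second term dominates and for
  \<open>r = c\<close> the sum is \<open>(c + 1) p\<^sup>4\<close>, where \<open>c + 1 \<le> C\<^sub>d\<^sub>-\<^sub>2\<close> if \<open>d \<ge> 5\<close>. The second term is absent for \<open>r = 1\<close>, and in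
  the remaining case \<open>d = 4\<close>, \<open>r = 2\<close> it disappears when the two planes are required to be
  complementary.

  That \<open>B\<^sub>0(G\<^sub>L)\<close> vanishes when \<open>L\<close> is spanned by wedges is seen as follows. A cocycle that is trivial on abelian
  subgroups gives a central extension \<open>E\<close> of \<open>G\<^sub>L\<close> in which commuting elements lift to commuting
  elements. So \<open>E\<close> has class two, the generators lift to elements of order \<open>p\<close>, and the resulting
  homomorphism from the free group to \<open>E\<close> kills every wedge in \<open>L\<close>; it therefore splits \<open>E\<close>.\<close>

section \<open>Linear algebra modulo a prime\<close>

text \<open>Vectors are arbitrary integer-valued functions, of which only the residues modulo \<open>p\<close> on \<open>I\<close> matter;
  the normal forms \<open>vecs p I\<close> are needed only for counting.\<close>
primrec in_span :: "nat \<Rightarrow> 'i set \<Rightarrow> ('i \<Rightarrow> int) list \<Rightarrow> ('i \<Rightarrow> int) \<Rightarrow> bool" where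
  "in_span p I [] x \<longleftrightarrow> (\<forall>i\<in>I. int p dvd x i)"
| "in_span p I (v # vs) x \<longleftrightarrow> (\<exists>a. in_span p I vs (\<lambda>i. x i - a * v i))"

lemma in_span_cong:
  "in_span p I vs x \<Longrightarrow> (\<And>i. i \<in> I \<Longrightarrow> [x i = y i] (mod int p)) \<Longrightarrow> in_span p I vs y"
proof (induction vs arbitrary: x y)
  case Nil
  then show ?case by (metis cong_dvd_iff in_span.simps(1))
next
  case (Cons v vs)
  then obtain a where "in_span p I vs (\<lambda>i. x i - a * v i)" by auto
  then have "in_span p I vs (\<lambda>i. y i - a * v i)"
    by (rule Cons.IH) (use Cons.prems(2) in \<open>auto intro: cong_diff\<close>)
  then show ?case by auto
qed

lemma in_span_zero: "in_span p I vs (\<lambda>i. 0)"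
proof (induction vs)
  case (Cons v vs)
  then show ?case by (auto intro!: exI[of _ 0])
qed simp

lemma in_span_add: "in_span p I vs x \<Longrightarrow> in_span p I vs y \<Longrightarrow> in_span p I vs (\<lambda>i. x i + y i)"
proof (induction vs arbitrary: x y)
  case (Cons v vs)
  then obtain a b where ab: "in_span p I vs (\<lambda>i. x i - a * v i)" "in_span p I vs (\<lambda>i. y i - b * v i)" by auto
  have "in_span p I vs (\<lambda>i. x i + y i - (a + b) * v i)"
    using Cons.IH[OF ab] by (simp add: algebra_simps)
  then show ?case by auto
qed simp

lemma in_span_smult: "in_span p I vs x \<Longrightarrow> in_span p I vs (\<lambda>i. c * x i)"
proof (induction vs arbitrary: x)
  case (Cons v vs)
  then obtain a where "in_span p I vs (\<lambda>i. x i - a * v i)" by auto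
  from Cons.IH[OF this] have "in_span p I vs (\<lambda>i. c * x i - (c * a) * v i)"
    by (simp add: algebra_simps)
  then show ?case by auto
qed simp

lemma in_span_diff: "in_span p I vs x \<Longrightarrow> in_span p I vs y \<Longrightarrow> in_span p I vs (\<lambda>i. x i - y i)"
  using in_span_add[of p I vs x "\<lambda>i. (-1) * y i"] in_span_smult[of p I vs y "-1"] by simp

lemma in_span_ConsI: "in_span p I vs x \<Longrightarrow> in_span p I (v # vs) x"
  by (auto intro!: exI[of _ 0])

lemma in_span_mem: "v \<in> set vs \<Longrightarrow> in_span p I vs v"
proof (induction vs)
  case (Cons w vs)
  show ?case
  proof (cases "v = w")
    case True
    then show ?thesis using in_span_zero by (auto intro!: exI[of _ 1])
  next
    case False
    with Cons show ?thesis by (intro in_span_ConsI) auto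
  qed
qed simp

lemma in_span_Cons_absorb: "in_span p I vs v \<Longrightarrow> in_span p I (v # vs) x \<longleftrightarrow> in_span p I vs x"
proof
  assume v: "in_span p I vs v" and "in_span p I (v # vs) x"
  then obtain a where "in_span p I vs (\<lambda>i. x i - a * v i)" by auto
  from in_span_add[OF this in_span_smult[OF v, of a]] show "in_span p I vs x" by simp
qed (rule in_span_ConsI)

text \<open>The base case of \<open>in_span\<close> admits every function that vanishes modulo
  \<open>p\<close> on \<open>I\<close>, not only the zero function. Induction along a span therefore
  has to carry a case \<open>cong\<close> for change of representative.\<close>

lemma in_span_induct [consumes 1, case_names cong zero add]:
  assumes "in_span p I vs x"
    and cong: "\<And>x y. P x \<Longrightarrow> (\<And>i. i \<in> I \<Longrightarrow> [x i = y i] (mod int p)) \<Longrightarrow> P y"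
    and zero: "P (\<lambda>i. 0)"
    and add: "\<And>x v a. v \<in> set vs \<Longrightarrow> P x \<Longrightarrow> P (\<lambda>i. x i + a * v i)"
  shows "P x"
  using assms(1) add
proof (induction vs arbitrary: x)
  case Nil
  then show ?case using cong[OF zero, of x] by (auto simp: cong_0_iff cong_sym_eq[of 0])
next
  case (Cons v vs)
  then obtain a where "in_span p I vs (\<lambda>i. x i - a * v i)" by auto
  from Cons.IH[OF this] Cons.prems(2) have "P (\<lambda>i. x i - a * v i)" by auto
  from Cons.prems(2)[OF _ this, of v a] show ?case by simp
qed

section \<open>Linear functionals and separation from a span\<close>

definition dot :: "'i set \<Rightarrow> ('i \<Rightarrow> int) \<Rightarrow> ('i \<Rightarrow> int) \<Rightarrow> int" where
  "dot I f x = (\<Sum>i\<in>I. f i * x i)"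

lemma dot_add: "dot I f (\<lambda>i. x i + y i) = dot I f x + dot I f y"
  by (simp add: dot_def algebra_simps sum.distrib)

lemma dot_diff: "dot I f (\<lambda>i. x i - y i) = dot I f x - dot I f y"
  by (simp add: dot_def algebra_simps sum_subtractf)

lemma dot_smult: "dot I f (\<lambda>i. c * x i) = c * dot I f x"
  by (simp add: dot_def sum_distrib_left mult.left_commute)

lemma dot_comm: "dot I f x = dot I x f"
  by (simp add: dot_def mult.commute)

lemma dot_cong: "(\<And>i. i \<in> I \<Longrightarrow> [x i = y i] (mod m)) \<Longrightarrow> [dot I f x = dot I f y] (mod m)"
  unfolding dot_def by (intro cong_sum cong_mult) auto

lemma dot_in_span:
  assumes "in_span p I vs x" "\<And>v. v \<in> set vs \<Longrightarrow> int p dvd dot I f v"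
  shows "int p dvd dot I f x"
  using assms
proof (induction rule: in_span_induct)
  case (cong x y)
  then show ?case using dot_cong[of I x y "int p" f] by (simp add: cong_dvd_iff)
qed (auto simp: dot_add dot_smult dot_def[of I f "\<lambda>i. 0"])

lemma prime_inverse:
  assumes "prime p" "\<not> int p dvd a"
  obtains b where "[a * b = 1] (mod int p)"
proof -
  have "coprime a (int p)"
    using assms by (metis coprime_commute prime_imp_coprime prime_nat_int_transfer)
  then show ?thesis using cong_solve_coprime_int that by blast
qed

text \<open>Induction on the list. If the functional \<open>f\<close> found for the tail also kills
  the new head \<open>u\<close>, it can be kept. Otherwise \<open>x\<close> is shifted by a multiple
  \<open>b * u\<close> on which \<open>f\<close> takes the value 1; the shifted vector is still
  outside the span of the tail and has its own functional \<open>g\<close>, which is then corrected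
  by a multiple of \<open>f\<close>.\<close>

lemma separating_functional:
  assumes p: "prime p" and I: "finite I" and x: "\<not> in_span p I vs x"
  obtains f where "\<And>v. v \<in> set vs \<Longrightarrow> int p dvd dot I f v" "[dot I f x = 1] (mod int p)"
proof -
  have "\<exists>f. (\<forall>v\<in>set vs. int p dvd dot I f v) \<and> [dot I f x = 1] (mod int p)"
    using x
  proof (induction vs arbitrary: x)
    case Nil
    then obtain i where i: "i \<in> I" "\<not> int p dvd x i" by auto
    obtain b where b: "[x i * b = 1] (mod int p)" using prime_inverse[OF p i(2)] .
    have "dot I (\<lambda>j. if j = i then b else 0) x = b * x i"
      using i(1) I by (simp add: dot_def if_distrib[of "\<lambda>t. t * _"] sum.delta cong: if_cong)
    then show ?case using b by (auto intro!: exI[of _ "\<lambda>j. if j = i then b else 0"] simp: mult.commute)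
  next
    case (Cons u vs)
    have "\<not> in_span p I vs x" using Cons.prems in_span_ConsI by blast
    from Cons.IH[OF this] obtain f where f: "\<forall>v\<in>set vs. int p dvd dot I f v" "[dot I f x = 1] (mod int p)" by blast
    show ?case
    proof (cases "int p dvd dot I f u")
      case True
      then show ?thesis using f by auto
    next
      case False
      then obtain b where b: "[dot I f u * b = 1] (mod int p)" by (rule prime_inverse[OF p])
      have "\<not> in_span p I vs (\<lambda>i. x i - b * u i)" using Cons.prems by auto
      from Cons.IH[OF this] obtain g where g: "\<forall>v\<in>set vs. int p dvd dot I g v"
        "[dot I g (\<lambda>i. x i - b * u i) = 1] (mod int p)" by blast
      \<comment> \<open>As \<open>dot I f u * b\<close> is 1, this multiple of \<open>f\<close>
        cancels \<open>g\<close> on \<open>u\<close>; as \<open>f\<close> is 1 at \<open>x\<close>,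
        the value at \<open>x\<close> becomes that of \<open>g\<close> at \<open>x - b * u\<close>,
        which is 1.\<close>
      let ?h = "\<lambda>i. g i - (b * dot I g u) * f i"
      have h: "dot I ?h v = dot I g v - b * dot I g u * dot I f v" for v
        by (simp add: dot_comm[of I _ v] dot_diff dot_smult)
      have "\<forall>v\<in>set vs. int p dvd dot I ?h v" using f(1) g(1) by (auto simp: h)
      moreover have "int p dvd dot I ?h u"
      proof -
        have "dot I ?h u = dot I g u * (1 - dot I f u * b)" by (simp only: h) (simp add: algebra_simps)
        moreover have "int p dvd 1 - dot I f u * b" using b by (simp add: cong_iff_dvd_diff dvd_diff_commute)
        ultimately show ?thesis by simp
      qed
      moreover have "[dot I ?h x = 1] (mod int p)"
      proof -
        have "[dot I g x - b * dot I g u * dot I f x = dot I g x - b * dot I g u * 1] (mod int p)"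
          using f(2) by (intro cong_diff cong_mult) auto
        also have "dot I g x - b * dot I g u * 1 = dot I g (\<lambda>i. x i - b * u i)"
          by (simp add: dot_diff dot_smult)
        also note g(2)
        finally show ?thesis by (simp add: h)
      qed
      ultimately show ?thesis by (intro exI[of _ ?h]) auto
    qed
  qed
  then show ?thesis using that by blast
qed

section \<open>Normal forms, rank and the size of a span\<close>

definition vecs :: "nat \<Rightarrow> 'i set \<Rightarrow> ('i \<Rightarrow> int) set" where
  "vecs p I = (I \<rightarrow>\<^sub>E {0..<int p})"

definition reduce :: "nat \<Rightarrow> 'i set \<Rightarrow> ('i \<Rightarrow> int) \<Rightarrow> ('i \<Rightarrow> int)" where
  "reduce p I x = (\<lambda>i\<in>I. x i mod int p)"

lemma reduce_cong [simp]: "i \<in> I \<Longrightarrow> [reduce p I x i = x i] (mod int p)"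
  by (simp add: reduce_def cong_def)

lemma reduce_vecs [simp]: "p > 0 \<Longrightarrow> reduce p I x \<in> vecs p I"
  by (auto simp: reduce_def vecs_def)

lemma in_span_reduce [simp]: "in_span p I vs (reduce p I x) \<longleftrightarrow> in_span p I vs x"
  using in_span_cong[of p I vs "reduce p I x" x] in_span_cong[of p I vs x "reduce p I x"] reduce_cong
  by (metis cong_sym)

lemma vecs_eqI:
  assumes "x \<in> vecs p I" "y \<in> vecs p I" "\<And>i. i \<in> I \<Longrightarrow> [x i = y i] (mod int p)"
  shows "x = y"
proof
  fix i
  show "x i = y i"
    using assms by (cases "i \<in> I") (auto simp: vecs_def PiE_iff extensional_def cong_def)
qed

lemma reduce_id: "p > 0 \<Longrightarrow> x \<in> vecs p I \<Longrightarrow> reduce p I x = x"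
  by (rule vecs_eqI) auto

lemma finite_vecs [simp]: "finite I \<Longrightarrow> finite (vecs p I)"
  by (auto simp: vecs_def intro: finite_PiE)

lemma card_vecs: "finite I \<Longrightarrow> card (vecs p I) = p ^ card I"
  by (simp add: vecs_def card_PiE)

text \<open>The dimension of the span over the prime field, read off from the end of the list: the
  link with actual subspaces is \<open>card_span_set\<close>.\<close>

primrec lrank :: "nat \<Rightarrow> 'i set \<Rightarrow> ('i \<Rightarrow> int) list \<Rightarrow> nat" where
  "lrank p I [] = 0"
| "lrank p I (v # vs) = lrank p I vs + (if in_span p I vs v then 0 else 1)"

lemma lrank_le_length: "lrank p I vs \<le> length vs"
  by (induction vs) auto

definition span_set :: "nat \<Rightarrow> 'i set \<Rightarrow> ('i \<Rightarrow> int) list \<Rightarrow> ('i \<Rightarrow> int) set" where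
  "span_set p I vs = {x \<in> vecs p I. in_span p I vs x}"

lemma finite_span_set: "finite I \<Longrightarrow> finite (span_set p I vs)"
  by (simp add: span_set_def)

text \<open>A head in the span of the tail adds nothing. A head \<open>v\<close> outside it
  multiplies the size by \<open>p\<close>, since every element of the larger span is
  \<open>x + a * v\<close> for a unique scalar \<open>a\<close> and a unique \<open>x\<close> in the
  smaller one.\<close>

lemma card_span_set:
  assumes p: "prime p" and I: "finite I"
  shows "card (span_set p I vs) = p ^ lrank p I vs"
proof (induction vs)
  case Nil
  have p0: "p > 0" using p by (simp add: prime_gt_0_nat)
  have "span_set p I [] = {reduce p I (\<lambda>_. 0)}"
  proof
    show "span_set p I [] \<subseteq> {reduce p I (\<lambda>_. 0)}"
      using p0 by (auto simp: span_set_def cong_0_iff reduce_def cong_def intro!: vecs_eqI[of _ p I])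
         (auto simp: vecs_def)
  qed (use p0 in \<open>auto simp: span_set_def simp del: in_span.simps intro: in_span_zero\<close>)
  then show ?case by simp
next
  case (Cons v vs)
  have p0: "p > 0" using p by (simp add: prime_gt_0_nat)
  show ?case
  proof (cases "in_span p I vs v")
    case True
    then have "span_set p I (v # vs) = span_set p I vs"
      unfolding span_set_def by (simp only: in_span_Cons_absorb)
    then show ?thesis using True Cons by simp
  next
    case False
    let ?f = "\<lambda>(a, x). reduce p I (\<lambda>i. x i + a * v i)"
    have "bij_betw ?f ({0..<int p} \<times> span_set p I vs) (span_set p I (v # vs))"
      unfolding bij_betw_def
    proof
      show "inj_on ?f ({0..<int p} \<times> span_set p I vs)"
      proof (rule inj_onI, clarify)
        fix a b x y
        assume ab: "a \<in> {0..<int p}" "b \<in> {0..<int p}" and xy: "x \<in> span_set p I vs" "y \<in> span_set p I vs"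
          and eq: "reduce p I (\<lambda>i. x i + a * v i) = reduce p I (\<lambda>i. y i + b * v i)"
        have c: "[x i + a * v i = y i + b * v i] (mod int p)" if "i \<in> I" for i
          using fun_cong[OF eq, of i] that by (simp add: reduce_def cong_def)
        \<comment> \<open>Otherwise \<open>(a - b) * v\<close> is congruent to \<open>y - x\<close>,
          and dividing by \<open>a - b\<close> puts \<open>v\<close> into the span of
          \<open>vs\<close>.\<close>
        have *: "a = b"
        proof (rule ccontr)
          assume "a \<noteq> b"
          then have "\<not> int p dvd a - b" using ab
            by (metis atLeastLessThan_iff mod_eq_dvd_iff mod_pos_pos_trivial)
          then obtain e where e: "[(a - b) * e = 1] (mod int p)" by (rule prime_inverse[OF p])
          have "in_span p I vs (\<lambda>i. e * (y i - x i))"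
            using xy by (intro in_span_smult in_span_diff) (auto simp: span_set_def)
          then have "in_span p I vs v"
          proof (rule in_span_cong)
            fix i assume "i \<in> I"
            from c[OF this] have "[y i - x i = (a - b) * v i] (mod int p)"
              by (simp add: cong_iff_dvd_diff algebra_simps dvd_diff_commute)
            then have "[e * (y i - x i) = e * ((a - b) * v i)] (mod int p)" by (rule cong_scalar_left)
            also have "e * ((a - b) * v i) = (a - b) * e * v i" by simp
            also have "[(a - b) * e * v i = 1 * v i] (mod int p)" using e by (rule cong_scalar_right)
            finally show "[e * (y i - x i) = v i] (mod int p)" by simp
          qed
          with False show False by blast
        qed
        have "x = y" using xy c unfolding * by (intro vecs_eqI[of _ p I]) (auto simp: span_set_def cong_add_rcancel)
        with * show "a = b \<and> x = y" by simp
      qed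
      show "?f ` ({0..<int p} \<times> span_set p I vs) = span_set p I (v # vs)"
      proof
        show "?f ` ({0..<int p} \<times> span_set p I vs) \<subseteq> span_set p I (v # vs)"
        proof clarify
          fix a x assume "x \<in> span_set p I vs"
          then have "in_span p I vs (\<lambda>i. x i + a * v i - a * v i)" by (simp add: span_set_def)
          then have "in_span p I (v # vs) (\<lambda>i. x i + a * v i)" unfolding in_span.simps by (rule exI)
          then show "reduce p I (\<lambda>i. x i + a * v i) \<in> span_set p I (v # vs)"
            using p0 by (simp add: span_set_def del: in_span.simps)
        qed
        show "span_set p I (v # vs) \<subseteq> ?f ` ({0..<int p} \<times> span_set p I vs)"
        proof
          fix x assume x: "x \<in> span_set p I (v # vs)"
          then obtain a where a: "in_span p I vs (\<lambda>i. x i - a * v i)" by (auto simp: span_set_def)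
          have "in_span p I vs (\<lambda>i. x i - (a mod int p) * v i)"
            by (rule in_span_cong[OF a], intro cong_diff cong_mult) (auto simp: cong_def)
          then have "reduce p I (\<lambda>i. x i - (a mod int p) * v i) \<in> span_set p I vs"
            using p0 by (simp add: span_set_def)
          moreover have "x = ?f (a mod int p, reduce p I (\<lambda>i. x i - (a mod int p) * v i))"
          proof -
            have "[x i = reduce p I (\<lambda>i. reduce p I (\<lambda>i. x i - a mod int p * v i) i + a mod int p * v i) i] (mod int p)"
              if "i \<in> I" for i
            proof -
              have "[reduce p I (\<lambda>i. reduce p I (\<lambda>i. x i - a mod int p * v i) i + a mod int p * v i) i
                = reduce p I (\<lambda>i. x i - a mod int p * v i) i + a mod int p * v i] (mod int p)"
                using that by (rule reduce_cong)
              also have "[reduce p I (\<lambda>i. x i - a mod int p * v i) i + a mod int p * v i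
                  = x i - a mod int p * v i + a mod int p * v i] (mod int p)"
                using that by (intro cong_add cong_refl reduce_cong)
              finally show ?thesis by (simp add: cong_sym_eq)
            qed
            moreover have "x \<in> vecs p I" using x by (simp add: span_set_def)
            ultimately show ?thesis unfolding case_prod_conv using p0 by (intro vecs_eqI[of _ p I] reduce_vecs) auto
          qed
          ultimately show "x \<in> ?f ` ({0..<int p} \<times> span_set p I vs)"
            using p0 by (intro image_eqI[of _ _ "(a mod int p, reduce p I (\<lambda>i. x i - (a mod int p) * v i))"]) auto
        qed
      qed
    qed
    from bij_betw_same_card[OF this] show ?thesis using False Cons by (simp add: card_cartesian_product)
  qed
qed

lemma lrank_le_card: "prime p \<Longrightarrow> finite I \<Longrightarrow> lrank p I vs \<le> card I"
proof -
  assume p: "prime p" and I: "finite I"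
  have "p ^ lrank p I vs = card (span_set p I vs)" using card_span_set[OF p I] by simp
  also have "\<dots> \<le> card (vecs p I)" by (rule card_mono) (auto simp: I span_set_def)
  also have "\<dots> = p ^ card I" by (rule card_vecs[OF I])
  finally show ?thesis using p prime_gt_1_nat power_le_imp_le_exp by blast
qed

section \<open>Counting relations between wedges\<close>

text \<open>An integral representative of \<open>wedge\<close>, left unreduced and defined on all
  index pairs. Contraction below needs the entries on and under the diagonal too.\<close>

definition wdg :: "(nat \<Rightarrow> int) \<Rightarrow> (nat \<Rightarrow> int) \<Rightarrow> nat \<times> nat \<Rightarrow> int" where
  "wdg v w = (\<lambda>(i, j). v i * w j - v j * w i)"

definition alternating :: "(nat \<times> nat \<Rightarrow> int) \<Rightarrow> bool" where
  "alternating T \<longleftrightarrow> (\<forall>i j. T (j, i) = - T (i, j))"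

definition wsum :: "(nat \<Rightarrow> int) list \<Rightarrow> (nat \<Rightarrow> int) list \<Rightarrow> nat \<times> nat \<Rightarrow> int" where
  "wsum vs ws ij = sum_list (map (\<lambda>(v, w). wdg v w ij) (zip vs ws))"

lemma wsum_simps [simp]: "wsum [] ws ij = 0" "wsum (v # vs) (w # ws) ij = wdg v w ij + wsum vs ws ij"
  by (simp_all add: wsum_def)

lemma alternating_wdg: "alternating (wdg v w)"
  by (simp add: alternating_def wdg_def)

lemma alternating_add: "alternating S \<Longrightarrow> alternating T \<Longrightarrow> alternating (\<lambda>ij. S ij + T ij)"
  unfolding alternating_def by (metis minus_add_distrib)

lemma alternating_wsum: "alternating (wsum vs ws)"
proof (induction vs arbitrary: ws)
  case (Cons v vs)
  show ?case
  proof (cases ws)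
    case Nil
    then show ?thesis by (simp add: alternating_def wsum_def)
  next
    case (Cons w ws')
    have "wsum (v # vs) (w # ws') = (\<lambda>ij. wdg v w ij + wsum vs ws' ij)" by auto
    then show ?thesis using alternating_add[OF alternating_wdg[of v w] Cons.IH[of ws']] Cons by simp
  qed
qed (simp add: alternating_def)

text \<open>Antisymmetry carries divisibility across the diagonal. The diagonal entries vanish
  outright because they are their own negatives in the integers.\<close>

lemma alternating_dvd:
  assumes "alternating T" "\<And>ij. ij \<in> pairs d \<Longrightarrow> m dvd T ij" "i < d" "j < d"
  shows "m dvd T (i, j)"
proof -
  consider "i < j" | "j < i" | "i = j" by linarith
  then show ?thesis
  proof cases
    case 2
    then have "m dvd T (j, i)" using assms by (auto simp: pairs_def)
    then show ?thesis using assms(1) by (metis alternating_def dvd_minus_iff)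
  next
    case 3
    have "T (i, i) + T (i, i) = 0" using assms(1) by (metis alternating_def add.right_inverse)
    then have "T (i, i) = 0" by linarith
    then show ?thesis using 3 by simp
  qed (use assms in \<open>auto simp: pairs_def\<close>)
qed

section \<open>Contraction with a functional and Cartan's lemma\<close>

definition contract :: "nat \<Rightarrow> (nat \<Rightarrow> int) \<Rightarrow> (nat \<times> nat \<Rightarrow> int) \<Rightarrow> nat \<Rightarrow> int" where
  "contract d f T j = (\<Sum>i<d. f i * T (i, j))"

lemma contract_add: "contract d f (\<lambda>ij. S ij + T ij) j = contract d f S j + contract d f T j"
  by (simp add: contract_def algebra_simps sum.distrib)

lemma contract_wdg: "contract d f (wdg v w) j = dot {..<d} f v * w j - dot {..<d} f w * v j"
  by (simp add: contract_def wdg_def dot_def algebra_simps sum_subtractf sum_distrib_left)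

text \<open>Contracting \<open>v \<and> w\<close> with \<open>f\<close> gives
  \<open>f(v) w - f(w) v\<close>, and the first term disappears when \<open>f\<close> kills
  \<open>v\<close>.\<close>

lemma contract_wsum_in_span:
  assumes "\<And>v. v \<in> set vs \<Longrightarrow> int p dvd dot {..<d} f v" "length ws = length vs"
  shows "in_span p {..<d} vs (contract d f (wsum vs ws))"
  using assms
proof (induction vs arbitrary: ws)
  case Nil
  then show ?case by (simp add: contract_def wsum_def)
next
  case (Cons v vs)
  then obtain w ws' where ws: "ws = w # ws'" "length ws' = length vs" by (cases ws) auto
  have "in_span p {..<d} vs (contract d f (wsum vs ws'))" using Cons ws by auto
  then have "in_span p {..<d} (v # vs) (\<lambda>j. contract d f (wsum vs ws') j + (- dot {..<d} f w) * v j)"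
    by (rule in_span_add[OF in_span_ConsI in_span_smult[OF in_span_mem]]) simp
  then show ?case
  proof (rule in_span_cong)
    fix j
    have "contract d f (wsum (v # vs) ws) j
      = contract d f (wsum vs ws') j + (- dot {..<d} f w) * v j + dot {..<d} f v * w j"
      unfolding ws contract_add[symmetric] by (simp add: contract_def wdg_def dot_def algebra_simps sum_subtractf sum_distrib_left sum.distrib)
    moreover have "int p dvd dot {..<d} f v * w j" using Cons.prems by auto
    ultimately show "[contract d f (wsum vs ws') j + (- dot {..<d} f w) * v j =
        contract d f (wsum (v # vs) ws) j] (mod int p)"
      by (simp only: cong_iff_dvd_diff) simp
  qed
qed

text \<open>The solutions \<open>ws\<close> of an inhomogeneous equation
  \<open>T + \<Sum> v\<^sub>k \<and> w\<^sub>k = 0\<close>. The inhomogeneity \<open>T\<close> is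
  there for the induction: it absorbs the wedges whose partners are already fixed.\<close>

definition partners :: "nat \<Rightarrow> nat \<Rightarrow> (nat \<Rightarrow> int) list \<Rightarrow> (nat \<times> nat \<Rightarrow> int) \<Rightarrow> (nat \<Rightarrow> int) list set" where
  "partners p d vs T = {ws. length ws = length vs \<and> set ws \<subseteq> vecs p {..<d} \<and>
     (\<forall>ij\<in>pairs d. int p dvd T ij + wsum vs ws ij)}"

lemma finite_vec_lists: "finite {ws. length ws = m \<and> set ws \<subseteq> vecs p {..<d::nat} \<and> P ws}"
  by (rule finite_subset[OF _ finite_lists_length_eq[of "vecs p {..<d}" m]]) auto

lemma finite_partners: "finite (partners p d vs T)"
  unfolding partners_def by (rule finite_vec_lists)

text \<open>Contract the equation with \<open>f\<close>. Since \<open>f(v)\<close> is 1 and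
  \<open>f\<close> kills \<open>vs\<close>, it turns into a formula for \<open>w\<close> plus the
  contraction of \<open>T\<close>: it equals \<open>f(w) v\<close> plus an element of the span of
  \<open>vs\<close>.\<close>

lemma partners_Cons_in_span:
  assumes f: "\<And>u. u \<in> set vs \<Longrightarrow> int p dvd dot {..<d} f u" "[dot {..<d} f v = 1] (mod int p)"
    and T: "alternating T" and w: "w # ws \<in> partners p d (v # vs) T"
  shows "in_span p {..<d} (v # vs) (\<lambda>j. w j + contract d f T j)"
proof -
  let ?Q = "\<lambda>ij. T ij + (wdg v w ij + wsum vs ws ij)"
  have "in_span p {..<d} vs (contract d f (wsum vs ws))"
    using f(1) w by (intro contract_wsum_in_span) (auto simp: partners_def)
  then have "in_span p {..<d} (v # vs) (\<lambda>j. (dot {..<d} f w) * v j + (-1) * contract d f (wsum vs ws) j)"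
    by (rule in_span_add[OF in_span_smult[OF in_span_mem] in_span_smult[OF in_span_ConsI], rotated]) simp
  then show ?thesis
  proof (rule in_span_cong)
    fix j assume j: "j \<in> {..<d}"
    have alt: "alternating ?Q" by (intro alternating_add T alternating_wdg alternating_wsum)
    have "int p dvd ?Q ij" if "ij \<in> pairs d" for ij
      using w that by (simp add: partners_def)
    from alternating_dvd[OF alt this] have "int p dvd ?Q (i, j)" if "i < d" for i
      using j that by blast
    then have "int p dvd contract d f ?Q j" unfolding contract_def by (intro dvd_sum dvd_mult) simp
    moreover have "int p dvd (dot {..<d} f v - 1) * w j" using f(2) by (simp add: cong_iff_dvd_diff)
    ultimately have "int p dvd (dot {..<d} f v - 1) * w j - contract d f ?Q j" by (rule dvd_diff[rotated])
    also have "(dot {..<d} f v - 1) * w j - contract d f ?Q j =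
      dot {..<d} f w * v j + (-1) * contract d f (wsum vs ws) j - (w j + contract d f T j)"
      by (simp add: contract_add contract_wdg algebra_simps)
    finally show "[dot {..<d} f w * v j + (-1) * contract d f (wsum vs ws) j = w j + contract d f T j] (mod int p)"
      by (simp only: cong_iff_dvd_diff)
  qed
qed

text \<open>If \<open>v\<close> is not in the span of \<open>vs\<close>, contraction with a functional that kills \<open>vs\<close> but not \<open>v\<close> confines the
  partner of \<open>v\<close> to a coset of the span of \<open>v # vs\<close> (Cartan's lemma).\<close>
lemma card_partners:
  assumes p: "prime p" and T: "alternating T"
  shows "card (partners p d vs T) * p ^ (d * lrank p {..<d} vs)
    \<le> p ^ (d * length vs) * p ^ (Suc (lrank p {..<d} vs) choose 2)"
  using T
proof (induction vs arbitrary: T)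
  case Nil
  have "partners p d [] T \<subseteq> {[]}" by (auto simp: partners_def)
  from card_mono[OF _ this] show ?case by (simp add: binomial_eq_0)
next
  case (Cons v vs)
  define u where "u = lrank p {..<d} vs"
  \<comment> \<open>For any finite set \<open>B\<close> that contains all possible first partners:
    once \<open>w\<close> is fixed, \<open>v \<and> w\<close> moves into \<open>T\<close> and the
    induction hypothesis applies to the tail.\<close>
  have step: "card (partners p d (v # vs) T) * p ^ (d * u) \<le> card B * (p ^ (d * length vs) * p ^ (Suc u choose 2))"
    if B: "finite B" "\<And>w ws. w # ws \<in> partners p d (v # vs) T \<Longrightarrow> w \<in> B" for B
  proof -
    have sub: "partners p d (v # vs) T \<subseteq> (\<Union>w\<in>B. (#) w ` partners p d vs (\<lambda>ij. T ij + wdg v w ij))"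
    proof
      fix l assume l: "l \<in> partners p d (v # vs) T"
      then obtain w ws where ws: "l = w # ws" by (auto simp: partners_def length_Suc_conv)
      have "ws \<in> partners p d vs (\<lambda>ij. T ij + wdg v w ij)"
        using l unfolding ws partners_def by (auto simp: add.assoc)
      with B(2) l ws show "l \<in> (\<Union>w\<in>B. (#) w ` partners p d vs (\<lambda>ij. T ij + wdg v w ij))" by blast
    qed
    have "card (partners p d (v # vs) T) \<le> card (\<Union>w\<in>B. (#) w ` partners p d vs (\<lambda>ij. T ij + wdg v w ij))"
      by (rule card_mono[OF _ sub]) (use B(1) finite_partners in auto)
    also have "\<dots> \<le> (\<Sum>w\<in>B. card ((#) w ` partners p d vs (\<lambda>ij. T ij + wdg v w ij)))"
      by (rule card_UN_le[OF B(1)])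
    also have "\<dots> = (\<Sum>w\<in>B. card (partners p d vs (\<lambda>ij. T ij + wdg v w ij)))"
      by (intro sum.cong refl card_image) auto
    finally have "card (partners p d (v # vs) T) * p ^ (d * u)
       \<le> (\<Sum>w\<in>B. card (partners p d vs (\<lambda>ij. T ij + wdg v w ij)) * p ^ (d * u))"
      by (simp add: sum_distrib_right[symmetric])
    also have "\<dots> \<le> (\<Sum>w\<in>B. p ^ (d * length vs) * p ^ (Suc u choose 2))"
      unfolding u_def by (intro sum_mono Cons.IH alternating_add Cons.prems alternating_wdg)
    finally show ?thesis by simp
  qed
  show ?case
  proof (cases "in_span p {..<d} vs v")
    case True
    have "w \<in> vecs p {..<d}" if "w # ws \<in> partners p d (v # vs) T" for w ws
      using that by (auto simp: partners_def)
    from step[OF _ this] show ?thesis using True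
      by (simp add: u_def card_vecs power_add mult.assoc)
  next
    case False
    obtain f where f: "\<And>u. u \<in> set vs \<Longrightarrow> int p dvd dot {..<d} f u" "[dot {..<d} f v = 1] (mod int p)"
      using separating_functional[OF p _ False] by auto
    \<comment> \<open>Translation by the contraction of \<open>T\<close> embeds this set into the
      span of \<open>v # vs\<close>, which has \<open>p ^ Suc u\<close> elements.\<close>
    define B where "B = {w \<in> vecs p {..<d}. in_span p {..<d} (v # vs) (\<lambda>j. w j + contract d f T j)}"
    have "inj_on (\<lambda>w. reduce p {..<d} (\<lambda>j. w j + contract d f T j)) B"
    proof (rule inj_onI)
      fix w w' assume w: "w \<in> B" "w' \<in> B"
        and eq: "reduce p {..<d} (\<lambda>j. w j + contract d f T j) = reduce p {..<d} (\<lambda>j. w' j + contract d f T j)"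
      have "[w i = w' i] (mod int p)" if "i \<in> {..<d}" for i
        using fun_cong[OF eq, of i] that
        by (simp add: reduce_def flip: cong_def) (simp add: cong_add_rcancel)
      then show "w = w'" using w by (intro vecs_eqI[of _ p "{..<d}"]) (auto simp: B_def)
    qed
    moreover have "(\<lambda>w. reduce p {..<d} (\<lambda>j. w j + contract d f T j)) ` B \<subseteq> span_set p {..<d} (v # vs)"
      using prime_gt_0_nat[OF p] by (auto simp: B_def span_set_def simp del: in_span.simps)
    ultimately have "card B \<le> card (span_set p {..<d} (v # vs))"
      by (intro card_inj_on_le) (auto simp: finite_span_set)
    also have "\<dots> = p ^ Suc u" using card_span_set[OF p, of "{..<d}" "v # vs"] False by (simp add: u_def)
    finally have cB: "card B \<le> p ^ Suc u" .
    have "w \<in> B" if "w # ws \<in> partners p d (v # vs) T" for w ws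
      using that partners_Cons_in_span[OF f Cons.prems that] by (auto simp: B_def partners_def simp del: in_span.simps)
    moreover have "finite B" unfolding B_def by simp
    ultimately have "card (partners p d (v # vs) T) * p ^ (d * u) \<le> card B * (p ^ (d * length vs) * p ^ (Suc u choose 2))"
      by (intro step) auto
    also have "\<dots> \<le> p ^ Suc u * (p ^ (d * length vs) * p ^ (Suc u choose 2))"
      using cB by (intro mult_right_mono) auto
    finally have "card (partners p d (v # vs) T) * p ^ (d * u) * p ^ d
       \<le> p ^ Suc u * (p ^ (d * length vs) * p ^ (Suc u choose 2)) * p ^ d"
      by (intro mult_right_mono) auto
    \<comment> \<open>The exponent \<open>Suc u\<close> contributed by \<open>B\<close> is exactly
      the increment of the binomial coefficient, while the factor \<open>p ^ d\<close> accounts for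
      the increase of the rank on the left.\<close>
    moreover have "Suc (Suc u) choose 2 = Suc u + (Suc u choose 2)" by (simp add: numeral_2_eq_2)
    ultimately show ?thesis using False
      by (simp add: u_def[symmetric] power_add algebra_simps)
  qed
qed

section \<open>Lists of vectors of given rank\<close>

definition nonzero_count :: "nat \<Rightarrow> int list \<Rightarrow> nat" where
  "nonzero_count p as = length (filter (\<lambda>a. \<not> int p dvd a) as)"

abbreviation scaled :: "int list \<Rightarrow> ('i \<Rightarrow> int) list \<Rightarrow> ('i \<Rightarrow> int) list" where
  "scaled as vs \<equiv> map2 (\<lambda>a v i. a * v i) as vs"

lemma in_span_dvd_smult: "int p dvd a \<Longrightarrow> in_span p I vs (\<lambda>i. a * v i)"
  by (rule in_span_cong[OF in_span_zero]) (auto simp: cong_iff_dvd_diff)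

lemma in_span_smult_iff:
  assumes "prime p" "\<not> int p dvd a"
  shows "in_span p I vs (\<lambda>i. a * v i) \<longleftrightarrow> in_span p I vs v"
proof
  assume *: "in_span p I vs (\<lambda>i. a * v i)"
  obtain b where b: "[a * b = 1] (mod int p)" using prime_inverse[OF assms] .
  show "in_span p I vs v"
  proof (rule in_span_cong[OF in_span_smult[OF *, of b]])
    fix i
    have "[a * b * v i = 1 * v i] (mod int p)" by (rule cong_scalar_right[OF b])
    then show "[b * (a * v i) = v i] (mod int p)" by (simp add: ac_simps)
  qed
qed (rule in_span_smult)

lemma lrank_scaled_le:
  "length as = length vs \<Longrightarrow> lrank p I (scaled as vs) \<le> nonzero_count p as"
proof (induction as vs rule: list_induct2)
  case (Cons a as v vs)
  then show ?case
    using in_span_dvd_smult[of p a I "scaled as vs" v] by (auto simp: nonzero_count_def)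
qed simp

definition rank_lists :: "nat \<Rightarrow> nat \<Rightarrow> int list \<Rightarrow> nat \<Rightarrow> (nat \<Rightarrow> int) list set" where
  "rank_lists p d as u = {vs. length vs = length as \<and> set vs \<subseteq> vecs p {..<d} \<and>
     lrank p {..<d} (scaled as vs) = u}"

lemma finite_rank_lists: "finite (rank_lists p d as u)"
  unfolding rank_lists_def by (rule finite_vec_lists)

text \<open>Only the \<open>s = nonzero_count p as\<close> vectors with nonzero coefficient matter.
  They form a \<open>d\<close> by \<open>s\<close> matrix, and matrices of rank \<open>u\<close>
  have codimension \<open>(d - u) * (s - u)\<close>; the exponents are multiplied out so that no
  subtraction occurs. The power of 2 pays for the alternative, at every entry, whether the rank
  grows.\<close>

lemma card_rank_lists:
  assumes p: "prime p"
  shows "card (rank_lists p d as u) * p ^ (u * u + d * nonzero_count p as)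
    \<le> 2 ^ length as * p ^ (d * length as + u * (d + nonzero_count p as))"
proof (induction as arbitrary: u)
  case Nil
  have "rank_lists p d [] u \<subseteq> (if u = 0 then {[]} else {})" by (auto simp: rank_lists_def)
  from card_mono[OF _ this] show ?case by (cases "u = 0") (auto simp: nonzero_count_def)
next
  case (Cons a as)
  define s where "s = nonzero_count p as"
  define m where "m = length as"
  have p1: "p > 0" using p by (simp add: prime_gt_0_nat)
  show ?case
  proof (cases "int p dvd a")
    case True
    have "rank_lists p d (a # as) u \<subseteq> (\<lambda>(v, vs). v # vs) ` (vecs p {..<d} \<times> rank_lists p d as u)"
      using in_span_dvd_smult[OF True]
      by (auto simp: rank_lists_def length_Suc_conv image_iff simp del: in_span.simps)
    then have "card (rank_lists p d (a # as) u) \<le> card (vecs p {..<d} \<times> rank_lists p d as u)"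
      by (intro surj_card_le) (auto simp: finite_rank_lists)
    also have "\<dots> = p ^ d * card (rank_lists p d as u)" by (simp add: card_cartesian_product card_vecs)
    finally have "card (rank_lists p d (a # as) u) * p ^ (u * u + d * s)
      \<le> p ^ d * (card (rank_lists p d as u) * p ^ (u * u + d * s))" by simp
    also have "\<dots> \<le> p ^ d * (2 ^ m * p ^ (d * m + u * (d + s)))"
      unfolding s_def m_def by (intro mult_left_mono Cons.IH) simp
    also have "\<dots> \<le> 2 ^ Suc m * p ^ (d * Suc m + u * (d + s))"
      by (simp add: power_add)
    finally show ?thesis using True by (simp add: s_def m_def nonzero_count_def)
  next
    case False
    define R where "R = rank_lists p d as"
    \<comment> \<open>\<open>A\<close> takes care of the lists whose head lies in the span of the
      scaled tail, \<open>B\<close> of those whose head raises the rank. In \<open>B\<close> the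
      head is allowed to be arbitrary.\<close>
    define A where "A = (SIGMA vs:R u. span_set p {..<d} (scaled as vs))"
    define B where "B = (if u = 0 then {} else R (u - 1) \<times> vecs p {..<d})"
    have "rank_lists p d (a # as) u \<subseteq> (\<lambda>(vs, v). v # vs) ` (A \<union> B)"
    proof
      fix l assume l: "l \<in> rank_lists p d (a # as) u"
      then obtain v vs where l': "l = v # vs" by (auto simp: rank_lists_def length_Suc_conv)
      show "l \<in> (\<lambda>(vs, v). v # vs) ` (A \<union> B)"
        using l in_span_smult_iff[OF p False, of "{..<d}" "scaled as vs" v]
        unfolding l' by (intro image_eqI[of _ _ "(vs, v)"]; cases "in_span p {..<d} (scaled as vs) v")
          (auto simp: rank_lists_def A_def B_def R_def span_set_def)
    qed
    moreover have fin: "finite A" "finite B"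
      by (auto simp: A_def B_def R_def finite_rank_lists finite_span_set)
    ultimately have "card (rank_lists p d (a # as) u) \<le> card (A \<union> B)"
      by (intro surj_card_le) auto
    also have "\<dots> \<le> card A + card B" by (rule card_Un_le)
    finally have 1: "card (rank_lists p d (a # as) u) \<le> card A + card B" .
    have "card A = (\<Sum>vs\<in>R u. card (span_set p {..<d} (scaled as vs)))"
      unfolding A_def R_def by (rule card_SigmaI) (auto simp: finite_rank_lists finite_span_set)
    also have "\<dots> = (\<Sum>vs\<in>R u. p ^ u)"
      by (intro sum.cong) (auto simp: card_span_set[OF p] R_def rank_lists_def)
    finally have "card A = card (R u) * p ^ u" by simp
    then have "card A * p ^ (u * u + d * Suc s) = card (R u) * p ^ (u * u + d * s) * p ^ (u + d)"
      by (simp add: power_add)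
    also have "\<dots> \<le> 2 ^ m * p ^ (d * m + u * (d + s)) * p ^ (u + d)"
      unfolding s_def m_def R_def by (intro mult_right_mono Cons.IH) simp
    also have "\<dots> = 2 ^ m * p ^ (d * Suc m + u * (d + Suc s))"
      by (simp add: power_add algebra_simps)
    finally have 2: "card A * p ^ (u * u + d * Suc s) \<le> 2 ^ m * p ^ (d * Suc m + u * (d + Suc s))" .
    have 3: "card B * p ^ (u * u + d * Suc s) \<le> 2 ^ m * p ^ (d * Suc m + u * (d + Suc s))"
    proof (cases "u = 0 \<or> R (u - 1) = {}")
      case True
      then have "card B = 0" by (auto simp: B_def)
      then show ?thesis by simp
    next
      case False
      then obtain t where t: "u = Suc t" by (cases u) auto
      from False t obtain vs where "vs \<in> R t" by auto
      \<comment> \<open>The exponents compared at the end of this case differ by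
        \<open>s - t\<close>.\<close>
      then have ts: "t \<le> s" using lrank_scaled_le[of as vs p "{..<d}"] by (auto simp: R_def rank_lists_def s_def)
      have "card B * p ^ (u * u + d * Suc s) = card (R t) * p ^ (t * t + d * s) * p ^ (2 * d + 2 * t + 1)"
      proof -
        have "card B = card (R t) * p ^ d" using t by (simp add: B_def card_cartesian_product card_vecs)
        moreover have "d + (u * u + d * Suc s) = t * t + d * s + (2 * d + 2 * t + 1)" by (simp add: t)
        ultimately show ?thesis by (simp only: mult.assoc flip: power_add)
      qed
      also have "\<dots> \<le> 2 ^ m * p ^ (d * m + t * (d + s)) * p ^ (2 * d + 2 * t + 1)"
        unfolding s_def m_def R_def by (intro mult_right_mono Cons.IH) simp
      also have "\<dots> = 2 ^ m * p ^ (d * m + t * (d + s) + (2 * d + 2 * t + 1))"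
        by (simp add: power_add)
      also have "\<dots> \<le> 2 ^ m * p ^ (d * Suc m + u * (d + Suc s))"
        using ts p1 by (intro mult_left_mono power_increasing) (auto simp: t algebra_simps)
      finally show ?thesis .
    qed
    have "card (rank_lists p d (a # as) u) * p ^ (u * u + d * Suc s)
       \<le> (card A + card B) * p ^ (u * u + d * Suc s)" using 1 by (rule mult_right_mono) simp
    also have "\<dots> \<le> 2 ^ Suc m * p ^ (d * Suc m + u * (d + Suc s))"
      using 2 3 by (simp add: algebra_simps)
    finally show ?thesis using False by (simp add: s_def m_def nonzero_count_def)
  qed
qed

section \<open>The number of lists satisfying a given relation\<close>

definition comb :: "int list \<Rightarrow> ((nat \<Rightarrow> int) \<times> (nat \<Rightarrow> int)) list \<Rightarrow> nat \<times> nat \<Rightarrow> int" where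
  "comb as ps ij = sum_list (map2 (\<lambda>a (v, w). a * wdg v w ij) as ps)"

definition pair_lists :: "nat \<Rightarrow> nat \<Rightarrow> nat \<Rightarrow> ((nat \<Rightarrow> int) \<times> (nat \<Rightarrow> int)) list set" where
  "pair_lists p d m = {ps. length ps = m \<and> set ps \<subseteq> vecs p {..<d} \<times> vecs p {..<d}}"

definition relations :: "nat \<Rightarrow> nat \<Rightarrow> int list \<Rightarrow> ((nat \<Rightarrow> int) \<times> (nat \<Rightarrow> int)) list set" where
  "relations p d as = {ps \<in> pair_lists p d (length as). \<forall>ij\<in>pairs d. int p dvd comb as ps ij}"

lemma finite_pair_lists [simp]: "finite (pair_lists p d m)"
proof -
  have "finite {ps. set ps \<subseteq> vecs p {..<d} \<times> vecs p {..<d} \<and> length ps = m}"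
    by (rule finite_lists_length_eq) auto
  then show ?thesis by (simp add: pair_lists_def conj_commute)
qed

lemma card_pair_lists: "card (pair_lists p d m) = p ^ (2 * d * m)"
proof -
  have "card {ps. set ps \<subseteq> vecs p {..<d} \<times> vecs p {..<d} \<and> length ps = m} = (p ^ d * p ^ d) ^ m"
    by (subst card_lists_length_eq) (auto simp: card_cartesian_product card_vecs)
  then show ?thesis
    by (simp add: pair_lists_def conj_commute power_add[symmetric] power_mult[symmetric] mult_2)
qed

text \<open>The coefficient is absorbed into the first vector of each wedge, so that the second
  vectors of a relation become partners of a scaled list.\<close>

lemma comb_eq_wsum: "length as = length ps \<Longrightarrow> comb as ps ij = wsum (scaled as (map fst ps)) (map snd ps) ij"
  by (induction as ps rule: list_induct2)
    (auto simp: comb_def wdg_def algebra_simps split: prod.splits)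

lemma twice_choose_two: "2 * (n choose 2) = n * (n - 1)"
proof -
  have "even (n * (n - 1))" by (cases n) auto
  then show ?thesis by (simp add: choose_two)
qed

text \<open>The exponents of \<open>p\<close> in the bounds for vector lists of rank \<open>u\<close> and for their partners: corank at least
  two is negligible. Corank at most one gives the main term.\<close>
lemma exponent_bound:
  fixes u d s :: nat
  assumes "u + 2 \<le> d" "s \<ge> 3"
  shows "(Suc u choose 2) + u * (d + s) + (2 * d + s) \<le> 4 + (d * u + (u * u + d * s))"
proof -
  obtain k where d: "d = u + 2 + k" using assms(1) le_Suc_ex by blast
  have "5 * u \<le> u * u + 6"
  proof (cases "u \<ge> 5")
    case True
    then show ?thesis by (simp add: trans_le_add1)
  next
    case False
    then have "u = 0 \<or> u = 1 \<or> u = 2 \<or> u = 3 \<or> u = 4" by auto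
    then show ?thesis by auto
  qed
  moreover have "k * 3 \<le> k * s" using assms(2) by simp
  moreover have "2 * (Suc u choose 2) = u * u + u" by (simp add: twice_choose_two)
  ultimately have "k * 2 + (u * 2 + (Suc u choose 2)) \<le> s + (k * s + u * u)"
    using assms(2) by linarith
  then show ?thesis by (simp add: d algebra_simps)
qed

lemma card_relations_le_sum:
  "card (relations p d as) \<le> (\<Sum>vs | length vs = length as \<and> set vs \<subseteq> vecs p {..<d}.
     card (partners p d (scaled as vs) (\<lambda>_. 0)))"
proof -
  let ?VL = "{vs. length vs = length as \<and> set vs \<subseteq> vecs p {..<d}}"
  have fin: "finite ?VL" using finite_vec_lists[of "length as" p d "\<lambda>_. True"] by simp
  have "card (relations p d as) \<le> card (SIGMA vs:?VL. partners p d (scaled as vs) (\<lambda>_. 0))"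
  proof (rule card_inj_on_le)
    show "inj_on (\<lambda>ps. (map fst ps, map snd ps)) (relations p d as)"
      by (rule inj_onI) (metis prod.inject zip_map_fst_snd)
    show "(\<lambda>ps. (map fst ps, map snd ps)) ` relations p d as \<subseteq> (SIGMA vs:?VL. partners p d (scaled as vs) (\<lambda>_. 0))"
      by (force simp: relations_def pair_lists_def partners_def comb_eq_wsum)
  qed (use fin finite_partners in auto)
  also have "\<dots> = (\<Sum>vs\<in>?VL. card (partners p d (scaled as vs) (\<lambda>_. 0)))"
    by (rule card_SigmaI) (use fin finite_partners in auto)
  finally show ?thesis .
qed

lemma power_frac_le:
  fixes x :: real
  assumes "x > 0" "x ^ (a + e) \<le> x ^ (c + b)"
  shows "x ^ a / x ^ b \<le> x ^ c / x ^ e"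
  using assms by (simp add: power_add field_simps)

text \<open>The lists of first vectors are sorted by the rank \<open>u\<close> of their scaled
  versions. For \<open>u = d\<close> and \<open>u = d - 1\<close> the bound on the number of
  partners is the same, and with all \<open>p ^ (d * m)\<close> lists it gives the first summand.
  Each of the fewer than \<open>d\<close> smaller ranks is bounded by \<open>card_rank_lists\<close>
  and \<open>exponent_bound\<close>; the latter is where three nonzero coefficients are
  used.\<close>

lemma card_relations:
  assumes p: "prime p" and s: "nonzero_count p as \<ge> 3"
  defines "m \<equiv> length as"
  shows "real (card (relations p d as)) \<le> real p ^ (2 * d * m) / real p ^ (d choose 2)
     + real d * 2 ^ m * real p ^ (2 * d * m + 4) / real p ^ (2 * d + nonzero_count p as)"
proof -
  let ?VL = "{vs. length vs = m \<and> set vs \<subseteq> vecs p {..<d}}"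
  define s where "s = nonzero_count p as"
  have p0: "real p > 0" "real p \<ge> 1" using p prime_gt_0_nat[OF p] by auto
  have fin: "finite ?VL" using finite_vec_lists[of m p d "\<lambda>_. True"] by simp
  have cVL: "card ?VL = p ^ (d * m)"
    using card_lists_length_eq[of "vecs p {..<d}" m] by (simp add: conj_commute card_vecs power_mult)
  \<comment> \<open>The bound of \<open>card_partners\<close> for rank \<open>u\<close>, solved for
    the number of partners.\<close>
  define h where "h u = real p ^ (d * m) * real p ^ (Suc u choose 2) / real p ^ (d * u)" for u
  have part: "real (card (partners p d (scaled as vs) (\<lambda>_. 0))) \<le> h (lrank p {..<d} (scaled as vs))"
    if "vs \<in> ?VL" for vs
  proof -
    have "card (partners p d (scaled as vs) (\<lambda>_. 0)) * p ^ (d * lrank p {..<d} (scaled as vs))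
      \<le> p ^ (d * length (scaled as vs)) * p ^ (Suc (lrank p {..<d} (scaled as vs)) choose 2)"
      by (rule card_partners[OF p]) (simp add: alternating_def)
    also have "length (scaled as vs) = m" using that by (simp add: m_def)
    finally have "real (card (partners p d (scaled as vs) (\<lambda>_. 0)) * p ^ (d * lrank p {..<d} (scaled as vs)))
      \<le> real (p ^ (d * m) * p ^ (Suc (lrank p {..<d} (scaled as vs)) choose 2))"
      by (rule of_nat_mono)
    then show ?thesis using p0 unfolding h_def by (simp add: field_simps)
  qed
  have h_top: "h u = real p ^ (d * m) / real p ^ (d choose 2)" if "u \<le> d" "\<not> u + 2 \<le> d" for u
  proof -
    have "(Suc u choose 2) + (d choose 2) = d * u"
    proof (cases "u = d")
      case True
      have "2 * (Suc d choose 2) = d * d + d" "2 * (d choose 2) = d * (d - 1)"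
        by (simp_all add: twice_choose_two)
      then show ?thesis using True by (cases d) (auto simp: algebra_simps)
    next
      case False
      then have "d = Suc u" using that by auto
      moreover have "2 * (Suc u choose 2) = u * u + u" by (simp add: twice_choose_two)
      ultimately show ?thesis by (simp add: algebra_simps)
    qed
    then have "real p ^ (Suc u choose 2) * real p ^ (d choose 2) = real p ^ (d * u)"
      by (simp flip: power_add)
    then show ?thesis using p0 by (simp add: h_def field_simps)
  qed
  have "real (card (relations p d as)) \<le> (\<Sum>vs\<in>?VL. real (card (partners p d (scaled as vs) (\<lambda>_. 0))))"
    using card_relations_le_sum[of p d as] unfolding m_def by (simp flip: of_nat_sum)
  also have "\<dots> \<le> (\<Sum>vs\<in>?VL. real p ^ (d * m) / real p ^ (d choose 2) +
      (\<Sum>u<d - 1. if vs \<in> rank_lists p d as u then h u else 0))"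
  proof (rule sum_mono)
    fix vs assume vs: "vs \<in> ?VL"
    define u where "u = lrank p {..<d} (scaled as vs)"
    have ud: "u \<le> d" unfolding u_def using lrank_le_card[OF p, of "{..<d}"] by simp
    have hn: "h v \<ge> 0" for v by (simp add: h_def)
    have sn: "(\<Sum>u<d - 1. if vs \<in> rank_lists p d as u then h u else 0) \<ge> 0"
      by (rule sum_nonneg) (simp add: hn)
    show "real (card (partners p d (scaled as vs) (\<lambda>_. 0))) \<le> real p ^ (d * m) / real p ^ (d choose 2) +
      (\<Sum>u<d - 1. if vs \<in> rank_lists p d as u then h u else 0)"
    proof (cases "u + 2 \<le> d")
      case True
      have "h u = (if vs \<in> rank_lists p d as u then h u else 0)"
        using vs by (simp add: rank_lists_def u_def m_def)
      also have "\<dots> \<le> (\<Sum>u<d - 1. if vs \<in> rank_lists p d as u then h u else 0)"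
        using True by (intro member_le_sum) (auto simp: hn)
      finally have "h u \<le> (\<Sum>u<d - 1. if vs \<in> rank_lists p d as u then h u else 0)" .
      then show ?thesis using part[OF vs] by (simp add: u_def add_increasing)
    next
      case False
      then show ?thesis using part[OF vs] h_top[OF ud] sn by (simp add: u_def)
    qed
  qed
  also have "\<dots> = real p ^ (2 * d * m) / real p ^ (d choose 2) +
      (\<Sum>u<d - 1. \<Sum>vs\<in>?VL. if vs \<in> rank_lists p d as u then h u else 0)"
  proof -
    have "2 * d * m = d * m + d * m" by simp
    then show ?thesis by (simp only: sum.distrib sum_constant cVL sum.swap[of _ ?VL] power_add of_nat_power times_divide_eq_right)
  qed
  also have "(\<Sum>u<d - 1. \<Sum>vs\<in>?VL. if vs \<in> rank_lists p d as u then h u else 0)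
      \<le> (\<Sum>u<d - 1. 2 ^ m * real p ^ (2 * d * m + 4) / real p ^ (2 * d + s))"
  proof (rule sum_mono)
    fix u assume "u \<in> {..<d - 1}"
    then have u: "u + 2 \<le> d" by auto
    have "?VL \<inter> rank_lists p d as u = rank_lists p d as u" by (auto simp: rank_lists_def m_def)
    then have "(\<Sum>vs\<in>?VL. if vs \<in> rank_lists p d as u then h u else 0) = real (card (rank_lists p d as u)) * h u"
      using fin by (simp add: sum.If_cases)
    also have "\<dots> \<le> 2 ^ m * real p ^ (2 * d * m + 4) / real p ^ (2 * d + s)"
    proof -
      have "real (card (rank_lists p d as u) * p ^ (u * u + d * s)) \<le> real (2 ^ m * p ^ (d * m + u * (d + s)))"
        unfolding m_def s_def by (intro of_nat_mono card_rank_lists[OF p])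
      then have "real (card (rank_lists p d as u)) \<le> 2 ^ m * real p ^ (d * m + u * (d + s)) / real p ^ (u * u + d * s)"
        using p0 by (simp add: field_simps)
      then have "real (card (rank_lists p d as u)) * h u
          \<le> 2 ^ m * real p ^ (d * m + u * (d + s)) / real p ^ (u * u + d * s) * h u"
        by (rule mult_right_mono) (simp add: h_def)
      also have "\<dots> = 2 ^ m * (real p ^ (d * m + u * (d + s) + d * m + (Suc u choose 2)) / real p ^ (d * u + (u * u + d * s)))"
        by (simp add: h_def power_add ac_simps)
      also have "real p ^ (d * m + u * (d + s) + d * m + (Suc u choose 2)) / real p ^ (d * u + (u * u + d * s))
          \<le> real p ^ (2 * d * m + 4) / real p ^ (2 * d + s)"
      proof -
        have "real p ^ (d * m + u * (d + s) + d * m + (Suc u choose 2) + (2 * d + s))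
           \<le> real p ^ (2 * d * m + 4 + (d * u + (u * u + d * s)))"
          using exponent_bound[OF u, of s] assms(2) p0 by (intro power_increasing) (auto simp: s_def)
        then show ?thesis by (rule power_frac_le[OF p0(1)])
      qed
      finally show ?thesis by simp
    qed
    finally show "(\<Sum>vs\<in>?VL. if vs \<in> rank_lists p d as u then h u else 0)
      \<le> 2 ^ m * real p ^ (2 * d * m + 4) / real p ^ (2 * d + s)" .
  qed
  also have "\<dots> \<le> real d * 2 ^ m * real p ^ (2 * d * m + 4) / real p ^ (2 * d + s)"
    by (simp add: divide_right_mono mult_right_mono)
  finally show ?thesis by (simp add: s_def)
qed

section \<open>Wedges in the span of given wedges\<close>

text \<open>The function on the right is convex and the left-hand side is its tangent at
  \<open>y = 1\<close>. The proof is Bernoulli's inequality at \<open>1 / y - 1\<close>.\<close>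

lemma reciprocal_power_ge_tangent:
  fixes y :: real
  assumes "y > 0"
  shows "1 - real r * (y - 1) \<le> (1 / y) ^ r"
proof -
  have "1 - y \<le> 1 / y - 1"
  proof -
    have "0 \<le> (1 - y)\<^sup>2 / y" using assms by simp
    also have "(1 - y)\<^sup>2 / y = 1 / y - 1 - (1 - y)"
      using assms by (simp add: field_simps power2_eq_square)
    finally show ?thesis by simp
  qed
  then have "real r * (1 - y) \<le> real r * (1 / y - 1)" by (rule mult_left_mono) simp
  then have "1 - real r * (y - 1) \<le> 1 + real r * (1 / y - 1)" by (simp add: algebra_simps)
  also have "\<dots> \<le> (1 + (1 / y - 1)) ^ r"
    using assms by (intro Bernoulli_inequality) simp
  finally show ?thesis by simp
qed

text \<open>Jensen's inequality for \<open>1 / x ^ r\<close>, multiplied out. Summing the tangent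
  bound at \<open>x s / \<mu>\<close>, with \<mu> the mean, makes the linear terms cancel.\<close>

lemma power_mean_reciprocal:
  fixes x :: "'a \<Rightarrow> real"
  assumes S: "finite S" "S \<noteq> {}" and pos: "\<And>s. s \<in> S \<Longrightarrow> x s > 0"
  shows "real (card S) ^ Suc r \<le> (\<Sum>s\<in>S. 1 / x s ^ r) * (\<Sum>s\<in>S. x s) ^ r"
proof -
  define N where "N = real (card S)"
  define \<mu> where "\<mu> = (\<Sum>s\<in>S. x s) / N"
  have N: "N > 0" using S by (simp add: N_def card_gt_0_iff)
  have sp: "(\<Sum>s\<in>S. x s) > 0" using S pos by (intro sum_pos) auto
  have \<mu>: "\<mu> > 0" using N sp by (simp add: \<mu>_def)
  have "N = (\<Sum>s\<in>S. 1 - real r * (x s / \<mu> - 1))"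
  proof -
    have "(\<Sum>s\<in>S. x s / \<mu>) = (\<Sum>s\<in>S. x s) / \<mu>" by (rule sum_divide_distrib[symmetric])
    also have "\<dots> = N" using N sp by (simp add: \<mu>_def)
    finally have "(\<Sum>s\<in>S. x s / \<mu>) = N" .
    then show ?thesis by (simp add: sum_subtractf N_def flip: sum_distrib_left)
  qed
  also have "\<dots> \<le> (\<Sum>s\<in>S. (1 / (x s / \<mu>)) ^ r)"
    using pos \<mu> by (intro sum_mono reciprocal_power_ge_tangent) auto
  also have "\<dots> = \<mu> ^ r * (\<Sum>s\<in>S. 1 / x s ^ r)"
    by (simp add: power_divide sum_distrib_left)
  finally have "N \<le> \<mu> ^ r * (\<Sum>s\<in>S. 1 / x s ^ r)" .
  then have "N ^ Suc r \<le> N ^ r * (\<mu> ^ r * (\<Sum>s\<in>S. 1 / x s ^ r))"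
    using N by (simp add: mult.commute)
  also have "\<dots> = (\<Sum>s\<in>S. 1 / x s ^ r) * (N * \<mu>) ^ r" by (simp add: power_mult_distrib)
  also have "N * \<mu> = (\<Sum>s\<in>S. x s)" using N by (simp add: \<mu>_def)
  finally show ?thesis by (simp add: N_def)
qed

section \<open>From lists of pairs to the subspaces they span\<close>

abbreviation wedges :: "((nat \<Rightarrow> int) \<times> (nat \<Rightarrow> int)) list \<Rightarrow> (nat \<times> nat \<Rightarrow> int) list" where
  "wedges ps \<equiv> map (\<lambda>(v, w). wdg v w) ps"

definition wedge_span :: "nat \<Rightarrow> nat \<Rightarrow> ((nat \<Rightarrow> int) \<times> (nat \<Rightarrow> int)) list \<Rightarrow> (nat \<times> nat \<Rightarrow> int) set" where
  "wedge_span p d ps = span_set p (pairs d) (wedges ps)"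

text \<open>Its cardinality is the quantity \<open>X(L)\<close> of the outline. Pairs with zero
  wedge would belong to every \<open>L\<close>, and an independent list never contains one.\<close>

definition hits :: "nat \<Rightarrow> nat \<Rightarrow> (nat \<times> nat \<Rightarrow> int) set \<Rightarrow> ((nat \<Rightarrow> int) \<times> (nat \<Rightarrow> int)) set" where
  "hits p d L = {(v, w) \<in> vecs p {..<d} \<times> vecs p {..<d}.
     reduce p (pairs d) (wdg v w) \<in> L \<and> (\<exists>ij\<in>pairs d. \<not> int p dvd wdg v w ij)}"

abbreviation wedge_indep :: "nat \<Rightarrow> nat \<Rightarrow> ((nat \<Rightarrow> int) \<times> (nat \<Rightarrow> int)) list \<Rightarrow> bool" where
  "wedge_indep p d ps \<equiv> lrank p (pairs d) (wedges ps) = length ps"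

lemma finite_hits: "finite (hits p d L)"
  by (rule finite_subset[of _ "vecs p {..<d} \<times> vecs p {..<d}"]) (auto simp: hits_def)

lemma in_span_all_dvd: "(\<And>i. i \<in> I \<Longrightarrow> int p dvd x i) \<Longrightarrow> in_span p I vs x"
  by (rule in_span_cong[OF in_span_zero]) (auto simp: cong_iff_dvd_diff)

lemma lrank_full_nonzero:
  assumes "lrank p I vs = length vs" "v \<in> set vs"
  shows "\<exists>i\<in>I. \<not> int p dvd v i"
  using assms
proof (induction vs)
  case (Cons u vs)
  have "lrank p I vs = length vs" "\<not> in_span p I vs u"
    using Cons.prems(1) lrank_le_length[of p I vs] by (auto split: if_splits)
  then show ?case using Cons in_span_all_dvd[of I p u vs] by auto
qed simp

lemma wedge_indep_hits:
  assumes p: "p > 0" and ps: "ps \<in> pair_lists p d r" "wedge_indep p d ps"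
  shows "set ps \<subseteq> hits p d (wedge_span p d ps)"
proof
  fix x assume x: "x \<in> set ps"
  obtain v w where [simp]: "x = (v, w)" by (cases x)
  have m: "wdg v w \<in> set (wedges ps)" using x by force
  have "\<exists>ij\<in>pairs d. \<not> int p dvd wdg v w ij" using lrank_full_nonzero[OF _ m] ps(2) by simp
  moreover have "in_span p (pairs d) (wedges ps) (wdg v w)" by (rule in_span_mem[OF m])
  ultimately show "x \<in> hits p d (wedge_span p d ps)"
    using ps(1) x p by (auto simp: hits_def wedge_span_def span_set_def pair_lists_def)
qed

text \<open>In the sum of \<open>1 / X(L) ^ r\<close> over \<open>S\<close>, each subspace
  \<open>L\<close> contributes at most 1: all entries of a list spanning \<open>L\<close> are hits
  of \<open>L\<close>, so at most \<open>X(L) ^ r\<close> lists do so. Hence the sum is at most the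
  number of subspaces, and \<open>power_mean_reciprocal\<close> bounds it from below.\<close>

lemma card_wedge_spans:
  assumes p: "p > 0" and r: "r \<ge> 1" and S: "S \<subseteq> pair_lists p d r" "S \<noteq> {}"
    and indep: "\<And>ps. ps \<in> S \<Longrightarrow> wedge_indep p d ps"
  shows "real (card S) ^ Suc r \<le> real (card (wedge_span p d ` S)) *
     (\<Sum>ps\<in>S. real (card (hits p d (wedge_span p d ps)))) ^ r"
proof -
  let ?X = "\<lambda>L. real (card (hits p d L))"
  have fin: "finite S" by (rule finite_subset[OF S(1) finite_pair_lists])
  have pos: "?X (wedge_span p d ps) > 0" if "ps \<in> S" for ps
  proof -
    have "ps \<in> pair_lists p d r" using that S by blast
    then have "set ps \<noteq> {}" using r by (auto simp: pair_lists_def)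
    then show ?thesis
      using wedge_indep_hits[OF p \<open>ps \<in> pair_lists p d r\<close> indep[OF that]] finite_hits[of p d "wedge_span p d ps"]
      by (auto simp: card_gt_0_iff)
  qed
  have "(\<Sum>ps\<in>S. 1 / ?X (wedge_span p d ps) ^ r)
      = (\<Sum>L\<in>wedge_span p d ` S. \<Sum>ps\<in>{ps\<in>S. wedge_span p d ps = L}. 1 / ?X (wedge_span p d ps) ^ r)"
    by (rule sum.image_gen[OF fin])
  also have "\<dots> \<le> (\<Sum>L\<in>wedge_span p d ` S. 1)"
  proof (rule sum_mono)
    fix L assume L: "L \<in> wedge_span p d ` S"
    let ?F = "{ps\<in>S. wedge_span p d ps = L}"
    have "?F \<subseteq> {ps. set ps \<subseteq> hits p d L \<and> length ps = r}"
      using S(1) wedge_indep_hits[OF p _ indep] by (fastforce simp: pair_lists_def)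
    then have "card ?F \<le> card {ps. set ps \<subseteq> hits p d L \<and> length ps = r}"
      by (rule card_mono[OF finite_lists_length_eq[OF finite_hits]])
    also have "\<dots> = card (hits p d L) ^ r" by (rule card_lists_length_eq[OF finite_hits])
    finally have "real (card ?F) \<le> real (card (hits p d L) ^ r)" by (rule of_nat_mono)
    then have c: "real (card ?F) \<le> ?X L ^ r" by (simp only: of_nat_power)
    have X0: "?X L ^ r > 0" using L pos by (intro zero_less_power) blast
    have "(\<Sum>ps\<in>?F. 1 / ?X (wedge_span p d ps) ^ r) = real (card ?F) / ?X L ^ r" by simp
    also have "\<dots> \<le> 1" using c X0 by (simp only: divide_le_eq_1) blast
    finally show "(\<Sum>ps\<in>?F. 1 / ?X (wedge_span p d ps) ^ r) \<le> 1" .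
  qed
  finally have "(\<Sum>ps\<in>S. 1 / ?X (wedge_span p d ps) ^ r) \<le> real (card (wedge_span p d ` S))" by simp
  then have "(\<Sum>ps\<in>S. 1 / ?X (wedge_span p d ps) ^ r) * (\<Sum>ps\<in>S. ?X (wedge_span p d ps)) ^ r
     \<le> real (card (wedge_span p d ` S)) * (\<Sum>ps\<in>S. ?X (wedge_span p d ps)) ^ r"
    by (intro mult_right_mono zero_le_power sum_nonneg) auto
  with power_mean_reciprocal[where x = "\<lambda>ps. ?X (wedge_span p d ps)" and r = r, OF fin S(2) pos] show ?thesis by linarith
qed

text \<open>A nonzero decomposable bivector determines its plane. Fixing one solution
  \<open>(v0, w0)\<close>, the vector \<open>v\<close> of any other lies in the span of these two,
  which leaves at most \<open>p ^ 2\<close> choices, and \<open>w\<close> is then fixed up to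
  multiples of \<open>v\<close>.\<close>

lemma card_wedge_fibre:
  assumes p: "prime p" and y: "\<exists>ij\<in>pairs d. \<not> int p dvd y ij"
  shows "card {(v, w) \<in> vecs p {..<d} \<times> vecs p {..<d}. \<forall>ij\<in>pairs d. [wdg v w ij = y ij] (mod int p)} \<le> p ^ 3"
    (is "card ?A \<le> _")
proof (cases "?A = {}")
  case False
  then obtain v0 w0 where vw0: "v0 \<in> vecs p {..<d}" "w0 \<in> vecs p {..<d}"
    "\<forall>ij\<in>pairs d. [wdg v0 w0 ij = y ij] (mod int p)" by auto
  let ?T = "\<lambda>ij. - wdg v0 w0 ij"
  have altT: "alternating ?T" by (simp add: alternating_def wdg_def)
  have nz: "\<exists>ij\<in>pairs d. \<not> int p dvd wdg v w ij"
    if "\<forall>ij\<in>pairs d. [wdg v w ij = y ij] (mod int p)" for v w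
    using y that cong_dvd_iff by blast
  have part: "[w] \<in> partners p d [v] ?T" if "(v, w) \<in> ?A" for v w
  proof -
    have "int p dvd - wdg v0 w0 ij + wdg v w ij" if ij: "ij \<in> pairs d" for ij
    proof -
      have "[wdg v w ij = y ij] (mod int p)" "[wdg v0 w0 ij = y ij] (mod int p)"
        using ij vw0(3) \<open>(v, w) \<in> ?A\<close> by auto
      then have "[wdg v w ij = wdg v0 w0 ij] (mod int p)" by (metis cong_trans cong_sym)
      then show ?thesis by (simp add: cong_iff_dvd_diff)
    qed
    then show ?thesis using that by (simp add: partners_def)
  qed
  have span: "in_span p {..<d} [v0, w0] v" if vw: "(v, w) \<in> ?A" for v w
  proof (rule ccontr)
    \<comment> \<open>Contraction with a functional that kills \<open>v0\<close> and
      \<open>w0\<close> but not \<open>v\<close> would make \<open>w\<close> a multiple of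
      \<open>v\<close>, so that the wedge would vanish.\<close>
    assume "\<not> in_span p {..<d} [v0, w0] v"
    then obtain f where f0: "\<And>u. u \<in> set [v0, w0] \<Longrightarrow> int p dvd dot {..<d} f u" "[dot {..<d} f v = 1] (mod int p)"
      using separating_functional[OF p finite_lessThan] by blast
    then have f: "int p dvd dot {..<d} f v0" "int p dvd dot {..<d} f w0" "[dot {..<d} f v = 1] (mod int p)" by auto
    have "in_span p {..<d} [v] (\<lambda>j. w j + contract d f ?T j)"
      by (rule partners_Cons_in_span[OF _ f(3) altT part[OF vw]]) simp
    then have "in_span p {..<d} [v] w"
    proof (rule in_span_cong)
      fix j
      have "contract d f ?T j = - contract d f (wdg v0 w0) j" by (simp add: contract_def sum_negf)
      moreover have "int p dvd contract d f (wdg v0 w0) j"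
        unfolding contract_wdg using f(1,2) by (intro dvd_diff) auto
      ultimately show "[w j + contract d f ?T j = w j] (mod int p)" by (simp add: cong_iff_dvd_diff)
    qed
    then obtain a where a: "\<And>j. j < d \<Longrightarrow> int p dvd w j - a * v j" by auto
    have "int p dvd wdg v w ij" if ijd: "ij \<in> pairs d" for ij
    proof -
      obtain i j where ij: "ij = (i, j)" "i < d" "j < d" using ijd by (auto simp: pairs_def)
      have "wdg v w ij = v i * (w j - a * v j) - v j * (w i - a * v i)" by (simp add: ij wdg_def algebra_simps)
      then show ?thesis using a[of i] a[of j] ij by simp
    qed
    then show False using nz[of v w] vw by blast
  qed
  \<comment> \<open>A nonzero wedge forces \<open>v\<close> to be nonzero, so
    \<open>card_partners\<close> applies with rank one.\<close>
  have fib: "card {w. (v, w) \<in> ?A} \<le> p" if v: "\<exists>w. (v, w) \<in> ?A" for v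
  proof -
    obtain w where w: "(v, w) \<in> ?A" using v by blast
    then obtain i j where ij: "(i, j) \<in> pairs d" "\<not> int p dvd wdg v w (i, j)" using nz[of v w] by auto
    have "\<not> (int p dvd v i \<and> int p dvd v j)" using ij(2) by (auto simp: wdg_def)
    then have "\<not> in_span p {..<d} [] v" using ij(1) by (auto simp: pairs_def)
    then have rk: "lrank p {..<d} [v] = 1" by simp
    have "card {w. (v, w) \<in> ?A} \<le> card (partners p d [v] ?T)"
      by (rule card_inj_on_le[of "\<lambda>w. [w]"]) (use part finite_partners in \<open>auto simp: inj_on_def\<close>)
    moreover have "card (partners p d [v] ?T) * p ^ d \<le> p ^ d * p"
      using card_partners[OF p altT, of d "[v]"] unfolding rk by (simp add: numeral_2_eq_2)
    ultimately show ?thesis using prime_gt_0_nat[OF p] by simp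
  qed
  have sub: "?A \<subseteq> (SIGMA v:{v \<in> span_set p {..<d} [v0, w0]. \<exists>w. (v, w) \<in> ?A}. {w. (v, w) \<in> ?A})"
    using span by (auto simp: span_set_def simp del: in_span.simps)
  have finw: "finite {w. (v, w) \<in> ?A}" for v
    by (rule finite_subset[of _ "vecs p {..<d}"]) auto
  have "card ?A \<le> card (SIGMA v:{v \<in> span_set p {..<d} [v0, w0]. \<exists>w. (v, w) \<in> ?A}. {w. (v, w) \<in> ?A})"
    by (rule card_mono[OF _ sub], rule finite_SigmaI) (use finite_span_set finw in auto)
  also have "\<dots> = (\<Sum>v\<in>{v \<in> span_set p {..<d} [v0, w0]. \<exists>w. (v, w) \<in> ?A}. card {w. (v, w) \<in> ?A})"
    by (rule card_SigmaI) (use finite_span_set finw in auto)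
  also have "\<dots> \<le> (\<Sum>v\<in>{v \<in> span_set p {..<d} [v0, w0]. \<exists>w. (v, w) \<in> ?A}. p)"
    by (rule sum_mono, rule fib) blast
  also have "\<dots> \<le> card (span_set p {..<d} [v0, w0]) * p"
    using finite_span_set[of "{..<d}"] by (auto intro!: card_mono)
  also have "\<dots> \<le> p ^ 2 * p"
    unfolding card_span_set[OF p finite_lessThan]
    using lrank_le_length[of p "{..<d}" "[v0, w0]"] prime_gt_0_nat[OF p]
    by (intro mult_right_mono power_increasing) auto
  finally show ?thesis by (simp add: power3_eq_cube power2_eq_square)
next
  case True
  then show ?thesis by (simp only: card.empty)
qed

text \<open>Makes the coefficients explicit and reduces them modulo \<open>p\<close>, so that they
  range over a finite set and can be classified by support.\<close>

lemma in_span_wedges_comb: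
  assumes "in_span p (pairs d) (wedges ps) x" "p > 0"
  shows "\<exists>as. length as = length ps \<and> set as \<subseteq> {0..<int p} \<and> (\<forall>ij\<in>pairs d. int p dvd x ij - comb as ps ij)"
  using assms(1)
proof (induction ps arbitrary: x)
  case Nil
  then show ?case by (simp add: comb_def)
next
  case (Cons q ps)
  obtain v w where q: "q = (v, w)" by (cases q)
  obtain a where "in_span p (pairs d) (wedges ps) (\<lambda>ij. x ij - a * wdg v w ij)" using Cons.prems by (auto simp: q)
  from Cons.IH[OF this] obtain as where as: "length as = length ps" "set as \<subseteq> {0..<int p}"
    "\<And>ij. ij \<in> pairs d \<Longrightarrow> int p dvd x ij - a * wdg v w ij - comb as ps ij" by auto
  have "int p dvd x ij - comb ((a mod int p) # as) (q # ps) ij" if "ij \<in> pairs d" for ij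
  proof -
    have eq: "x ij - comb ((a mod int p) # as) (q # ps) ij
       = (x ij - a * wdg v w ij - comb as ps ij) + (a - a mod int p) * wdg v w ij"
      by (simp add: comb_def q algebra_simps)
    have "int p dvd a - a mod int p" by (rule dvd_minus_mod)
    then show ?thesis unfolding eq using as(3)[OF that] by (intro dvd_add dvd_mult2)
  qed
  then show ?case using as assms(2) by (intro exI[of _ "(a mod int p) # as"]) auto
qed

lemma comb_no_support:
  "length as = length ps \<Longrightarrow> nonzero_count p as = 0 \<Longrightarrow> int p dvd comb as ps ij"
  by (induction as ps rule: list_induct2) (auto simp: comb_def nonzero_count_def split: if_splits)

lemma comb_support_one:
  assumes "length as = length ps" "nonzero_count p as = 1"
  shows "\<exists>(v, w)\<in>set ps. \<exists>a\<in>set as. \<forall>ij. int p dvd comb as ps ij - a * wdg v w ij"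
  using assms
proof (induction as ps rule: list_induct2)
  case (Cons a as q ps)
  obtain v w where q: "q = (v, w)" by (cases q)
  have c: "comb (a # as) (q # ps) ij = a * wdg v w ij + comb as ps ij" for ij by (simp add: comb_def q)
  show ?case
  proof (cases "int p dvd a")
    case True
    then have "nonzero_count p as = 1" using Cons.prems by (simp add: nonzero_count_def)
    from Cons.IH[OF this] obtain v' w' b where b: "(v', w') \<in> set ps" "b \<in> set as"
      "\<And>ij. int p dvd comb as ps ij - b * wdg v' w' ij" by auto
    have "int p dvd comb (a # as) (q # ps) ij - b * wdg v' w' ij" for ij
    proof -
      have eq: "comb (a # as) (q # ps) ij - b * wdg v' w' ij = a * wdg v w ij + (comb as ps ij - b * wdg v' w' ij)"
        by (simp add: c)
      show ?thesis unfolding eq using True b(3) by (intro dvd_add dvd_mult2)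
    qed
    then show ?thesis using b(1,2) by (auto intro!: bexI[of _ "(v', w')"] bexI[of _ b])
  next
    case False
    then have "nonzero_count p as = 0" using Cons.prems by (simp add: nonzero_count_def)
    have "int p dvd comb (a # as) (q # ps) ij - a * wdg v w ij" for ij
      using comb_no_support[OF Cons.hyps \<open>nonzero_count p as = 0\<close>, of ij] by (simp only: c) simp
    then have "\<forall>ij. int p dvd comb (a # as) (q # ps) ij - a * wdg v w ij" by blast
    then show ?thesis by (intro bexI[of _ "(v, w)"]) (auto simp: q)
  qed
qed (simp add: nonzero_count_def)

section \<open>Splitting the hits by the support of their coefficients\<close>

definition coeffs :: "nat \<Rightarrow> nat \<Rightarrow> int list set" where
  "coeffs p r = {as. set as \<subseteq> {0..<int p} \<and> length as = r}"

lemma finite_coeffs [simp]: "finite (coeffs p r)"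
  unfolding coeffs_def by (rule finite_lists_length_eq) simp

lemma card_coeffs: "card (coeffs p r) = p ^ r"
  unfolding coeffs_def by (subst card_lists_length_eq) auto

lemma coeffs_Suc: "coeffs p (Suc r) = (\<lambda>(a, as). a # as) ` ({0..<int p} \<times> coeffs p r)"
  by (auto simp: coeffs_def length_Suc_conv image_iff)

text \<open>The sum is a product over the positions, and each factor is
  \<open>1 + (p - 1) / p\<close>, which is less than 2. This keeps the error terms of
  \<open>card_relations\<close> bounded when they are summed over all coefficient lists.\<close>

lemma sum_coeffs_nonzero_count:
  assumes p: "p > 0"
  shows "(\<Sum>as\<in>coeffs p r. 1 / real p ^ nonzero_count p as) \<le> 2 ^ r"
proof (induction r)
  case 0
  have "coeffs p 0 = {[]}" by (auto simp: coeffs_def)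
  then show ?case by (simp add: nonzero_count_def)
next
  case (Suc r)
  have "(\<Sum>as\<in>coeffs p (Suc r). 1 / real p ^ nonzero_count p as)
     = (\<Sum>(a, as)\<in>{0..<int p} \<times> coeffs p r. 1 / real p ^ nonzero_count p (a # as))"
    unfolding coeffs_Suc by (subst sum.reindex) (auto simp: inj_on_def case_prod_unfold)
  also have "\<dots> = (\<Sum>a\<in>{0..<int p}. \<Sum>as\<in>coeffs p r. (if int p dvd a then 1 else 1 / real p) * (1 / real p ^ nonzero_count p as))"
    by (subst sum.cartesian_product) (auto intro!: sum.cong simp: nonzero_count_def)
  also have "\<dots> = (\<Sum>a\<in>{0..<int p}. if int p dvd a then 1 else 1 / real p) * (\<Sum>as\<in>coeffs p r. 1 / real p ^ nonzero_count p as)"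
    by (simp add: sum_product)
  also have "\<dots> \<le> 2 * 2 ^ r"
  proof (rule mult_mono[OF _ Suc.IH])
    have "(\<Sum>a\<in>{0..<int p}. if int p dvd a then 1 else 1 / real p) \<le> (\<Sum>a\<in>{0..<int p}. (if a = 0 then 1 else 0) + 1 / real p)"
      using p by (intro sum_mono) (auto dest: zdvd_imp_le)
    also have "\<dots> = 2" using p by (simp add: sum.distrib)
    finally show "(\<Sum>a\<in>{0..<int p}. if int p dvd a then 1 else 1 / real p) \<le> 2" .
  qed (auto intro: sum_nonneg)
  finally show ?case by simp
qed

definition support2 :: "nat \<Rightarrow> nat \<Rightarrow> int list set" where
  "support2 p r = {as \<in> coeffs p r. nonzero_count p as \<ge> 2}"

text \<open>The coefficient list \<open>1 # map uminus as\<close> turns \<open>x = \<Sum> a\<^sub>k x\<^sub>k\<close> into a relation.\<close>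
definition hits2 :: "nat \<Rightarrow> nat \<Rightarrow> ((nat \<Rightarrow> int) \<times> (nat \<Rightarrow> int)) list \<Rightarrow> ((nat \<Rightarrow> int) \<times> (nat \<Rightarrow> int)) set" where
  "hits2 p d ps = {x. \<exists>as\<in>support2 p (length ps). x # ps \<in> relations p d (1 # map uminus as)}"

lemma comb_uminus: "length as = length ps \<Longrightarrow> comb (map uminus as) ps ij = - comb as ps ij"
  by (induction as ps rule: list_induct2) (auto simp: comb_def algebra_simps)

text \<open>A hit has coefficients with respect to \<open>ps\<close>. Empty support would give a
  zero wedge. With one nonzero coefficient the wedge is a multiple of some wedge from
  \<open>ps\<close>: there are at most \<open>r\<close> choices of the pair, \<open>p\<close> of the
  scalar and \<open>p ^ 3\<close> for the fibre. The rest is \<open>hits2\<close>.\<close>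

lemma card_hits_le:
  assumes p: "prime p" and ps: "ps \<in> pair_lists p d r"
  shows "card (hits p d (wedge_span p d ps)) \<le> r * p ^ 4 + card (hits2 p d ps)"
proof -
  have p0: "p > 0" using prime_gt_0_nat[OF p] .
  define V where "V = vecs p {..<d}"
  define B where "B v w a = {(v', w') \<in> hits p d (wedge_span p d ps). \<forall>ij\<in>pairs d. [wdg v' w' ij = a * wdg v w ij] (mod int p)}" for v w a
  have fin2: "finite (hits2 p d ps)"
    by (rule finite_subset[of _ "V \<times> V"])
      (auto simp: hits2_def relations_def pair_lists_def V_def)
  have cB: "card (B v w a) \<le> p ^ 3" for v w a
  proof (cases "B v w a = {}")
    case False
    then obtain v' w' where vw: "(v', w') \<in> hits p d (wedge_span p d ps)"
      "\<forall>ij\<in>pairs d. [wdg v' w' ij = a * wdg v w ij] (mod int p)" by (auto simp: B_def)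
    then have "\<exists>ij\<in>pairs d. \<not> int p dvd a * wdg v w ij" unfolding hits_def using cong_dvd_iff by blast
    from card_wedge_fibre[OF p this]
    have "card {(v', w') \<in> V \<times> V. \<forall>ij\<in>pairs d. [wdg v' w' ij = a * wdg v w ij] (mod int p)} \<le> p ^ 3" unfolding V_def .
    moreover have "card (B v w a) \<le> card {(v', w') \<in> V \<times> V. \<forall>ij\<in>pairs d. [wdg v' w' ij = a * wdg v w ij] (mod int p)}"
      by (rule card_mono, rule finite_subset[of _ "V \<times> V"]) (auto simp: V_def B_def hits_def)
    ultimately show ?thesis by linarith
  qed simp
  have sub: "hits p d (wedge_span p d ps) \<subseteq> (\<Union>((v, w), a)\<in>set ps \<times> {0..<int p}. B v w a) \<union> hits2 p d ps"
  proof
    fix x assume x: "x \<in> hits p d (wedge_span p d ps)"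
    obtain v w where xv: "x = (v, w)" by (cases x)
    have vw: "v \<in> V" "w \<in> V" "\<exists>ij\<in>pairs d. \<not> int p dvd wdg v w ij" "in_span p (pairs d) (wedges ps) (wdg v w)"
      using x p0 by (auto simp: hits_def xv wedge_span_def span_set_def V_def)
    obtain as where as: "length as = length ps" "set as \<subseteq> {0..<int p}"
      "\<And>ij. ij \<in> pairs d \<Longrightarrow> int p dvd wdg v w ij - comb as ps ij"
      using in_span_wedges_comb[OF vw(4) p0] by auto
    consider "nonzero_count p as = 0" | "nonzero_count p as = 1" | "nonzero_count p as \<ge> 2" by linarith
    then show "x \<in> (\<Union>((v, w), a)\<in>set ps \<times> {0..<int p}. B v w a) \<union> hits2 p d ps"
    proof cases
      case 1
      have "int p dvd wdg v w ij" if "ij \<in> pairs d" for ij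
        using dvd_add[OF as(3)[OF that] comb_no_support[OF as(1) 1, of ij]] by simp
      then show ?thesis using vw(3) by blast
    next
      case 2
      obtain v' w' a where a: "(v', w') \<in> set ps" "a \<in> set as" "\<And>ij. int p dvd comb as ps ij - a * wdg v' w' ij"
        using comb_support_one[OF as(1) 2] by auto
      have "[wdg v w ij = a * wdg v' w' ij] (mod int p)" if "ij \<in> pairs d" for ij
        using dvd_add[OF as(3)[OF that] a(3)[of ij]] by (simp add: cong_iff_dvd_diff)
      then have "x \<in> B v' w' a" using x by (auto simp: B_def xv)
      then show ?thesis using a(1,2) as(2) by fastforce
    next
      case 3
      have "comb (1 # map uminus as) (x # ps) ij = wdg v w ij - comb as ps ij" for ij
        using comb_uminus[OF as(1)] by (simp add: comb_def[of "_ # _"] xv) (simp add: comb_def)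
      then have "x # ps \<in> relations p d (1 # map uminus as)"
        using vw as ps by (auto simp: relations_def pair_lists_def xv V_def)
      moreover have "as \<in> support2 p (length ps)" using 3 as by (simp add: support2_def coeffs_def)
      ultimately show ?thesis by (auto simp: hits2_def)
    qed
  qed
  have finB: "finite (B v w a)" for v w a
    unfolding B_def by (rule finite_subset[OF _ finite_hits[of p d "wedge_span p d ps"]]) auto
  have "card (hits p d (wedge_span p d ps)) \<le> card ((\<Union>((v, w), a)\<in>set ps \<times> {0..<int p}. B v w a) \<union> hits2 p d ps)"
    by (rule card_mono[OF _ sub]) (use fin2 finB in auto)
  also have "\<dots> \<le> card (\<Union>((v, w), a)\<in>set ps \<times> {0..<int p}. B v w a) + card (hits2 p d ps)"
    by (rule card_Un_le)
  also have "card (\<Union>((v, w), a)\<in>set ps \<times> {0..<int p}. B v w a) \<le> (\<Sum>((v, w), a)\<in>set ps \<times> {0..<int p}. card (B v w a))"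
    using card_UN_le[of "set ps \<times> {0..<int p}" "\<lambda>((v, w), a). B v w a"] by (simp add: case_prod_unfold)
  also have "\<dots> \<le> (\<Sum>((v, w), a)\<in>set ps \<times> {0..<int p}. p ^ 3)"
    by (intro sum_mono) (auto simp: cB)
  also have "\<dots> = card (set ps) * p * p ^ 3" by (simp add: case_prod_unfold card_cartesian_product)
  also have "\<dots> \<le> r * p * p ^ 3"
    using card_length[of ps] ps by (intro mult_right_mono) (auto simp: pair_lists_def)
  finally show ?thesis by (simp add: numeral_eq_Suc)
qed

text \<open>Double counting: for a fixed coefficient list, the lists \<open>ps\<close> together with
  a hit \<open>x\<close> are relations of length \<open>r + 1\<close>. The coefficient 1 of
  \<open>x\<close> raises the support from two to three, as \<open>card_relations\<close>
  requires.\<close>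

lemma sum_hits2:
  assumes p: "prime p"
  shows "(\<Sum>ps\<in>pair_lists p d r. real (card (hits2 p d ps)))
    \<le> real p ^ (2 * d * r) * (real (card (support2 p r)) * real p ^ (2 * d) / real p ^ (d choose 2)
        + real d * 2 ^ (2 * r + 1) * real p ^ 3)"
proof -
  have p0: "p > 0" using prime_gt_0_nat[OF p] .
  define Q where "Q = real p ^ (2 * d * r)"
  have fs: "finite (support2 p r)" by (simp add: support2_def)
  have fr: "finite {x. x # ps \<in> relations p d as}" for ps as
  proof (rule finite_subset[of _ "vecs p {..<d} \<times> vecs p {..<d}"])
    show "{x. x # ps \<in> relations p d as} \<subseteq> vecs p {..<d} \<times> vecs p {..<d}"
      by (auto simp: relations_def pair_lists_def)
  qed simp
  have "(\<Sum>ps\<in>pair_lists p d r. card (hits2 p d ps))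
      \<le> (\<Sum>ps\<in>pair_lists p d r. \<Sum>as\<in>support2 p r. card {x. x # ps \<in> relations p d (1 # map uminus as)})"
  proof (rule sum_mono)
    fix ps assume "ps \<in> pair_lists p d r"
    then have "hits2 p d ps = (\<Union>as\<in>support2 p r. {x. x # ps \<in> relations p d (1 # map uminus as)})"
      by (auto simp: hits2_def pair_lists_def)
    then show "card (hits2 p d ps) \<le> (\<Sum>as\<in>support2 p r. card {x. x # ps \<in> relations p d (1 # map uminus as)})"
      using card_UN_le[OF fs] by simp
  qed
  also have "\<dots> = (\<Sum>as\<in>support2 p r. \<Sum>ps\<in>pair_lists p d r. card {x. x # ps \<in> relations p d (1 # map uminus as)})"
    by (rule sum.swap)
  also have "\<dots> \<le> (\<Sum>as\<in>support2 p r. card (relations p d (1 # map uminus as)))"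
  proof (rule sum_mono)
    fix as :: "int list"
    have "(\<Sum>ps\<in>pair_lists p d r. card {x. x # ps \<in> relations p d (1 # map uminus as)})
       = card (SIGMA ps:pair_lists p d r. {x. x # ps \<in> relations p d (1 # map uminus as)})"
      by (rule card_SigmaI[symmetric]) (use fr in auto)
    also have "\<dots> \<le> card (relations p d (1 # map uminus as))"
      by (rule card_inj_on_le[of "\<lambda>(ps, x). x # ps"]) (auto simp: inj_on_def relations_def)
    finally show "(\<Sum>ps\<in>pair_lists p d r. card {x. x # ps \<in> relations p d (1 # map uminus as)})
       \<le> card (relations p d (1 # map uminus as))" .
  qed
  finally have "(\<Sum>ps\<in>pair_lists p d r. real (card (hits2 p d ps)))
      \<le> (\<Sum>as\<in>support2 p r. real (card (relations p d (1 # map uminus as))))"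
    by (simp flip: of_nat_sum)
  also have "\<dots> \<le> (\<Sum>as\<in>support2 p r. Q * (real p ^ (2 * d) / real p ^ (d choose 2)) +
      Q * (real d * 2 ^ Suc r * real p ^ 3) * (1 / real p ^ nonzero_count p as))"
  proof (rule sum_mono)
    fix as assume "as \<in> support2 p r"
    then have as: "length as = r" "nonzero_count p as \<ge> 2" by (auto simp: support2_def coeffs_def)
    have nz: "nonzero_count p (1 # map uminus as) = Suc (nonzero_count p as)"
      using prime_gt_1_nat[OF p] by (simp add: nonzero_count_def filter_map o_def)
    have "real (card (relations p d (1 # map uminus as))) \<le> real p ^ (2 * d * Suc r) / real p ^ (d choose 2) +
       real d * 2 ^ Suc r * (real p ^ (2 * d * Suc r + 4) / real p ^ (2 * d + Suc (nonzero_count p as)))"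
      using card_relations[OF p, of "1 # map uminus as" d] as unfolding nz times_divide_eq_right by simp
    also have "real p ^ (2 * d * Suc r) = Q * real p ^ (2 * d)"
      by (simp add: Q_def power_add)
    also have "real p ^ (2 * d * Suc r + 4) / real p ^ (2 * d + Suc (nonzero_count p as))
        = Q * real p ^ 3 * (1 / real p ^ nonzero_count p as)"
      using p0 by (simp add: Q_def power_add numeral_eq_Suc field_simps)
    finally show "real (card (relations p d (1 # map uminus as))) \<le> Q * (real p ^ (2 * d) / real p ^ (d choose 2)) +
      Q * (real d * 2 ^ Suc r * real p ^ 3) * (1 / real p ^ nonzero_count p as)"
      by (simp add: mult.assoc mult.left_commute)
  qed
  also have "\<dots> = real (card (support2 p r)) * (Q * (real p ^ (2 * d) / real p ^ (d choose 2))) +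
      Q * (real d * 2 ^ Suc r * real p ^ 3) * (\<Sum>as\<in>support2 p r. 1 / real p ^ nonzero_count p as)"
    by (simp only: sum.distrib sum_constant sum_distrib_left)
  also have "\<dots> \<le> real (card (support2 p r)) * (Q * (real p ^ (2 * d) / real p ^ (d choose 2))) +
      Q * (real d * 2 ^ Suc r * real p ^ 3) * 2 ^ r"
  proof -
    have "(\<Sum>as\<in>support2 p r. 1 / real p ^ nonzero_count p as) \<le> (\<Sum>as\<in>coeffs p r. 1 / real p ^ nonzero_count p as)"
      by (rule sum_mono2) (auto simp: support2_def)
    also have "\<dots> \<le> 2 ^ r" by (rule sum_coeffs_nonzero_count[OF p0])
    finally show ?thesis by (intro add_left_mono mult_left_mono) (auto simp: Q_def)
  qed
  also have "\<dots> = Q * (real (card (support2 p r)) * real p ^ (2 * d) / real p ^ (d choose 2)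
        + real d * 2 ^ (2 * r + 1) * real p ^ 3)"
  proof -
    have "2 * r + 1 = Suc r + r" by simp
    then have "(2::real) ^ (2 * r + 1) = 2 ^ Suc r * 2 ^ r" by (simp only: power_add)
    then show ?thesis by (simp only:) (simp add: algebra_simps)
  qed
  finally show ?thesis by (simp add: Q_def)
qed

section \<open>Independent wedges\<close>

text \<open>Since \<open>f i\<close> is invertible, coordinate \<open>i\<close> of a solution is
  determined by the other coordinates.\<close>

lemma card_hyperplane:
  assumes p: "prime p" and I: "finite I" "i \<in> I" and f: "\<not> int p dvd f i"
  shows "card {x \<in> vecs p I. int p dvd dot I f x} * p \<le> p ^ card I" (is "card ?A * p \<le> _")
proof -
  have "inj_on (\<lambda>x. restrict x (I - {i})) ?A"
  proof (rule inj_onI)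
    fix x y assume x: "x \<in> ?A" and y: "y \<in> ?A" and eq: "restrict x (I - {i}) = restrict y (I - {i})"
    have e: "x j = y j" if "j \<in> I - {i}" for j using fun_cong[OF eq, of j] that by simp
    have "dot I f x - dot I f y = f i * x i - f i * y i"
    proof -
      have "(\<Sum>j\<in>I - {i}. f j * x j) = (\<Sum>j\<in>I - {i}. f j * y j)" by (rule sum.cong) (auto simp: e)
      then show ?thesis using I by (simp add: dot_def sum.remove[OF I])
    qed
    moreover have "int p dvd dot I f x - dot I f y" using x y by (intro dvd_diff) auto
    ultimately have "int p dvd f i * x i - f i * y i" by (simp only:)
    then have "int p dvd f i * (x i - y i)" by (simp only: right_diff_distrib)
    then have "int p dvd x i - y i" using f p by (simp add: prime_dvd_mult_iff)
    then have "[x j = y j] (mod int p)" if "j \<in> I" for j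
      using e[of j] that by (cases "j = i") (auto simp: cong_iff_dvd_diff)
    then show "x = y" using x y by (intro vecs_eqI[of _ p I]) auto
  qed
  then have "card ?A \<le> card (vecs p (I - {i}))"
  proof (rule card_inj_on_le)
    show "(\<lambda>x. restrict x (I - {i})) ` ?A \<subseteq> vecs p (I - {i})" by (force simp: vecs_def PiE_iff)
    show "finite (vecs p (I - {i}))" using I by simp
  qed
  also have "\<dots> = p ^ (card I - 1)" using I by (simp add: card_vecs)
  finally have "card ?A * p \<le> p ^ (card I - 1) * p" by simp
  also have "\<dots> = p ^ card I" using I by (metis card_gt_0_iff empty_iff power_minus_mult)
  finally show ?thesis .
qed

lemma sum_pairs_triangle:
  "(\<Sum>ij\<in>pairs d. g ij) = (\<Sum>i<d. \<Sum>j<d. if i < j then g (i, j) else (0::int))"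
proof -
  have "(\<Sum>i<d. \<Sum>j<d. if i < j then g (i, j) else 0) = (\<Sum>ij\<in>{..<d} \<times> {..<d}. if fst ij < snd ij then g ij else 0)"
    unfolding sum.cartesian_product by (rule sum.cong) auto
  also have "\<dots> = (\<Sum>ij\<in>pairs d. g ij)"
    by (rule sum.mono_neutral_cong_right) (auto simp: pairs_def)
  finally show ?thesis by simp
qed

text \<open>The Gram matrix of the alternating form on \<open>V\<close> that corresponds to the
  functional \<open>f\<close> on the exterior square.\<close>

definition skew :: "(nat \<times> nat \<Rightarrow> int) \<Rightarrow> nat \<Rightarrow> nat \<Rightarrow> int" where
  "skew f i j = (if i < j then f (i, j) else if j < i then - f (j, i) else 0)"

lemma dot_wdg_skew:
  "dot (pairs d) f (wdg v w) = dot {..<d} (\<lambda>j. dot {..<d} (\<lambda>i. skew f i j) v) w"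
proof -
  have "dot (pairs d) f (wdg v w) = (\<Sum>i<d. \<Sum>j<d. if i < j then f (i, j) * (v i * w j) else 0)
      - (\<Sum>i<d. \<Sum>j<d. if i < j then f (i, j) * (v j * w i) else 0)"
    unfolding dot_def sum_pairs_triangle sum_subtractf[symmetric]
    by (intro sum.cong refl) (auto simp: wdg_def algebra_simps)
  also have "(\<Sum>i<d. \<Sum>j<d. if i < j then f (i, j) * (v j * w i) else 0)
     = (\<Sum>i<d. \<Sum>j<d. if j < i then f (j, i) * (v i * w j) else 0)"
    by (rule sum.swap)
  also have "(\<Sum>i<d. \<Sum>j<d. if i < j then f (i, j) * (v i * w j) else 0) - \<dots>
     = (\<Sum>i<d. \<Sum>j<d. skew f i j * v i * w j)"
    unfolding sum_subtractf[symmetric] by (intro sum.cong refl) (auto simp: skew_def)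
  also have "\<dots> = (\<Sum>j<d. \<Sum>i<d. skew f i j * v i * w j)" by (rule sum.swap)
  also have "\<dots> = dot {..<d} (\<lambda>j. dot {..<d} (\<lambda>i. skew f i j) v) w"
    by (simp add: dot_def sum_distrib_right)
  finally show ?thesis .
qed

text \<open>A nonzero alternating form vanishes on few pairs. Let \<open>c v\<close> be the
  functional of \<open>w\<close> given by \<open>v\<close>. Either its coordinate \<open>j0\<close>
  vanishes, which confines \<open>v\<close> to a hyperplane, or \<open>c v\<close> is nonzero and
  confines \<open>w\<close> to one. Each event has proportion at most \<open>1 / p\<close>.\<close>

lemma card_isotropic_pairs:
  assumes p: "prime p" and ij: "ij \<in> pairs d" "\<not> int p dvd f ij"
  shows "card {(v, w) \<in> vecs p {..<d} \<times> vecs p {..<d}. int p dvd dot (pairs d) f (wdg v w)} * p \<le> 2 * p ^ (2 * d)"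
    (is "card ?A * p \<le> _")
proof -
  obtain i0 j0 where ij0: "ij = (i0, j0)" "i0 < j0" "j0 < d" using ij(1) by (auto simp: pairs_def)
  define V where "V = vecs p {..<d}"
  define c where "c v j = dot {..<d} (\<lambda>i. skew f i j) v" for v j
  define Z where "Z = {v \<in> V. int p dvd c v j0}"
  have finV: "finite V" "card V = p ^ d" by (simp_all add: V_def card_vecs)
  have Z: "card Z * p \<le> p ^ d"
    unfolding Z_def c_def V_def
    using card_hyperplane[OF p, of "{..<d}" i0 "\<lambda>i. skew f i j0"] ij ij0 by (simp add: skew_def)
  have sub: "?A \<subseteq> Z \<times> V \<union> (SIGMA v:V - Z. {w \<in> V. int p dvd dot {..<d} (c v) w})"
    by (auto simp: V_def Z_def dot_wdg_skew c_def[abs_def])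
  have fin: "finite (Z \<times> V)" "finite (SIGMA v:V - Z. {w \<in> V. int p dvd dot {..<d} (c v) w})"
    using finV by (auto simp: Z_def)
  have "card ?A \<le> card (Z \<times> V \<union> (SIGMA v:V - Z. {w \<in> V. int p dvd dot {..<d} (c v) w}))"
    by (rule card_mono[OF _ sub]) (use fin in blast)
  also have "\<dots> \<le> card (Z \<times> V) + card (SIGMA v:V - Z. {w \<in> V. int p dvd dot {..<d} (c v) w})"
    by (rule card_Un_le)
  also have "card (SIGMA v:V - Z. {w \<in> V. int p dvd dot {..<d} (c v) w})
      = (\<Sum>v\<in>V - Z. card {w \<in> V. int p dvd dot {..<d} (c v) w})"
    by (rule card_SigmaI) (use finV in auto)
  finally have "card ?A * p \<le> (card (Z \<times> V) + (\<Sum>v\<in>V - Z. card {w \<in> V. int p dvd dot {..<d} (c v) w})) * p"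
    by (rule mult_right_mono) simp
  also have "\<dots> = (card Z * p) * p ^ d + (\<Sum>v\<in>V - Z. card {w \<in> V. int p dvd dot {..<d} (c v) w} * p)"
    by (simp only: card_cartesian_product finV add_mult_distrib sum_distrib_right mult.assoc mult.commute[of "p ^ d" p])
  also have "\<dots> \<le> p ^ d * p ^ d + (\<Sum>v\<in>V - Z. p ^ d)"
  proof (intro add_mono mult_right_mono Z sum_mono)
    fix v assume "v \<in> V - Z"
    then have "\<not> int p dvd c v j0" by (auto simp: Z_def)
    then show "card {w \<in> V. int p dvd dot {..<d} (c v) w} * p \<le> p ^ d"
      using card_hyperplane[OF p, of "{..<d}" j0 "c v"] ij0 by (simp add: V_def)
  qed simp
  also have "(\<Sum>v\<in>V - Z. p ^ d) \<le> p ^ d * p ^ d"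
    using card_mono[OF finV(1), of "V - Z"] finV by simp
  finally show ?thesis by (simp add: mult_2 power_add)
qed

text \<open>The functional may depend on the list being extended. With annihilators this produces
  independent lists, and with \<open>pluecker\<close> it produces pairs of complementary
  planes.\<close>

lemma card_extend_lists:
  assumes p: "prime p" and T: "T \<subseteq> pair_lists p d m"
    and f: "\<And>ps. ps \<in> T \<Longrightarrow> \<exists>ij\<in>pairs d. \<not> int p dvd f ps ij"
  shows "real (card T) * (real p ^ (2 * d) * (1 - 2 / real p))
    \<le> real (card {(v, w) # ps | v w ps. ps \<in> T \<and> v \<in> vecs p {..<d} \<and> w \<in> vecs p {..<d} \<and>
        \<not> int p dvd dot (pairs d) (f ps) (wdg v w)})" (is "_ \<le> real (card ?S)")
proof -
  define V where "V = vecs p {..<d}"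
  have p0: "p > 0" using prime_gt_0_nat[OF p] .
  have finV: "finite (V \<times> V)" "card (V \<times> V) = p ^ (2 * d)"
    by (simp_all add: V_def card_vecs card_cartesian_product mult_2 power_add)
  have finT: "finite T" by (rule finite_subset[OF T finite_pair_lists])
  define B where "B ps = {(v, w) \<in> V \<times> V. int p dvd dot (pairs d) (f ps) (wdg v w)}" for ps
  have BV: "B ps \<subseteq> V \<times> V" for ps by (auto simp: B_def)
  have S: "?S = (\<lambda>(ps, x). x # ps) ` (SIGMA ps:T. V \<times> V - B ps)"
    by (force simp: V_def B_def image_iff)
  have "card ?S = card (SIGMA ps:T. V \<times> V - B ps)"
    unfolding S by (rule card_image) (auto simp: inj_on_def)
  also have "\<dots> = (\<Sum>ps\<in>T. card (V \<times> V - B ps))"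
    by (rule card_SigmaI) (use finT finV in auto)
  finally have c: "real (card ?S) = (\<Sum>ps\<in>T. real (card (V \<times> V - B ps)))" by simp
  have "real (card T) * (real p ^ (2 * d) * (1 - 2 / real p)) = (\<Sum>ps\<in>T. real p ^ (2 * d) * (1 - 2 / real p))"
    by simp
  also have "\<dots> \<le> (\<Sum>ps\<in>T. real (card (V \<times> V - B ps)))"
  proof (rule sum_mono)
    fix ps assume "ps \<in> T"
    then obtain ij where ij: "ij \<in> pairs d" "\<not> int p dvd f ps ij" using f by blast
    have "card (B ps) * p \<le> 2 * p ^ (2 * d)"
      using card_isotropic_pairs[where f = "f ps", OF p ij] by (simp add: B_def V_def)
    then have "real (card (B ps) * p) \<le> real (2 * p ^ (2 * d))" by (rule of_nat_mono)
    then have "real (card (B ps)) \<le> 2 * real p ^ (2 * d) / real p" using p0 by (simp add: field_simps)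
    moreover have "real (card (V \<times> V - B ps)) = real (card (V \<times> V)) - real (card (B ps))"
      using BV[of ps] finV(1) by (simp add: card_Diff_subset finite_subset of_nat_diff card_mono)
    ultimately show "real p ^ (2 * d) * (1 - 2 / real p) \<le> real (card (V \<times> V - B ps))"
      using finV(2) by (simp add: algebra_simps)
  qed
  finally show ?thesis using c by simp
qed

lemma card_pairs: "card (pairs d) = d choose 2"
proof (induction d)
  case (Suc d)
  have "pairs (Suc d) = pairs d \<union> (\<lambda>i. (i, d)) ` {..<d}" by (auto simp: pairs_def)
  moreover have "pairs d \<inter> (\<lambda>i. (i, d)) ` {..<d} = {}" by (auto simp: pairs_def)
  ultimately have "card (pairs (Suc d)) = card (pairs d) + card ((\<lambda>i. (i, d)) ` {..<d})"
    by (simp add: card_Un_disjoint finite_pairs)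
  also have "card ((\<lambda>i. (i, d)) ` {..<d}) = d" by (subst card_image) (auto simp: inj_on_def)
  finally show ?case using Suc by (simp add: numeral_2_eq_2)
qed (simp add: pairs_def)

text \<open>Fewer vectors than the dimension of \<open>W\<close> leave, by counting, some
  \<open>y\<close> outside their span. A functional separating \<open>y\<close> is nonzero.\<close>

lemma annihilator_exists:
  assumes p: "prime p" and "length vs < d choose 2"
  shows "\<exists>f. (\<forall>v\<in>set vs. int p dvd dot (pairs d) f v) \<and> (\<exists>ij\<in>pairs d. \<not> int p dvd f ij)"
proof -
  have "card (span_set p (pairs d) vs) \<le> p ^ length vs"
    using lrank_le_length[of p "pairs d" vs] prime_gt_0_nat[OF p]
    by (simp add: card_span_set[OF p finite_pairs] power_increasing)
  also have "\<dots> < p ^ (d choose 2)" using assms(2) prime_gt_1_nat[OF p] by simp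
  also have "\<dots> = card (vecs p (pairs d))" by (simp add: card_vecs finite_pairs card_pairs)
  finally have "span_set p (pairs d) vs \<noteq> vecs p (pairs d)" by auto
  then obtain y where y: "\<not> in_span p (pairs d) vs y" by (auto simp: span_set_def)
  obtain f where f: "\<And>v. v \<in> set vs \<Longrightarrow> int p dvd dot (pairs d) f v" "[dot (pairs d) f y = 1] (mod int p)"
    using separating_functional[OF p finite_pairs y] by blast
  have "\<exists>ij\<in>pairs d. \<not> int p dvd f ij"
  proof (rule ccontr)
    assume "\<not> ?thesis"
    then have "int p dvd dot (pairs d) f y" unfolding dot_def by (intro dvd_sum dvd_mult2) auto
    then have "int p dvd 1" using f(2) cong_dvd_iff by blast
    then show False using prime_gt_1_nat[OF p] by simp
  qed
  then show ?thesis using f(1) by blast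
qed

definition indep_lists :: "nat \<Rightarrow> nat \<Rightarrow> nat \<Rightarrow> ((nat \<Rightarrow> int) \<times> (nat \<Rightarrow> int)) list set" where
  "indep_lists p d m = {ps \<in> pair_lists p d m. wedge_indep p d ps}"

lemma indep_lists_ConsI:
  assumes "ps \<in> indep_lists p d m" "v \<in> vecs p {..<d}" "w \<in> vecs p {..<d}"
    "\<And>u. u \<in> set (wedges ps) \<Longrightarrow> int p dvd dot (pairs d) f u" "\<not> int p dvd dot (pairs d) f (wdg v w)"
  shows "(v, w) # ps \<in> indep_lists p d (Suc m)"
proof -
  have "\<not> in_span p (pairs d) (wedges ps) (wdg v w)" using dot_in_span[OF _ assms(4)] assms(5) by blast
  then show ?thesis using assms(1-3) by (auto simp: indep_lists_def pair_lists_def)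
qed

text \<open>For every independent list a nonzero functional is chosen that kills its wedges. Any
  pair on which this functional does not vanish extends the list, and that is all but a proportion
  of \<open>2 / p\<close> of the pairs.\<close>

lemma card_indep_lists:
  assumes p: "prime p" and "m \<le> d choose 2"
  shows "(real p ^ (2 * d) * (1 - 2 / real p)) ^ m \<le> real (card (indep_lists p d m))"
  using assms(2)
proof (induction m)
  case 0
  have "indep_lists p d 0 = {[]}" by (auto simp: indep_lists_def pair_lists_def)
  then show ?case by simp
next
  case (Suc m)
  let ?K = "real p ^ (2 * d) * (1 - 2 / real p)"
  have K: "?K \<ge> 0" using prime_ge_2_nat[OF p] by simp
  define f where "f ps = (SOME f. (\<forall>v\<in>set (wedges ps). int p dvd dot (pairs d) f v) \<and> (\<exists>ij\<in>pairs d. \<not> int p dvd f ij))" for ps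
  have f: "(\<forall>v\<in>set (wedges ps). int p dvd dot (pairs d) (f ps) v) \<and> (\<exists>ij\<in>pairs d. \<not> int p dvd f ps ij)"
    if "ps \<in> indep_lists p d m" for ps
    unfolding f_def using that Suc.prems
    by (intro someI_ex[OF annihilator_exists[OF p]]) (auto simp: indep_lists_def pair_lists_def)
  let ?S = "{(v, w) # ps | v w ps. ps \<in> indep_lists p d m \<and> v \<in> vecs p {..<d} \<and> w \<in> vecs p {..<d} \<and>
        \<not> int p dvd dot (pairs d) (f ps) (wdg v w)}"
  have "?K ^ Suc m \<le> real (card (indep_lists p d m)) * ?K"
    unfolding power_Suc2 using Suc K by (intro mult_right_mono) auto
  also have "\<dots> \<le> real (card ?S)"
    by (rule card_extend_lists[OF p]) (use f in \<open>auto simp: indep_lists_def\<close>)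
  also have "card ?S \<le> card (indep_lists p d (Suc m))"
  proof (rule card_mono)
    show "finite (indep_lists p d (Suc m))" by (simp add: indep_lists_def)
    show "?S \<subseteq> indep_lists p d (Suc m)"
    proof clarify
      fix v w ps
      assume *: "ps \<in> indep_lists p d m" "v \<in> vecs p {..<d}" "w \<in> vecs p {..<d}"
        "\<not> int p dvd dot (pairs d) (f ps) (wdg v w)"
      show "(v, w) # ps \<in> indep_lists p d (Suc m)"
        by (rule indep_lists_ConsI[OF *(1-3) _ *(4)]) (use f[OF *(1)] in blast)
    qed
  qed
  finally show ?case by simp
qed

section \<open>The Klein quadric for dimension four\<close>

definition pluecker :: "(nat \<times> nat \<Rightarrow> int) \<Rightarrow> nat \<times> nat \<Rightarrow> int" where
  "pluecker x ij = (if ij = (0, 1) then x (2, 3) else if ij = (0, 2) then - x (1, 3)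
     else if ij = (0, 3) then x (1, 2) else if ij = (1, 2) then x (0, 3)
     else if ij = (1, 3) then - x (0, 2) else x (0, 1))"

lemma pairs_4: "pairs 4 = {(0, 1), (0, 2), (0, 3), (1, 2), (1, 3), (2, 3)}"
  by (auto simp: pairs_def numeral_eq_Suc less_Suc_eq)

text \<open>The right-hand side is the coefficient of
  \<open>e\<^sub>0 \<and> e\<^sub>1 \<and> e\<^sub>2 \<and> e\<^sub>3\<close> in
  \<open>x \<and> y\<close>.\<close>

lemma dot_pluecker:
  "dot (pairs 4) (pluecker x) y = x (2, 3) * y (0, 1) - x (1, 3) * y (0, 2) + x (1, 2) * y (0, 3)
     + x (0, 3) * y (1, 2) - x (0, 2) * y (1, 3) + x (0, 1) * y (2, 3)"
  by (simp add: dot_def pairs_4 pluecker_def)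

text \<open>The Pluecker relation: the fourfold product \<open>v \<and> w \<and> v \<and> w\<close>
  vanishes.\<close>

lemma pluecker_wdg: "dot (pairs 4) (pluecker (wdg v w)) (wdg v w) = 0"
  by (simp add: dot_pluecker wdg_def algebra_simps)

text \<open>For \<open>d = 4\<close> decomposability is the vanishing of a quadratic form, and \<open>pluecker x\<close> represents pairing
  with \<open>x\<close> in its polar form. If two points of this quadric have nonzero pairing, the line through them contains no third
  point of it.\<close>
definition skew_planes :: "nat \<Rightarrow> ((nat \<Rightarrow> int) \<times> (nat \<Rightarrow> int)) list set" where
  "skew_planes p = {(v, w) # ps | v w ps. ps \<in> indep_lists p 4 1 \<and> v \<in> vecs p {..<4} \<and> w \<in> vecs p {..<4} \<and>
        \<not> int p dvd dot (pairs 4) (pluecker (hd (wedges ps))) (wdg v w)}"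

lemma indep_lists_oneE:
  assumes "ps \<in> indep_lists p d 1"
  obtains v w where "ps = [(v, w)]" "\<exists>ij\<in>pairs d. \<not> int p dvd wdg v w ij"
proof -
  obtain v w where vw: "ps = [(v, w)]"
    using assms by (auto simp: indep_lists_def pair_lists_def length_Suc_conv)
  have "\<exists>ij\<in>pairs d. \<not> int p dvd wdg v w ij"
    using lrank_full_nonzero[of p "pairs d" "wedges ps" "wdg v w"] assms vw
    by (simp add: indep_lists_def)
  with vw show ?thesis by (rule that)
qed

text \<open>Pairing with the wedge at the tail is a functional that kills this wedge by the Pluecker
  relation but not the wedge at the head, so the two are independent.\<close>

lemma skew_planes_subset: "skew_planes p \<subseteq> indep_lists p 4 2"
proof
  fix x assume "x \<in> skew_planes p"
  then obtain v w ps where x: "x = (v, w) # ps" "ps \<in> indep_lists p 4 1" "v \<in> vecs p {..<4}" "w \<in> vecs p {..<4}"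
    "\<not> int p dvd dot (pairs 4) (pluecker (hd (wedges ps))) (wdg v w)" by (auto simp: skew_planes_def)
  obtain v' w' where ps: "ps = [(v', w')]" using indep_lists_oneE[OF x(2)] by blast
  have "(v, w) # ps \<in> indep_lists p 4 (Suc 1)"
  proof (rule indep_lists_ConsI[OF x(2-4) _ x(5)])
    fix u assume "u \<in> set (wedges ps)"
    then show "int p dvd dot (pairs 4) (pluecker (hd (wedges ps))) u"
      using pluecker_wdg[of v' w'] by (simp add: ps)
  qed
  then show "x \<in> indep_lists p 4 2" by (simp add: x(1) numeral_2_eq_2)
qed

text \<open>\<open>pluecker\<close> permutes the coordinates up to sign, so it yields a nonzero
  functional for every nonzero wedge and \<open>card_extend_lists\<close> applies.\<close>

lemma card_skew_planes:
  assumes p: "prime p"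
  shows "(real p ^ (2 * 4) * (1 - 2 / real p)) ^ 2 \<le> real (card (skew_planes p))"
proof -
  let ?K = "real p ^ (2 * 4) * (1 - 2 / real p)"
  have K: "?K \<ge> 0" using prime_ge_2_nat[OF p] by simp
  have "?K ^ 1 \<le> real (card (indep_lists p 4 1))" by (rule card_indep_lists[OF p]) (simp add: choose_two)
  then have "?K ^ 2 \<le> real (card (indep_lists p 4 1)) * ?K"
    using K by (simp add: power2_eq_square mult_right_mono)
  also have "\<dots> \<le> real (card (skew_planes p))"
    unfolding skew_planes_def
  proof (rule card_extend_lists[OF p])
    show "indep_lists p 4 1 \<subseteq> pair_lists p 4 1" by (auto simp: indep_lists_def)
    fix ps assume "ps \<in> indep_lists p 4 1"
    then obtain v w where vw: "ps = [(v, w)]" "\<exists>ij\<in>pairs 4. \<not> int p dvd wdg v w ij" by (rule indep_lists_oneE)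
    then show "\<exists>ij\<in>pairs 4. \<not> int p dvd pluecker (hd (wedges ps)) ij"
      by (auto simp: pairs_4 pluecker_def)
  qed
  finally show ?thesis .
qed

text \<open>Suppose a wedge equals \<open>a2 x2 + a1 x1\<close> with both coefficients nonzero. Its
  pairing with itself is zero, and so are those of \<open>x1\<close> and \<open>x2\<close>; what
  remains is twice \<open>a1 a2\<close> times the nonzero pairing of \<open>x1\<close> with
  \<open>x2\<close>, a contradiction for odd \<open>p\<close>.\<close>

lemma hits2_skew_planes:
  assumes p: "prime p" "p > 2" and ps: "ps \<in> skew_planes p"
  shows "hits2 p 4 ps = {}"
proof (rule ccontr)
  assume "hits2 p 4 ps \<noteq> {}"
  then obtain q as where as: "as \<in> support2 p (length ps)" "q # ps \<in> relations p 4 (1 # map uminus as)"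
    by (auto simp: hits2_def)
  obtain v w where q: "q = (v, w)" by (cases q)
  obtain v2 w2 qs where qs: "ps = (v2, w2) # qs" "qs \<in> indep_lists p 4 1"
    "\<not> int p dvd dot (pairs 4) (pluecker (hd (wedges qs))) (wdg v2 w2)"
    using ps by (auto simp: skew_planes_def)
  obtain v1 w1 where "qs = [(v1, w1)]" using indep_lists_oneE[OF qs(2)] by blast
  then have ps': "ps = [(v2, w2), (v1, w1)]" "\<not> int p dvd dot (pairs 4) (pluecker (wdg v1 w1)) (wdg v2 w2)"
    using qs by auto
  obtain a2 a1 where a: "as = [a2, a1]"
    using as(1) ps' by (auto simp: support2_def coeffs_def length_Suc_conv)
  have a0: "\<not> int p dvd a1" "\<not> int p dvd a2"
    using as(1) by (auto simp: support2_def a nonzero_count_def split: if_splits)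
  let ?z = "\<lambda>ij. a2 * wdg v2 w2 ij + a1 * wdg v1 w1 ij"
  have z: "[wdg v w ij = ?z ij] (mod int p)" if "ij \<in> pairs 4" for ij
    using as(2) that by (simp add: relations_def comb_def a ps' q cong_iff_dvd_diff algebra_simps)
  have "[dot (pairs 4) (pluecker (wdg v w)) (wdg v w) = dot (pairs 4) (pluecker ?z) ?z] (mod int p)"
    unfolding dot_pluecker by (intro cong_add cong_diff cong_mult z) (auto simp: pairs_4)
  moreover have "dot (pairs 4) (pluecker ?z) ?z = 2 * (a1 * (a2 * dot (pairs 4) (pluecker (wdg v1 w1)) (wdg v2 w2)))
     + a1 * a1 * dot (pairs 4) (pluecker (wdg v1 w1)) (wdg v1 w1)
     + a2 * a2 * dot (pairs 4) (pluecker (wdg v2 w2)) (wdg v2 w2)"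
    unfolding dot_pluecker by (simp add: algebra_simps)
  ultimately have "int p dvd 2 * (a1 * (a2 * dot (pairs 4) (pluecker (wdg v1 w1)) (wdg v2 w2)))"
    by (simp add: pluecker_wdg cong_iff_dvd_diff)
  moreover have "\<not> int p dvd 2" using p by (auto dest: zdvd_imp_le)
  moreover have "prime (int p)" using p by simp
  ultimately show False using a0 ps'(2) by (simp only: prime_dvd_mult_iff) blast
qed

section \<open>Counting subspaces\<close>

text \<open>Linear subspaces in terms of normal forms, with arbitrary integers as scalars;
  \<open>closed_set_iff_subspace\<close> makes the link with the module
  \<open>Wspace\<close>.\<close>

definition closed_set :: "nat \<Rightarrow> 'i set \<Rightarrow> ('i \<Rightarrow> int) set \<Rightarrow> bool" where
  "closed_set p I L \<longleftrightarrow> L \<subseteq> vecs p I \<and> reduce p I (\<lambda>_. 0) \<in> L \<and>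
     (\<forall>x\<in>L. \<forall>y\<in>L. reduce p I (\<lambda>i. x i + y i) \<in> L) \<and> (\<forall>a. \<forall>x\<in>L. reduce p I (\<lambda>i. a * x i) \<in> L)"

lemma reduce_eqI: "(\<And>i. i \<in> I \<Longrightarrow> [x i = y i] (mod int p)) \<Longrightarrow> reduce p I x = reduce p I y"
  by (auto simp: reduce_def cong_def)

lemma span_set_subset_closed:
  assumes L: "closed_set p I L" and vs: "set vs \<subseteq> L" and p: "p > 0"
  shows "span_set p I vs \<subseteq> L"
proof
  fix x assume x: "x \<in> span_set p I vs"
  then have "in_span p I vs x" by (simp add: span_set_def)
  then have "reduce p I x \<in> L"
  proof (induction rule: in_span_induct)
    case (cong x y)
    then show ?case using reduce_eqI[of I x y p] by metis
  next
    case zero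
    then show ?case using L by (simp add: closed_set_def)
  next
    case (add x v a)
    have "reduce p I (\<lambda>i. a * v i) \<in> L" using add vs L unfolding closed_set_def by blast
    then have "reduce p I (\<lambda>i. reduce p I x i + reduce p I (\<lambda>i. a * v i) i) \<in> L"
      using add L unfolding closed_set_def by blast
    also have "reduce p I (\<lambda>i. reduce p I x i + reduce p I (\<lambda>i. a * v i) i) = reduce p I (\<lambda>i. x i + a * v i)"
      by (intro reduce_eqI cong_add reduce_cong)
    finally show ?case .
  qed
  then show "x \<in> L" using x p by (simp add: reduce_id span_set_def)
qed

lemma closed_span_set:
  assumes p: "p > 0"
  shows "closed_set p I (span_set p I vs)"
  using p by (auto simp: closed_set_def span_set_def in_span_zero in_span_add in_span_smult)

section \<open>Passage between normal forms and the module \<open>Wspace\<close>\<close>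

lemma carrier_Wspace: "p > 1 \<Longrightarrow> carrier (Wspace p d) = vecs p (pairs d)"
proof -
  assume "p > 1"
  moreover have "{0..int p - 1} = {0..<int p}" by auto
  ultimately show ?thesis by (simp add: Wspace_simps vecs_def)
qed

lemma carrier_Vspace: "p > 1 \<Longrightarrow> carrier (Vspace p d) = vecs p {..<d}"
proof -
  assume "p > 1"
  moreover have "{0..int p - 1} = {0..<int p}" by auto
  ultimately show ?thesis by (simp add: Vspace_simps vecs_def)
qed

lemma Wspace_reduce:
  assumes "p > 1"
  shows "a \<oplus>\<^bsub>Wspace p d\<^esub> b = reduce p (pairs d) (\<lambda>i. a i + b i)"
    "\<zero>\<^bsub>Wspace p d\<^esub> = reduce p (pairs d) (\<lambda>_. 0)"
    "c \<odot>\<^bsub>Wspace p d\<^esub> a = reduce p (pairs d) (\<lambda>i. c * a i)"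
  using assms by (simp_all add: Wspace_simps reduce_def)

lemma field_Fp: "prime p \<Longrightarrow> field (Fp p)"
proof -
  assume p: "prime p"
  interpret residues_prime p "Fp p"
    by unfold_locales (use p prime_gt_1_nat in auto)
  show ?thesis by (rule is_field)
qed

lemma vectorspace_Wspace: "prime p \<Longrightarrow> vectorspace (Fp p) (Wspace p d)"
proof -
  assume p: "prime p"
  interpret field "Fp p" by (rule field_Fp[OF p])
  show ?thesis unfolding Wspace_def
    by (rule vectorspace.intro[OF func_space_is_module field_axioms])
qed

lemma closed_set_iff_subspace:
  assumes p: "prime p"
  shows "VectorSpace.subspace (Fp p) L (Wspace p d) \<longleftrightarrow> closed_set p (pairs d) L"
proof
  have p1: "p > 1" using prime_gt_1_nat[OF p] .
  assume "VectorSpace.subspace (Fp p) L (Wspace p d)"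
  then interpret submodule "Fp p" L "Wspace p d" by (rule subspace.submod)
  have sub: "L \<subseteq> vecs p (pairs d)" using subset carrier_Wspace[OF p1] by simp
  have "reduce p (pairs d) (\<lambda>i. a * x i) \<in> L" if "x \<in> L" for a x
  proof -
    \<comment> \<open>The submodule is closed only under scalars from the carrier of
      \<open>Fp p\<close>, so an arbitrary integer is replaced by its residue first.\<close>
    have "(a mod int p) \<odot>\<^bsub>Wspace p d\<^esub> x \<in> L"
      using that p1 by (intro smult_closed) (auto simp: Fp_simps)
    also have "(a mod int p) \<odot>\<^bsub>Wspace p d\<^esub> x = reduce p (pairs d) (\<lambda>i. a * x i)"
      unfolding Wspace_reduce[OF p1] by (intro reduce_eqI cong_mult) (auto simp: cong_def)
    finally show ?thesis .
  qed
  then show "closed_set p (pairs d) L"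
    using sub m_closed zero_closed unfolding closed_set_def Wspace_reduce[OF p1] by blast
next
  have p1: "p > 1" using prime_gt_1_nat[OF p] .
  assume L: "closed_set p (pairs d) L"
  have vs: "vectorspace (Fp p) (Wspace p d)" by (rule vectorspace_Wspace[OF p])
  have "submodule (Fp p) L (Wspace p d)"
    using L vs unfolding submodule_def closed_set_def carrier_Wspace[OF p1] Wspace_reduce[OF p1]
    by (auto simp: vectorspace_def)
  with vs show "VectorSpace.subspace (Fp p) L (Wspace p d)" by (rule subspace.intro)
qed

lemma card_vectorspace:
  assumes V: "vectorspace K V" and finite_V: "finite (carrier V)"
  shows "card (carrier V) = card (carrier K) ^ vectorspace.dim K V"
proof -
  interpret vectorspace K V by (rule V)
  have "gen_set (carrier V)"
    using span_is_submodule[of "carrier V"] in_own_span[of "carrier V"]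
    by (auto simp: submodule_def)
  then have "fin_dim" unfolding fin_dim_def using finite_V by (intro exI[of _ "carrier V"]) simp
  then obtain B where B: "finite B" "basis B" using finite_basis_exists by blast
  have BV: "B \<subseteq> carrier V" using B(2) by (simp add: basis_def)
  have u: "\<exists>!a. a \<in> B \<rightarrow>\<^sub>E carrier K \<and> lincomb a B = v" if "v \<in> carrier V" for v
    using basis_criterion[OF B(1) BV] B(2) that by blast
  have "bij_betw (\<lambda>a. lincomb a B) (B \<rightarrow>\<^sub>E carrier K) (carrier V)"
    unfolding bij_betw_def
  proof
    have cl: "lincomb a B \<in> carrier V" if "a \<in> B \<rightarrow>\<^sub>E carrier K" for a
      using that BV by (intro lincomb_closed) auto
    show "inj_on (\<lambda>a. lincomb a B) (B \<rightarrow>\<^sub>E carrier K)"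
      by (rule inj_onI) (metis cl u)
    show "(\<lambda>a. lincomb a B) ` (B \<rightarrow>\<^sub>E carrier K) = carrier V"
      using cl u by (auto simp: image_iff) metis
  qed
  then have "card (carrier V) = card (B \<rightarrow>\<^sub>E carrier K)" by (simp add: bij_betw_same_card)
  also have "\<dots> = card (carrier K) ^ card B" using B(1) by (simp add: card_PiE)
  also have "card B = dim" using dim_basis[OF B] by simp
  finally show ?thesis .
qed

text \<open>A space of dimension \<open>r\<close> over \<open>Fp p\<close> has \<open>p ^ r\<close>
  elements, and this number determines \<open>r\<close>. The Grassmannian thus becomes accessible to
  counting.\<close>

lemma Gr_iff:
  assumes p: "prime p"
  shows "L \<in> Gr p d r \<longleftrightarrow> closed_set p (pairs d) L \<and> card L = p ^ r"
proof (cases "closed_set p (pairs d) L")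
  case True
  have p1: "p > 1" using prime_gt_1_nat[OF p] .
  have sub: "VectorSpace.subspace (Fp p) L (Wspace p d)" using True closed_set_iff_subspace[OF p] by blast
  have V: "vectorspace (Fp p) ((Wspace p d)\<lparr>carrier := L\<rparr>)"
    by (rule vectorspace.subspace_is_vs[OF vectorspace_Wspace[OF p] sub])
  have fin: "finite L" using True finite_subset[of L "vecs p (pairs d)"] by (auto simp: closed_set_def finite_pairs)
  have "card L = p ^ vectorspace.dim (Fp p) ((Wspace p d)\<lparr>carrier := L\<rparr>)"
    using card_vectorspace[OF V] fin by (simp add: Fp_simps)
  then show ?thesis using True sub p1 by (auto simp: Gr_def dest: power_inject_exp[THEN iffD1])
next
  case False
  then show ?thesis using closed_set_iff_subspace[OF p] by (auto simp: Gr_def)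
qed

lemma wedge_span_Gr:
  assumes p: "prime p" and "wedge_indep p d ps" "length ps = r"
  shows "wedge_span p d ps \<in> Gr p d r"
  using assms card_span_set[OF p finite_pairs, of d "wedges ps"]
    closed_span_set[OF prime_gt_0_nat[OF p], of "pairs d" "wedges ps"]
  by (simp add: Gr_iff[OF p] wedge_span_def)

section \<open>Ordered bases and the size of the Grassmannian\<close>

definition frames :: "nat \<Rightarrow> 'i set \<Rightarrow> ('i \<Rightarrow> int) set \<Rightarrow> nat \<Rightarrow> ('i \<Rightarrow> int) list set" where
  "frames p I L m = {xs. length xs = m \<and> set xs \<subseteq> L \<and> lrank p I xs = m}"

lemma finite_frames: "finite L \<Longrightarrow> finite (frames p I L m)"
  by (rule finite_subset[OF _ finite_lists_length_eq[of L m]]) (auto simp: frames_def)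

text \<open>An independent list of length \<open>m\<close> in \<open>L\<close> can be extended by
  every element of \<open>L\<close> outside its span, which has \<open>p ^ m\<close>
  elements.\<close>

lemma card_frames:
  assumes p: "prime p" and I: "finite I" and L: "closed_set p I L" "card L = p ^ r" and "m \<le> r"
  shows "(\<Prod>i<m. real p ^ r - real p ^ i) \<le> real (card (frames p I L m))"
  using assms(5)
proof (induction m)
  case 0
  have "frames p I L 0 = {[]}" by (auto simp: frames_def)
  then show ?case by simp
next
  case (Suc m)
  have p0: "p > 0" using prime_gt_0_nat[OF p] .
  have LV: "L \<subseteq> vecs p I" using L(1) by (simp add: closed_set_def)
  have finL: "finite L" using finite_subset[OF LV] I by simp
  have S: "(\<lambda>(xs, x). x # xs) ` (SIGMA xs:frames p I L m. L - span_set p I xs) \<subseteq> frames p I L (Suc m)"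
    using LV by (auto simp: frames_def span_set_def)
  have "(\<Prod>i<Suc m. real p ^ r - real p ^ i) \<le> real (card (frames p I L m)) * (real p ^ r - real p ^ m)"
    using Suc p0 by (auto intro!: mult_right_mono power_increasing)
  also have "\<dots> = (\<Sum>xs\<in>frames p I L m. real p ^ r - real p ^ m)" by simp
  also have "\<dots> = (\<Sum>xs\<in>frames p I L m. real (card (L - span_set p I xs)))"
  proof (rule sum.cong[OF refl])
    fix xs assume xs: "xs \<in> frames p I L m"
    have "span_set p I xs \<subseteq> L" using xs by (intro span_set_subset_closed[OF L(1) _ p0]) (simp add: frames_def)
    moreover have "card (span_set p I xs) = p ^ m" using xs card_span_set[OF p I, of xs] by (simp add: frames_def)
    ultimately have "real (card (L - span_set p I xs)) = real (card L) - real (p ^ m)"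
      using finL by (simp add: card_Diff_subset finite_subset of_nat_diff card_mono flip: \<open>card (span_set p I xs) = p ^ m\<close>)
    then show "real p ^ r - real p ^ m = real (card (L - span_set p I xs))" using L(2) by simp
  qed
  also have "\<dots> = real (card (SIGMA xs:frames p I L m. L - span_set p I xs))"
    using finL finite_frames[OF finL] by (subst card_SigmaI) auto
  also have "card (SIGMA xs:frames p I L m. L - span_set p I xs)
     = card ((\<lambda>(xs, x). x # xs) ` (SIGMA xs:frames p I L m. L - span_set p I xs))"
    by (rule card_image[symmetric]) (auto simp: inj_on_def)
  also have "real \<dots> \<le> real (card (frames p I L (Suc m)))"
    using card_mono[OF finite_frames[OF finL] S] by simp
  finally show ?case .
qed

lemma span_set_frame:
  assumes p: "prime p" and I: "finite I" and L: "closed_set p I L" "card L = p ^ r" and xs: "xs \<in> frames p I L r"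
  shows "span_set p I xs = L"
proof (rule card_subset_eq)
  show "finite L" using L(1) I finite_subset[of L "vecs p I"] by (auto simp: closed_set_def)
  show "span_set p I xs \<subseteq> L"
    using xs by (intro span_set_subset_closed[OF L(1) _ prime_gt_0_nat[OF p]]) (simp add: frames_def)
  show "card (span_set p I xs) = card L" using xs L(2) card_span_set[OF p I, of xs] by (simp add: frames_def)
qed

lemma finite_Gr: "prime p \<Longrightarrow> finite (Gr p d r)"
  by (rule finite_subset[of _ "Pow (vecs p (pairs d))"]) (auto simp: Gr_iff closed_set_def finite_pairs)

text \<open>Every \<open>L\<close> has at least as many ordered bases as the product says, and an
  ordered basis determines \<open>L\<close> as its span. So the bases of all \<open>L\<close>
  together are distinct lists of \<open>r\<close> vectors of \<open>W\<close>. Only an upper bound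
  is wanted, because the Grassmannian is the denominator of the ratio.\<close>

lemma card_Gr_le:
  assumes p: "prime p"
  shows "real (card (Gr p d r)) * (\<Prod>i<r. real p ^ r - real p ^ i) \<le> real p ^ (card (pairs d) * r)"
proof -
  let ?I = "pairs d"
  have finL: "finite L" if "L \<in> Gr p d r" for L
    using that finite_subset[of L "vecs p ?I"] by (auto simp: Gr_iff[OF p] closed_set_def finite_pairs)
  have "real (card (Gr p d r)) * (\<Prod>i<r. real p ^ r - real p ^ i) = (\<Sum>L\<in>Gr p d r. \<Prod>i<r. real p ^ r - real p ^ i)"
    by simp
  also have "\<dots> \<le> (\<Sum>L\<in>Gr p d r. real (card (frames p ?I L r)))"
    by (rule sum_mono) (use card_frames[OF p finite_pairs _ _ order.refl] Gr_iff[OF p] in blast)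
  also have "\<dots> = real (card (SIGMA L:Gr p d r. frames p ?I L r))"
    using finite_Gr[OF p] finL by (subst card_SigmaI) (auto intro: finite_frames)
  also have "card (SIGMA L:Gr p d r. frames p ?I L r) \<le> card {xs. set xs \<subseteq> vecs p ?I \<and> length xs = r}"
  proof (rule card_inj_on_le[of snd])
    show "inj_on snd (SIGMA L:Gr p d r. frames p ?I L r)"
    proof (rule inj_onI, clarsimp)
      fix L L' xs assume "L \<in> Gr p d r" "xs \<in> frames p ?I L r" "L' \<in> Gr p d r" "xs \<in> frames p ?I L' r"
      then show "L = L'" using span_set_frame[OF p finite_pairs] Gr_iff[OF p] by metis
    qed
    show "snd ` (SIGMA L:Gr p d r. frames p ?I L r) \<subseteq> {xs. set xs \<subseteq> vecs p ?I \<and> length xs = r}"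
      by (fastforce simp: frames_def Gr_iff[OF p] closed_set_def)
  qed (intro finite_lists_length_eq finite_vecs finite_pairs)
  also have "\<dots> = (p ^ card ?I) ^ r"
    by (simp add: card_lists_length_eq finite_pairs card_vecs)
  finally show ?thesis by (simp add: power_mult)
qed

lemma wedge_eq_reduce: "p > 1 \<Longrightarrow> wedge p d v w = reduce p (pairs d) (wdg v w)"
  by (auto simp: wedge_eq reduce_def wdg_def intro!: restrict_ext)

text \<open>Linear combinations reduce to group products because a scalar can be moved into the
  first vector: \<open>a (v \<and> w) = (a v) \<and> w\<close> is again a wedge in the span.\<close>

lemma wedge_span_generated:
  assumes p: "p > 1" and ps: "ps \<in> pair_lists p d r" and a: "a \<in> wedge_span p d ps"
  shows "(\<zero>\<^bsub>Vspace p d\<^esub>, a) \<in> generate (free2 p d) {(\<zero>\<^bsub>Vspace p d\<^esub>, wedge p d v w) | v w.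
    v \<in> carrier (Vspace p d) \<and> w \<in> carrier (Vspace p d) \<and> wedge p d v w \<in> wedge_span p d ps}"
    (is "_ \<in> generate _ ?S")
proof -
  let ?I = "pairs d"
  have "in_span p ?I (wedges ps) a" using a by (simp add: wedge_span_def span_set_def)
  then have "in_span p ?I (wedges ps) a \<and> (\<zero>\<^bsub>Vspace p d\<^esub>, reduce p ?I a) \<in> generate (free2 p d) ?S"
  proof (induction rule: in_span_induct)
    case (cong x y)
    have "in_span p ?I (wedges ps) y" using cong by (intro in_span_cong[of p ?I "wedges ps" x y]) auto
    moreover have "reduce p ?I x = reduce p ?I y" by (rule reduce_eqI) (rule cong(2))
    ultimately show ?case using cong(1) by simp
  next
    case zero
    have "(\<zero>\<^bsub>Vspace p d\<^esub>, reduce p ?I (\<lambda>_. 0)) = \<one>\<^bsub>free2 p d\<^esub>"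
      by (simp add: free2_one[OF p] Vspace_simps[OF p] reduce_def)
    then show ?case using in_span_zero generate.one[of "free2 p d" ?S] by (simp only:) simp
  next
    case (add x u a)
    from add(1) obtain v w where vw: "(v, w) \<in> set ps" "u = wdg v w" by auto
    then have vwV: "v \<in> vecs p {..<d}" "w \<in> vecs p {..<d}" using ps by (auto simp: pair_lists_def)
    define v' where "v' = reduce p {..<d} (\<lambda>i. a * v i)"
    have v'V: "v' \<in> vecs p {..<d}" using p by (simp add: v'_def)
    have c: "[wdg v' w ij = a * u ij] (mod int p)" if ijd: "ij \<in> ?I" for ij
    proof -
      obtain i j where ij: "ij = (i, j)" "i < d" "j < d" using ijd by (auto simp: pairs_def)
      have "[v' i * w j - v' j * w i = (a * v i) * w j - (a * v j) * w i] (mod int p)"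
        unfolding v'_def using ij by (intro cong_diff cong_mult cong_refl reduce_cong) auto
      then show ?thesis by (simp add: wdg_def ij vw(2) algebra_simps)
    qed
    have c': "[reduce p ?I (wdg v' w) ij = a * u ij] (mod int p)" if ijd: "ij \<in> ?I" for ij
      using reduce_cong[OF ijd, of p "wdg v' w"] c[OF ijd] by (rule cong_trans)
    have u: "in_span p ?I (wedges ps) (\<lambda>ij. a * u ij)"
      by (intro in_span_smult in_span_mem add(1))
    have "in_span p ?I (wedges ps) (wdg v' w)" by (rule in_span_cong[OF u]) (simp add: c cong_sym)
    then have "wedge p d v' w \<in> wedge_span p d ps"
      using p by (simp add: wedge_eq_reduce wedge_span_def span_set_def)
    then have g: "(\<zero>\<^bsub>Vspace p d\<^esub>, wedge p d v' w) \<in> generate (free2 p d) ?S"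
      using vwV(2) v'V by (intro generate.incl CollectI exI[of _ v'] exI[of _ w]) (simp add: carrier_Vspace[OF p])
    have "(\<zero>\<^bsub>Vspace p d\<^esub>, reduce p ?I x) \<otimes>\<^bsub>free2 p d\<^esub> (\<zero>\<^bsub>Vspace p d\<^esub>, wedge p d v' w) \<in> generate (free2 p d) ?S"
      using add g by (intro generate.eng) auto
    also have "(\<zero>\<^bsub>Vspace p d\<^esub>, reduce p ?I x) \<otimes>\<^bsub>free2 p d\<^esub> (\<zero>\<^bsub>Vspace p d\<^esub>, wedge p d v' w)
       = (\<zero>\<^bsub>Vspace p d\<^esub>, reduce p ?I (\<lambda>ij. reduce p ?I x ij + wedge p d v' w ij))"
      unfolding free2_mult[OF p] Vspace_simps[OF p] reduce_def prod.inject
      by (intro conjI restrict_ext; clarify?; simp add: pairs_bound)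
    also have "reduce p ?I (\<lambda>ij. reduce p ?I x ij + wedge p d v' w ij) = reduce p ?I (\<lambda>ij. x ij + a * u ij)"
      unfolding wedge_eq_reduce[OF p]
      by (intro reduce_eqI cong_add reduce_cong c')
    finally show ?case using in_span_add[OF _ u] add(2) by blast
  qed
  moreover have "reduce p ?I a = a" using a p by (simp add: reduce_id wedge_span_def span_set_def)
  ultimately show ?thesis by simp
qed

section \<open>Vanishing of the Bogomolov multiplier\<close>

context group
begin

lemma generate_commute:
  assumes x: "x \<in> generate G S" and S: "S \<subseteq> carrier G" and y: "y \<in> carrier G"
    and comm: "\<And>s. s \<in> S \<Longrightarrow> y \<otimes> s = s \<otimes> y"
  shows "y \<otimes> x = x \<otimes> y"
  using x
proof (induction rule: generate.induct)
  case one
  then show ?case using y by simp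
next
  case (incl h)
  then show ?case by (rule comm)
next
  case (inv h)
  then have h: "h \<in> carrier G" using S by blast
  have "y \<otimes> inv h = inv h \<otimes> (h \<otimes> y) \<otimes> inv h" using h y by (simp add: m_assoc[symmetric])
  also have "h \<otimes> y = y \<otimes> h" using comm[OF inv] by simp
  also have "inv h \<otimes> (y \<otimes> h) \<otimes> inv h = inv h \<otimes> y" using h y by (simp add: m_assoc)
  finally show ?case .
next
  case (eng h1 h2)
  then have c: "h1 \<in> carrier G" "h2 \<in> carrier G" using generate_in_carrier[OF S] by auto
  have "y \<otimes> (h1 \<otimes> h2) = (y \<otimes> h1) \<otimes> h2" using c y by (simp only: m_assoc)
  also have "y \<otimes> h1 = h1 \<otimes> y" by (rule eng.IH)
  also have "h1 \<otimes> y \<otimes> h2 = h1 \<otimes> (y \<otimes> h2)" using c y by (simp only: m_assoc)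
  also have "y \<otimes> h2 = h2 \<otimes> y" by (rule eng.IH)
  also have "h1 \<otimes> (h2 \<otimes> y) = h1 \<otimes> h2 \<otimes> y" using c y by (simp only: m_assoc)
  finally show ?case .
qed

lemma comm_group_generate:
  assumes S: "S \<subseteq> carrier G" and comm: "\<And>s t. s \<in> S \<Longrightarrow> t \<in> S \<Longrightarrow> s \<otimes> t = t \<otimes> s"
  shows "comm_group (G\<lparr>carrier := generate G S\<rparr>)"
proof (rule group.group_comm_groupI)
  show "group (G\<lparr>carrier := generate G S\<rparr>)"
    by (rule subgroup.subgroup_is_group[OF generate_is_subgroup[OF S] group_axioms])
  fix x y assume "x \<in> carrier (G\<lparr>carrier := generate G S\<rparr>)" "y \<in> carrier (G\<lparr>carrier := generate G S\<rparr>)"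
  then have xy: "x \<in> generate G S" "y \<in> generate G S" by auto
  have "s \<otimes> x = x \<otimes> s" if "s \<in> S" for s
    by (rule generate_commute[OF xy(1) S]) (use S that comm in auto)
  then have "x \<otimes> y = y \<otimes> x"
    using generate_in_carrier[OF S xy(1)] by (intro generate_commute[OF xy(2) S]) auto
  then show "x \<otimes>\<^bsub>G\<lparr>carrier := generate G S\<rparr>\<^esub> y = y \<otimes>\<^bsub>G\<lparr>carrier := generate G S\<rparr>\<^esub> x" by simp
qed

lemma commutator_closed [simp]: "x \<in> carrier G \<Longrightarrow> y \<in> carrier G \<Longrightarrow> commutator G x y \<in> carrier G"
  by (simp add: commutator_def)


lemma commutator_mult: "x \<in> carrier G \<Longrightarrow> y \<in> carrier G \<Longrightarrow> commutator G x y \<otimes> (y \<otimes> x) = x \<otimes> y"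
proof -
  assume xy: "x \<in> carrier G" "y \<in> carrier G"
  have "commutator G x y \<otimes> (y \<otimes> x) = x \<otimes> y \<otimes> (inv x \<otimes> (inv y \<otimes> y) \<otimes> x)"
    unfolding commutator_def using xy by (simp only: m_assoc m_closed inv_closed)
  then show ?thesis using xy by simp
qed

lemma commutator_one_iff:
  "x \<in> carrier G \<Longrightarrow> y \<in> carrier G \<Longrightarrow> commutator G x y = \<one> \<longleftrightarrow> x \<otimes> y = y \<otimes> x"
  using commutator_mult[of x y] by (metis commutator_closed l_one m_closed one_closed right_cancel)

text \<open>The collection process: each exchange of a \<open>y\<close> with an \<open>x\<close>
  produces one central commutator. Moving \<open>x\<close> past \<open>y [^] n\<close> takes
  \<open>n\<close> exchanges, and sorting \<open>(x \<otimes> y) [^] n\<close> takes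
  \<open>0 + 1 + ... + (n - 1)\<close>.\<close>

lemma class2_pow_mult:
  assumes xy: "x \<in> carrier G" "y \<in> carrier G"
    and central: "\<And>z. z \<in> carrier G \<Longrightarrow> z \<otimes> commutator G y x = commutator G y x \<otimes> z"
  shows "y [^] (n::nat) \<otimes> x = commutator G y x [^] n \<otimes> (x \<otimes> y [^] n)"
    "(x \<otimes> y) [^] n = commutator G y x [^] (n choose 2) \<otimes> (x [^] n \<otimes> y [^] n)"
proof -
  define k where "k = commutator G y x"
  have k: "k \<in> carrier G" using xy by (simp add: k_def)
  have kc: "k [^] (i::nat) \<otimes> z = z \<otimes> k [^] i" if "z \<in> carrier G" for i z
  proof (induction i)
    case (Suc i)
    have "k [^] Suc i \<otimes> z = k [^] i \<otimes> (k \<otimes> z)" using k that by (simp add: m_assoc)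
    also have "k \<otimes> z = z \<otimes> k" using central[OF that] by (simp add: k_def)
    also have "k [^] i \<otimes> (z \<otimes> k) = (k [^] i \<otimes> z) \<otimes> k" using k that by (simp add: m_assoc)
    also have "k [^] i \<otimes> z = z \<otimes> k [^] i" by (rule Suc.IH)
    finally show ?case using k that by (simp add: m_assoc)
  qed (use that in simp)
  have yx: "y \<otimes> x = k \<otimes> (x \<otimes> y)" using commutator_mult[OF xy(2,1)] by (simp add: k_def)
  have 1: "y [^] n \<otimes> x = k [^] n \<otimes> (x \<otimes> y [^] n)" for n :: nat
  proof (induction n)
    case (Suc n)
    have "y [^] Suc n \<otimes> x = y [^] n \<otimes> (y \<otimes> x)" using xy by (simp add: m_assoc)
    also have "\<dots> = (y [^] n \<otimes> k) \<otimes> (x \<otimes> y)" using xy k by (simp add: yx m_assoc)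
    also have "y [^] n \<otimes> k = k \<otimes> y [^] n" using central[of "y [^] n"] xy by (simp add: k_def)
    also have "k \<otimes> y [^] n \<otimes> (x \<otimes> y) = k \<otimes> (y [^] n \<otimes> x) \<otimes> y" using xy k by (simp add: m_assoc)
    also have "y [^] n \<otimes> x = k [^] n \<otimes> (x \<otimes> y [^] n)" by (rule Suc.IH)
    also have "k \<otimes> (k [^] n \<otimes> (x \<otimes> y [^] n)) \<otimes> y = (k \<otimes> k [^] n) \<otimes> (x \<otimes> y [^] Suc n)"
      using xy k by (simp add: m_assoc)
    also have "k \<otimes> k [^] n = k [^] Suc n" using k by (simp add: nat_pow_Suc2[symmetric] del: nat_pow_Suc)
    finally show ?case .
  qed (use xy k in simp)
  have 2: "(x \<otimes> y) [^] n = k [^] (n choose 2) \<otimes> (x [^] n \<otimes> y [^] n)"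
  proof (induction n)
    case (Suc n)
    have "(x \<otimes> y) [^] Suc n = k [^] (n choose 2) \<otimes> (x [^] n \<otimes> y [^] n) \<otimes> (x \<otimes> y)" by (simp add: Suc.IH)
    also have "\<dots> = k [^] (n choose 2) \<otimes> (x [^] n \<otimes> (y [^] n \<otimes> x) \<otimes> y)" using xy k by (simp add: m_assoc)
    also have "\<dots> = k [^] (n choose 2) \<otimes> ((x [^] n \<otimes> k [^] n) \<otimes> (x \<otimes> y [^] n) \<otimes> y)"
      using xy k by (simp only: 1) (simp add: m_assoc)
    also have "x [^] n \<otimes> k [^] n = k [^] n \<otimes> x [^] n" using xy by (simp add: kc)
    also have "k [^] (n choose 2) \<otimes> (k [^] n \<otimes> x [^] n \<otimes> (x \<otimes> y [^] n) \<otimes> y)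
        = (k [^] (n choose 2) \<otimes> k [^] n) \<otimes> (x [^] Suc n \<otimes> y [^] Suc n)" using xy k by (simp add: m_assoc)
    also have "k [^] (n choose 2) \<otimes> k [^] n = k [^] (Suc n choose 2)"
      using k by (simp add: nat_pow_mult numeral_2_eq_2 add.commute)
    finally show ?case .
  qed (use xy k in \<open>simp add: binomial_eq_0\<close>)
  show "y [^] n \<otimes> x = commutator G y x [^] n \<otimes> (x \<otimes> y [^] n)"
    "(x \<otimes> y) [^] n = commutator G y x [^] (n choose 2) \<otimes> (x [^] n \<otimes> y [^] n)"
    using 1 2 by (auto simp: k_def)
qed

text \<open>If \<open>y\<close> has order dividing \<open>p\<close>, so has its commutator with
  \<open>x\<close>, and for odd \<open>p\<close> the exponent \<open>p choose 2\<close> is a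
  multiple of \<open>p\<close>. Hence products stay in \<open>T\<close>. An extension by
  \<open>QmodZ\<close> does not have exponent \<open>p\<close>, and \<open>T\<close> is the part of
  it to which the universal property of \<open>free2\<close> applies.\<close>

lemma class2_exponent_torsion:
  assumes p: "odd p"
    and central: "\<And>x y z. x \<in> carrier G \<Longrightarrow> y \<in> carrier G \<Longrightarrow> z \<in> carrier G \<Longrightarrow>
      z \<otimes> commutator G x y = commutator G x y \<otimes> z"
  defines "T \<equiv> {x \<in> carrier G. x [^] p = \<one>}"
  shows "subgroup T G" "class2_exponent p (G\<lparr>carrier := T\<rparr>)"
proof -
  show T: "subgroup T G"
  proof (rule subgroupI)
    show "T \<subseteq> carrier G" "T \<noteq> {}" by (auto simp: T_def intro: exI[of _ \<one>])
  next
    fix x assume "x \<in> T"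
    then show "inv x \<in> T" by (simp add: T_def nat_pow_inv)
  next
    fix x y assume "x \<in> T" "y \<in> T"
    then have xy: "x \<in> carrier G" "y \<in> carrier G" "x [^] p = \<one>" "y [^] p = \<one>" by (auto simp: T_def)
    let ?k = "commutator G y x"
    have k: "?k \<in> carrier G" using xy by simp
    have "x = ?k [^] p \<otimes> x"
      using class2_pow_mult(1)[OF xy(1,2) central, of p] xy by simp
    then have kp: "?k [^] p = \<one>" using xy k by (metis l_one nat_pow_closed one_closed right_cancel)
    have "p choose 2 = p * ((p - 1) div 2)" using p by (auto simp: choose_two elim!: oddE)
    then have "?k [^] (p choose 2) = \<one>" using kp k by (simp flip: nat_pow_pow)
    then have "(x \<otimes> y) [^] p = \<one>"
      using class2_pow_mult(2)[OF xy(1,2) central, of p] xy by simp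
    then show "x \<otimes> y \<in> T" using xy by (simp add: T_def)
  qed
  have c: "commutator (G\<lparr>carrier := T\<rparr>) x y = commutator G x y" if "x \<in> T" "y \<in> T" for x y
    using that by (simp add: commutator_def m_inv_consistent[OF T])
  show "class2_exponent p (G\<lparr>carrier := T\<rparr>)"
    unfolding class2_exponent_def
  proof (intro conjI ballI)
    show "group (G\<lparr>carrier := T\<rparr>)" by (rule subgroup.subgroup_is_group[OF T group_axioms])
  next
    fix x assume "x \<in> carrier (G\<lparr>carrier := T\<rparr>)"
    then show "x [^]\<^bsub>G\<lparr>carrier := T\<rparr>\<^esub> p = \<one>\<^bsub>G\<lparr>carrier := T\<rparr>\<^esub>"
      by (simp add: T_def flip: nat_pow_consistent)
  next
    fix x y z assume "x \<in> carrier (G\<lparr>carrier := T\<rparr>)" "y \<in> carrier (G\<lparr>carrier := T\<rparr>)" "z \<in> carrier (G\<lparr>carrier := T\<rparr>)"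
    then have T': "x \<in> T" "y \<in> T" "z \<in> T" by auto
    then show "commutator (G\<lparr>carrier := T\<rparr>) x y \<otimes>\<^bsub>G\<lparr>carrier := T\<rparr>\<^esub> z
       = z \<otimes>\<^bsub>G\<lparr>carrier := T\<rparr>\<^esub> commutator (G\<lparr>carrier := T\<rparr>) x y"
      using central[of x y z] by (simp add: c) (simp add: T_def)
  qed
qed

end

lemma hom_eq_on_generate:
  assumes f: "group_hom G H f" and g: "group_hom G H g" and S: "S \<subseteq> carrier G"
    and eq: "\<And>s. s \<in> S \<Longrightarrow> f s = g s" and x: "x \<in> generate G S"
  shows "f x = g x"
proof -
  interpret f: group_hom G H f by (rule f)
  interpret g: group_hom G H g by (rule g)
  show ?thesis using x
  proof (induction rule: generate.induct)
    case (inv h)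
    then show ?case using eq[of h] S by (auto simp: f.hom_inv g.hom_inv)
  next
    case (eng h1 h2)
    then show ?case using f.G.generate_in_carrier[OF S] by simp
  qed (auto simp: eq)
qed

section \<open>Central extensions attached to cocycles\<close>

definition cocycle_ext :: "('g, 'x) monoid_scheme \<Rightarrow> ('m, 'y) monoid_scheme \<Rightarrow> ('g \<times> 'g \<Rightarrow> 'm) \<Rightarrow> ('g \<times> 'm) monoid" where
  "cocycle_ext G M f = \<lparr>carrier = carrier G \<times> carrier M,
     monoid.mult = (\<lambda>(g, a) (h, b). (g \<otimes>\<^bsub>G\<^esub> h, a \<otimes>\<^bsub>M\<^esub> b \<otimes>\<^bsub>M\<^esub> f (g, h))),
     one = (\<one>\<^bsub>G\<^esub>, inv\<^bsub>M\<^esub> f (\<one>\<^bsub>G\<^esub>, \<one>\<^bsub>G\<^esub>))\<rparr>"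

lemma cocycle_ext_simps [simp]:
  "carrier (cocycle_ext G M f) = carrier G \<times> carrier M"
  "(g, a) \<otimes>\<^bsub>cocycle_ext G M f\<^esub> (h, b) = (g \<otimes>\<^bsub>G\<^esub> h, a \<otimes>\<^bsub>M\<^esub> b \<otimes>\<^bsub>M\<^esub> f (g, h))"
  "\<one>\<^bsub>cocycle_ext G M f\<^esub> = (\<one>\<^bsub>G\<^esub>, inv\<^bsub>M\<^esub> f (\<one>\<^bsub>G\<^esub>, \<one>\<^bsub>G\<^esub>))"
  by (simp_all add: cocycle_ext_def)

text \<open>Associativity is the cocycle identity. Cocycles are not assumed to be normalised, so the
  identity element and the inverses are corrected by \<open>f\<close> at the identity of
  \<open>G\<close>.\<close>

lemma group_cocycle_ext:
  assumes G: "group G" and M: "comm_group M" and f: "f \<in> cocycles2 G M"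
  shows "group (cocycle_ext G M f)"
proof -
  interpret G: group G by (rule G)
  interpret M: comm_group M by (rule M)
  have fc: "f (g, h) \<in> carrier M" if "g \<in> carrier G" "h \<in> carrier G" for g h
    using f that by (auto simp: cocycles2_def)
  have coc: "f (h, k) \<otimes>\<^bsub>M\<^esub> f (g, h \<otimes>\<^bsub>G\<^esub> k) = f (g \<otimes>\<^bsub>G\<^esub> h, k) \<otimes>\<^bsub>M\<^esub> f (g, h)"
    if "g \<in> carrier G" "h \<in> carrier G" "k \<in> carrier G" for g h k
    using f that by (simp add: cocycles2_def)
  \<comment> \<open>The cocycle identity for the triple consisting of 1, 1 and \<open>k\<close>,
    after cancelling one factor.\<close>
  have f1: "f (\<one>\<^bsub>G\<^esub>, k) = f (\<one>\<^bsub>G\<^esub>, \<one>\<^bsub>G\<^esub>)" if "k \<in> carrier G" for k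
    using coc[of "\<one>\<^bsub>G\<^esub>" "\<one>\<^bsub>G\<^esub>" k] that fc by simp
  show ?thesis
  proof (rule groupI)
    fix x y assume "x \<in> carrier (cocycle_ext G M f)" "y \<in> carrier (cocycle_ext G M f)"
    then show "x \<otimes>\<^bsub>cocycle_ext G M f\<^esub> y \<in> carrier (cocycle_ext G M f)" by (auto simp: fc)
  next
    show "\<one>\<^bsub>cocycle_ext G M f\<^esub> \<in> carrier (cocycle_ext G M f)" by (simp add: fc)
  next
    fix x y z assume "x \<in> carrier (cocycle_ext G M f)" "y \<in> carrier (cocycle_ext G M f)" "z \<in> carrier (cocycle_ext G M f)"
    then obtain g a h b k c where xyz: "x = (g, a)" "y = (h, b)" "z = (k, c)"
      and c: "g \<in> carrier G" "h \<in> carrier G" "k \<in> carrier G" "a \<in> carrier M" "b \<in> carrier M" "c \<in> carrier M" by auto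
    have "a \<otimes>\<^bsub>M\<^esub> b \<otimes>\<^bsub>M\<^esub> f (g, h) \<otimes>\<^bsub>M\<^esub> c \<otimes>\<^bsub>M\<^esub> f (g \<otimes>\<^bsub>G\<^esub> h, k)
       = (a \<otimes>\<^bsub>M\<^esub> b \<otimes>\<^bsub>M\<^esub> c) \<otimes>\<^bsub>M\<^esub> (f (g \<otimes>\<^bsub>G\<^esub> h, k) \<otimes>\<^bsub>M\<^esub> f (g, h))"
      using c fc by (simp add: M.m_ac)
    also have "\<dots> = (a \<otimes>\<^bsub>M\<^esub> b \<otimes>\<^bsub>M\<^esub> c) \<otimes>\<^bsub>M\<^esub> (f (h, k) \<otimes>\<^bsub>M\<^esub> f (g, h \<otimes>\<^bsub>G\<^esub> k))"
      using c by (simp add: coc)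
    also have "\<dots> = a \<otimes>\<^bsub>M\<^esub> (b \<otimes>\<^bsub>M\<^esub> c \<otimes>\<^bsub>M\<^esub> f (h, k)) \<otimes>\<^bsub>M\<^esub> f (g, h \<otimes>\<^bsub>G\<^esub> k)"
      using c fc by (simp add: M.m_ac)
    finally show "x \<otimes>\<^bsub>cocycle_ext G M f\<^esub> y \<otimes>\<^bsub>cocycle_ext G M f\<^esub> z
        = x \<otimes>\<^bsub>cocycle_ext G M f\<^esub> (y \<otimes>\<^bsub>cocycle_ext G M f\<^esub> z)"
      using c by (simp add: xyz G.m_assoc)
  next
    fix x assume "x \<in> carrier (cocycle_ext G M f)"
    then obtain g a where x: "x = (g, a)" "g \<in> carrier G" "a \<in> carrier M" by auto
    let ?u = "f (\<one>\<^bsub>G\<^esub>, \<one>\<^bsub>G\<^esub>)"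
    have u: "?u \<in> carrier M" by (simp add: fc)
    have "inv\<^bsub>M\<^esub> ?u \<otimes>\<^bsub>M\<^esub> a \<otimes>\<^bsub>M\<^esub> ?u = inv\<^bsub>M\<^esub> ?u \<otimes>\<^bsub>M\<^esub> ?u \<otimes>\<^bsub>M\<^esub> a" using u x by (simp only: M.m_ac M.inv_closed)
    also have "\<dots> = a" using u x by simp
    finally show "\<one>\<^bsub>cocycle_ext G M f\<^esub> \<otimes>\<^bsub>cocycle_ext G M f\<^esub> x = x" using x by (simp add: f1[OF x(2)])
    let ?w = "a \<otimes>\<^bsub>M\<^esub> f (inv\<^bsub>G\<^esub> g, g)"
    have w: "?w \<in> carrier M" using x fc by simp
    have "(inv\<^bsub>M\<^esub> ?w \<otimes>\<^bsub>M\<^esub> inv\<^bsub>M\<^esub> ?u) \<otimes>\<^bsub>M\<^esub> a \<otimes>\<^bsub>M\<^esub> f (inv\<^bsub>G\<^esub> g, g) = (inv\<^bsub>M\<^esub> ?w \<otimes>\<^bsub>M\<^esub> ?w) \<otimes>\<^bsub>M\<^esub> inv\<^bsub>M\<^esub> ?u"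
      using u x w fc by (simp only: M.m_ac M.inv_closed M.m_closed G.inv_closed)
    also have "\<dots> = inv\<^bsub>M\<^esub> ?u" using u w by simp
    finally have "(inv\<^bsub>G\<^esub> g, inv\<^bsub>M\<^esub> ?w \<otimes>\<^bsub>M\<^esub> inv\<^bsub>M\<^esub> ?u) \<otimes>\<^bsub>cocycle_ext G M f\<^esub> x = \<one>\<^bsub>cocycle_ext G M f\<^esub>"
      using x by simp
    then show "\<exists>y\<in>carrier (cocycle_ext G M f). y \<otimes>\<^bsub>cocycle_ext G M f\<^esub> x = \<one>\<^bsub>cocycle_ext G M f\<^esub>"
      using x u w by (intro bexI[of _ "(inv\<^bsub>G\<^esub> g, inv\<^bsub>M\<^esub> ?w \<otimes>\<^bsub>M\<^esub> inv\<^bsub>M\<^esub> ?u)"]) auto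
  qed
qed

text \<open>Assumption \<open>ker\<close> says that the relations of \<open>G\<close> follow from
  certain pairs of elements commuting. By \<open>loc\<close> such pairs still commute in the
  extension \<open>E\<close>, so a lift of \<open>\<pi>\<close> to \<open>E\<close> kills the kernel
  of \<open>\<pi>\<close> and splits the extension.\<close>

lemma locally_trivial_coboundary:
  assumes p: "odd p" "p > 1" and G: "group G" and M: "comm_group M" and f: "f \<in> cocycles2 G M"
    and \<pi>: "\<pi> \<in> hom (free2 p d) G" and surj: "\<pi> ` carrier (free2 p d) = carrier G"
    and loc: "\<And>A. subgroup A G \<Longrightarrow> comm_group (G\<lparr>carrier := A\<rparr>) \<Longrightarrow>
      \<exists>c\<in>A \<rightarrow> carrier M. \<forall>g\<in>A. \<forall>h\<in>A. f (g, h) = c g \<otimes>\<^bsub>M\<^esub> c h \<otimes>\<^bsub>M\<^esub> inv\<^bsub>M\<^esub> c (g \<otimes>\<^bsub>G\<^esub> h)"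
    and ker: "\<And>x. x \<in> carrier (free2 p d) \<Longrightarrow> \<pi> x = \<one>\<^bsub>G\<^esub> \<Longrightarrow>
      x \<in> generate (free2 p d) {commutator (free2 p d) y z | y z. y \<in> carrier (free2 p d) \<and>
        z \<in> carrier (free2 p d) \<and> \<pi> (commutator (free2 p d) y z) = \<one>\<^bsub>G\<^esub>}"
  shows "f \<in> coboundaries2 G M"
proof -
  define F where "F = free2 p d"
  define E where "E = cocycle_ext G M f"
  interpret G: group G by (rule G)
  interpret M: comm_group M by (rule M)
  interpret F: group F unfolding F_def by (rule free2_group[OF p(2)])
  interpret E: group E unfolding E_def by (rule group_cocycle_ext[OF G M f])
  interpret \<pi>: group_hom F G \<pi> using \<pi> by unfold_locales (simp add: F_def)
  have E_carrier: "carrier E = carrier G \<times> carrier M" by (simp add: E_def)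
  have E_mult: "(g, a) \<otimes>\<^bsub>E\<^esub> (h, b) = (g \<otimes>\<^bsub>G\<^esub> h, a \<otimes>\<^bsub>M\<^esub> b \<otimes>\<^bsub>M\<^esub> f (g, h))" for g a h b
    by (simp add: E_def)
  have fc: "f (g, h) \<in> carrier M" if "g \<in> carrier G" "h \<in> carrier G" for g h
    using f that by (auto simp: cocycles2_def)
  interpret fst: group_hom E G fst
    by unfold_locales (auto simp: hom_def E_carrier E_mult)
  \<comment> \<open>On the abelian subgroup generated by \<open>g\<close> and \<open>h\<close> the
    cocycle is a coboundary, and coboundaries on abelian groups are symmetric.\<close>
  have f_sym: "f (g, h) = f (h, g)"
    if gh: "g \<in> carrier G" "h \<in> carrier G" "g \<otimes>\<^bsub>G\<^esub> h = h \<otimes>\<^bsub>G\<^esub> g" for g h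
  proof -
    let ?A = "generate G {g, h}"
    have "subgroup ?A G" "comm_group (G\<lparr>carrier := ?A\<rparr>)"
      using gh by (auto intro!: G.generate_is_subgroup G.comm_group_generate)
    from loc[OF this] obtain c where c: "c \<in> ?A \<rightarrow> carrier M"
      "\<forall>g\<in>?A. \<forall>h\<in>?A. f (g, h) = c g \<otimes>\<^bsub>M\<^esub> c h \<otimes>\<^bsub>M\<^esub> inv\<^bsub>M\<^esub> c (g \<otimes>\<^bsub>G\<^esub> h)" by blast
    have "g \<in> ?A" "h \<in> ?A" by (auto intro: generate.incl)
    then have "c g \<in> carrier M" "c h \<in> carrier M"
      "f (g, h) = c g \<otimes>\<^bsub>M\<^esub> c h \<otimes>\<^bsub>M\<^esub> inv\<^bsub>M\<^esub> c (g \<otimes>\<^bsub>G\<^esub> h)"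
      "f (h, g) = c h \<otimes>\<^bsub>M\<^esub> c g \<otimes>\<^bsub>M\<^esub> inv\<^bsub>M\<^esub> c (g \<otimes>\<^bsub>G\<^esub> h)" using c gh(3) by auto
    then show ?thesis using M.m_comm[of "c g" "c h"] by simp
  qed
  have E_comm: "x \<otimes>\<^bsub>E\<^esub> y = y \<otimes>\<^bsub>E\<^esub> x"
    if "x \<in> carrier E" "y \<in> carrier E" "fst x \<otimes>\<^bsub>G\<^esub> fst y = fst y \<otimes>\<^bsub>G\<^esub> fst x" for x y
    using that f_sym[of "fst x" "fst y"] by (cases x; cases y) (auto simp: E_carrier E_mult M.m_comm)
  have \<pi>_comm: "\<pi> (commutator F x y) = commutator G (\<pi> x) (\<pi> y)" if "x \<in> carrier F" "y \<in> carrier F" for x y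
    using that by (simp add: commutator_def)
  have fst_comm: "fst (commutator E x y) = commutator G (fst x) (fst y)" if "x \<in> carrier E" "y \<in> carrier E" for x y
    using that by (simp only: commutator_def fst.hom_mult fst.hom_inv E.m_closed E.inv_closed)
  have ex: "\<exists>x\<in>carrier F. g = \<pi> x" if "g \<in> carrier G" for g
    using that unfolding surj[symmetric] F_def by blast
  have G_central: "z \<otimes>\<^bsub>G\<^esub> commutator G x y = commutator G x y \<otimes>\<^bsub>G\<^esub> z"
    if xyz: "x \<in> carrier G" "y \<in> carrier G" "z \<in> carrier G" for x y z
  proof -
    obtain x' where x': "x' \<in> carrier F" "x = \<pi> x'" using ex[OF xyz(1)] by (rule bexE)
    obtain y' where y': "y' \<in> carrier F" "y = \<pi> y'" using ex[OF xyz(2)] by (rule bexE)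
    obtain z' where z': "z' \<in> carrier F" "z = \<pi> z'" using ex[OF xyz(3)] by (rule bexE)
    note c = x'(1) y'(1) z'(1) x'(2) y'(2) z'(2)
    have "commutator F x' y' \<otimes>\<^bsub>F\<^esub> z' = z' \<otimes>\<^bsub>F\<^esub> commutator F x' y'"
      using free2_class2_exponent[OF p, of d] c(1-3) unfolding class2_exponent_def F_def by blast
    then have "\<pi> (commutator F x' y' \<otimes>\<^bsub>F\<^esub> z') = \<pi> (z' \<otimes>\<^bsub>F\<^esub> commutator F x' y')" by (rule arg_cong)
    then show ?thesis
      using c by (simp only: \<pi>_comm \<pi>.hom_mult F.commutator_closed)
  qed
  \<comment> \<open>A commutator of \<open>E\<close> lies over a commutator of \<open>G\<close>,
    which is central there, and by \<open>E_comm\<close> centrality can be tested in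
    \<open>G\<close>.\<close>
  have E_central: "z \<otimes>\<^bsub>E\<^esub> commutator E x y = commutator E x y \<otimes>\<^bsub>E\<^esub> z"
    if xyz: "x \<in> carrier E" "y \<in> carrier E" "z \<in> carrier E" for x y z
    using xyz G_central[of "fst x" "fst y" "fst z"]
    by (intro E_comm E.commutator_closed) (auto simp: fst_comm)
  define T where "T = {x \<in> carrier E. x [^]\<^bsub>E\<^esub> p = \<one>\<^bsub>E\<^esub>}"
  have T: "subgroup T E" "class2_exponent p (E\<lparr>carrier := T\<rparr>)"
    using E.class2_exponent_torsion[OF p(1) E_central] by (auto simp: T_def)
  have "\<exists>y\<in>T. fst y = \<pi> (free2_gen p d i)" if i: "i < d" for i
  proof -
    define g where "g = \<pi> (free2_gen p d i)"
    have gen: "free2_gen p d i \<in> carrier F" unfolding F_def by (rule free2_gen_carrier[OF p(2) i])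
    then have g: "g \<in> carrier G" by (simp add: g_def)
    have "free2_gen p d i [^]\<^bsub>F\<^esub> p = \<one>\<^bsub>F\<^esub>"
      using free2_class2_exponent[OF p, of d] gen by (simp add: class2_exponent_def F_def)
    from arg_cong[OF this, of \<pi>] have gp: "g [^]\<^bsub>G\<^esub> p = \<one>\<^bsub>G\<^esub>" using gen by (simp add: g_def \<pi>.hom_nat_pow)
    let ?A = "generate G {g}"
    have A: "subgroup ?A G" "comm_group (G\<lparr>carrier := ?A\<rparr>)"
      using g by (auto intro!: G.generate_is_subgroup G.comm_group_generate)
    from loc[OF this] obtain c where c: "c \<in> ?A \<rightarrow> carrier M"
      "\<forall>g\<in>?A. \<forall>h\<in>?A. f (g, h) = c g \<otimes>\<^bsub>M\<^esub> c h \<otimes>\<^bsub>M\<^esub> inv\<^bsub>M\<^esub> c (g \<otimes>\<^bsub>G\<^esub> h)" by blast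
    have 1: "\<one>\<^bsub>G\<^esub> \<in> ?A" "g \<in> ?A" by (auto intro: generate.incl generate.one)
    have gn: "g [^]\<^bsub>G\<^esub> (n::nat) \<in> ?A" for n
      by (induction n) (auto intro: 1 subgroup.m_closed[OF A(1)])
    have f1: "f (\<one>\<^bsub>G\<^esub>, \<one>\<^bsub>G\<^esub>) = c \<one>\<^bsub>G\<^esub>" using c 1 by (auto simp: M.m_assoc Pi_iff)
    \<comment> \<open>On the cyclic group generated by \<open>g\<close> the cocycle is the
      coboundary of \<open>c\<close>, so \<open>x \<mapsto> (x, inv (c x))\<close> is a homomorphic
      section there. In particular this lift of \<open>g\<close> has order dividing
      \<open>p\<close>.\<close>
    have pow: "(g, inv\<^bsub>M\<^esub> c g) [^]\<^bsub>E\<^esub> n = (g [^]\<^bsub>G\<^esub> n, inv\<^bsub>M\<^esub> c (g [^]\<^bsub>G\<^esub> n))" for n :: nat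
    proof (induction n)
      case 0
      then show ?case by (simp add: f1) (simp add: E_def f1)
    next
      case (Suc n)
      define a b e where "a = c (g [^]\<^bsub>G\<^esub> n)" and "b = c g" and "e = c (g [^]\<^bsub>G\<^esub> n \<otimes>\<^bsub>G\<^esub> g)"
      have cc: "a \<in> carrier M" "b \<in> carrier M" "e \<in> carrier M"
        using c(1) gn 1 gn[of "Suc n"] by (auto simp: Pi_iff a_def b_def e_def)
      have "inv\<^bsub>M\<^esub> a \<otimes>\<^bsub>M\<^esub> inv\<^bsub>M\<^esub> b \<otimes>\<^bsub>M\<^esub> (a \<otimes>\<^bsub>M\<^esub> b \<otimes>\<^bsub>M\<^esub> inv\<^bsub>M\<^esub> e) =
         (inv\<^bsub>M\<^esub> a \<otimes>\<^bsub>M\<^esub> a) \<otimes>\<^bsub>M\<^esub> ((inv\<^bsub>M\<^esub> b \<otimes>\<^bsub>M\<^esub> b) \<otimes>\<^bsub>M\<^esub> inv\<^bsub>M\<^esub> e)"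
        using cc by (simp only: M.m_ac M.inv_closed M.m_closed)
      also have "\<dots> = inv\<^bsub>M\<^esub> e" using cc by simp
      finally show ?case using c(2) gn[of n] 1 Suc.IH by (simp add: E_mult a_def b_def e_def)
    qed
    have "(g, inv\<^bsub>M\<^esub> c g) [^]\<^bsub>E\<^esub> p = \<one>\<^bsub>E\<^esub>" by (simp add: pow gp) (simp add: E_def f1)
    moreover have "c g \<in> carrier M" using c(1) 1 by auto
    ultimately have "(g, inv\<^bsub>M\<^esub> c g) \<in> T" using g by (simp add: T_def E_carrier)
    then show ?thesis by (intro bexI[of _ "(g, inv\<^bsub>M\<^esub> c g)"]) (auto simp: g_def)
  qed
  then obtain y where y: "\<And>i. i < d \<Longrightarrow> y i \<in> T" "\<And>i. i < d \<Longrightarrow> fst (y i) = \<pi> (free2_gen p d i)" by metis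
  obtain \<phi> where \<phi>: "\<phi> \<in> hom F (E\<lparr>carrier := T\<rparr>)" "\<And>i. i < d \<Longrightarrow> \<phi> (free2_gen p d i) = y i"
    using free2_universal_aux[OF p T(2), of d y] y(1) unfolding F_def by auto
  have \<phi>E: "\<phi> \<in> hom F E" using \<phi>(1) subgroup.subset[OF T(1)] by (auto simp: hom_def)
  interpret \<phi>: group_hom F E \<phi> using \<phi>E by unfold_locales
  have fst_\<phi>: "fst (\<phi> x) = \<pi> x" if "x \<in> carrier F" for x
  proof -
    have "(fst \<circ> \<phi>) x = \<pi> x"
    proof (rule hom_eq_on_generate[where f = "fst \<circ> \<phi>" and g = \<pi> and G = F and H = G and S = "free2_gen p d ` {..<d}"])
      show "group_hom F G (fst \<circ> \<phi>)" by unfold_locales (rule hom_compose[OF \<phi>E fst.homh])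
      show "group_hom F G \<pi>" by (rule \<pi>.group_hom_axioms)
      show "x \<in> generate F (free2_gen p d ` {..<d})" using that free2_generated[OF p] by (simp add: F_def)
      show "free2_gen p d ` {..<d} \<subseteq> carrier F" using free2_gen_carrier[OF p(2)] by (auto simp: F_def)
    qed (use \<phi>(2) y(2) in auto)
    then show ?thesis by simp
  qed
  \<comment> \<open>Each generator of the kernel is a commutator of elements with commuting images
    in \<open>G\<close>. Their images under \<open>\<phi>\<close> commute by \<open>E_comm\<close>,
    so the generator is sent to the identity.\<close>
  have \<phi>_ker: "\<phi> x = \<one>\<^bsub>E\<^esub>" if x: "x \<in> carrier F" "\<pi> x = \<one>\<^bsub>G\<^esub>" for x
  proof -
    let ?S = "{commutator F y z | y z. y \<in> carrier F \<and> z \<in> carrier F \<and> \<pi> (commutator F y z) = \<one>\<^bsub>G\<^esub>}"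
    have "s \<in> kernel F E \<phi>" if s: "s \<in> ?S" for s
    proof -
      obtain y z where yz: "y \<in> carrier F" "z \<in> carrier F" "\<pi> (commutator F y z) = \<one>\<^bsub>G\<^esub>" "s = commutator F y z"
        using s by auto
      then have "commutator G (\<pi> y) (\<pi> z) = \<one>\<^bsub>G\<^esub>" by (simp add: \<pi>_comm)
      then have "\<pi> y \<otimes>\<^bsub>G\<^esub> \<pi> z = \<pi> z \<otimes>\<^bsub>G\<^esub> \<pi> y" using yz by (simp add: G.commutator_one_iff)
      then have "\<phi> y \<otimes>\<^bsub>E\<^esub> \<phi> z = \<phi> z \<otimes>\<^bsub>E\<^esub> \<phi> y" using yz by (intro E_comm) (auto simp: fst_\<phi>)
      then have "commutator E (\<phi> y) (\<phi> z) = \<one>\<^bsub>E\<^esub>" using yz by (simp add: E.commutator_one_iff)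
      then show ?thesis using yz by (simp add: kernel_def commutator_def)
    qed
    then have "generate F ?S \<subseteq> kernel F E \<phi>"
      by (intro F.generate_subgroup_incl \<phi>.subgroup_kernel) blast
    then show ?thesis using ker[folded F_def, OF x] by (auto simp: kernel_def)
  qed
  \<comment> \<open>As \<open>\<phi>\<close> is trivial on the kernel of \<open>\<pi>\<close>, the
    choice of the preimage does not matter.\<close>
  define \<sigma> where "\<sigma> g = snd (\<phi> (SOME x. x \<in> carrier F \<and> \<pi> x = g))" for g
  have \<phi>_eq: "\<phi> x = (\<pi> x, \<sigma> (\<pi> x))" if x: "x \<in> carrier F" for x
  proof -
    define x' where "x' = (SOME x'. x' \<in> carrier F \<and> \<pi> x' = \<pi> x)"
    have x': "x' \<in> carrier F \<and> \<pi> x' = \<pi> x" unfolding x'_def by (rule someI[of _ x]) (use x in auto)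
    then have "\<phi> (x' \<otimes>\<^bsub>F\<^esub> inv\<^bsub>F\<^esub> x) = \<one>\<^bsub>E\<^esub>" using x by (intro \<phi>_ker) auto
    then have "\<phi> x' \<otimes>\<^bsub>E\<^esub> inv\<^bsub>E\<^esub> \<phi> x = \<one>\<^bsub>E\<^esub>" using x x' by (simp add: \<phi>.hom_inv)
    have cl: "\<phi> x \<in> carrier E" "\<phi> x' \<in> carrier E" "inv\<^bsub>E\<^esub> \<phi> x \<in> carrier E" using x x' by simp_all
    have "\<phi> x' \<otimes>\<^bsub>E\<^esub> inv\<^bsub>E\<^esub> \<phi> x = \<phi> x \<otimes>\<^bsub>E\<^esub> inv\<^bsub>E\<^esub> \<phi> x"
      unfolding \<open>\<phi> x' \<otimes>\<^bsub>E\<^esub> inv\<^bsub>E\<^esub> \<phi> x = \<one>\<^bsub>E\<^esub>\<close> E.r_inv[OF cl(1)] by (rule refl)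
    then have "\<phi> x' = \<phi> x" using E.right_cancel[OF cl(3,2,1)] by blast
    then have "snd (\<phi> x) = \<sigma> (\<pi> x)" by (simp add: \<sigma>_def x'_def)
    then show ?thesis using fst_\<phi>[OF x] by (metis prod.collapse)
  qed
  have \<sigma>: "\<sigma> g \<in> carrier M" if g: "g \<in> carrier G" for g
  proof -
    obtain x where x: "x \<in> carrier F" "g = \<pi> x" using ex[OF g] by (rule bexE)
    have "(\<pi> x, \<sigma> (\<pi> x)) \<in> carrier E" using \<phi>.hom_closed[OF x(1)] unfolding \<phi>_eq[OF x(1)] .
    then show ?thesis using x(2) by (simp add: E_carrier)
  qed
  \<comment> \<open>Multiplicativity of \<open>\<phi>\<close> says that \<open>\<sigma>\<close>
    fails to be a homomorphism by \<open>f\<close>; hence \<open>f\<close> is the coboundary of the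
    inverse of \<open>\<sigma>\<close>.\<close>
  have f_eq: "f (g, h) = inv\<^bsub>M\<^esub> \<sigma> g \<otimes>\<^bsub>M\<^esub> inv\<^bsub>M\<^esub> \<sigma> h \<otimes>\<^bsub>M\<^esub> inv\<^bsub>M\<^esub> (inv\<^bsub>M\<^esub> \<sigma> (g \<otimes>\<^bsub>G\<^esub> h))"
    if gh: "g \<in> carrier G" "h \<in> carrier G" for g h
  proof -
    obtain x where x: "x \<in> carrier F" "g = \<pi> x" using ex[OF gh(1)] by (rule bexE)
    obtain y where y: "y \<in> carrier F" "h = \<pi> y" using ex[OF gh(2)] by (rule bexE)
    have "\<phi> (x \<otimes>\<^bsub>F\<^esub> y) = \<phi> x \<otimes>\<^bsub>E\<^esub> \<phi> y" using x y by simp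
    then have s: "\<sigma> (g \<otimes>\<^bsub>G\<^esub> h) = \<sigma> g \<otimes>\<^bsub>M\<^esub> \<sigma> h \<otimes>\<^bsub>M\<^esub> f (g, h)"
      unfolding \<phi>_eq[OF x(1)] \<phi>_eq[OF y(1)] \<phi>_eq[OF F.m_closed[OF x(1) y(1)]] E_mult \<pi>.hom_mult[OF x(1) y(1)] x(2) y(2)
      by (simp only: prod.inject)
    have c: "\<sigma> g \<in> carrier M" "\<sigma> h \<in> carrier M" "f (g, h) \<in> carrier M" using gh \<sigma> fc by auto
    have "inv\<^bsub>M\<^esub> \<sigma> g \<otimes>\<^bsub>M\<^esub> inv\<^bsub>M\<^esub> \<sigma> h \<otimes>\<^bsub>M\<^esub> (\<sigma> g \<otimes>\<^bsub>M\<^esub> \<sigma> h \<otimes>\<^bsub>M\<^esub> f (g, h))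
      = (inv\<^bsub>M\<^esub> \<sigma> g \<otimes>\<^bsub>M\<^esub> \<sigma> g) \<otimes>\<^bsub>M\<^esub> ((inv\<^bsub>M\<^esub> \<sigma> h \<otimes>\<^bsub>M\<^esub> \<sigma> h) \<otimes>\<^bsub>M\<^esub> f (g, h))"
      using c by (simp only: M.m_ac M.inv_closed M.m_closed)
    also have "\<dots> = f (g, h)" using c by simp
    finally show ?thesis using c by (simp add: s)
  qed
  have "f = (\<lambda>(g, h)\<in>carrier G \<times> carrier G. inv\<^bsub>M\<^esub> \<sigma> g \<otimes>\<^bsub>M\<^esub> inv\<^bsub>M\<^esub> \<sigma> h \<otimes>\<^bsub>M\<^esub> inv\<^bsub>M\<^esub> (inv\<^bsub>M\<^esub> \<sigma> (g \<otimes>\<^bsub>G\<^esub> h)))"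
  proof (rule extensionalityI[of _ "carrier G \<times> carrier G"])
    show "f \<in> extensional (carrier G \<times> carrier G)" using f by (simp add: cocycles2_def PiE_iff)
  qed (auto simp: f_eq)
  then show ?thesis unfolding coboundaries2_def using \<sigma>
    by (auto intro!: exI[of _ "\<lambda>g. inv\<^bsub>M\<^esub> \<sigma> g"])
qed

text \<open>A class in the multiplier is represented by a cocycle whose restriction to every abelian
  subgroup is a coboundary, and \<open>locally_trivial_coboundary\<close> makes the cocycle itself
  one.\<close>

lemma bogomolov_trivialI:
  assumes p: "odd p" "p > 1" and G: "group G"
    and \<pi>: "\<pi> \<in> hom (free2 p d) G" and surj: "\<pi> ` carrier (free2 p d) = carrier G"
    and ker: "\<And>x. x \<in> carrier (free2 p d) \<Longrightarrow> \<pi> x = \<one>\<^bsub>G\<^esub> \<Longrightarrow>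
      x \<in> generate (free2 p d) {commutator (free2 p d) y z | y z. y \<in> carrier (free2 p d) \<and>
        z \<in> carrier (free2 p d) \<and> \<pi> (commutator (free2 p d) y z) = \<one>\<^bsub>G\<^esub>}"
  shows "trivial_group (bogomolov_multiplier G)"
proof -
  note M = comm_group_QmodZ
  interpret Z: comm_group "Z2 G QmodZ" by (rule comm_group_Z2[OF G M])
  have one: "\<one>\<^bsub>H2 G' QmodZ\<^esub> = coboundaries2 G' QmodZ" for G' :: "('a, 'b) monoid_scheme"
    by (simp add: H2_def FactGroup_def)
  have "\<xi> = \<one>\<^bsub>H2 G QmodZ\<^esub>" if \<xi>: "\<xi> \<in> carrier (bogomolov_multiplier G)" for \<xi>
  proof -
    have H: "\<xi> \<in> carrier (H2 G QmodZ)" and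
      res: "\<And>A. subgroup A G \<Longrightarrow> comm_group (G\<lparr>carrier := A\<rparr>) \<Longrightarrow>
        res2 G QmodZ A \<xi> = \<one>\<^bsub>H2 (G\<lparr>carrier := A\<rparr>) QmodZ\<^esub>"
      using \<xi> by (auto simp: bogomolov_multiplier_def)
    obtain f where f: "f \<in> cocycles2 G QmodZ" "\<xi> = coboundaries2 G QmodZ #>\<^bsub>Z2 G QmodZ\<^esub> f"
      using H by (auto simp: H2_def carrier_FactGroup Z2_def)
    have "f \<in> coboundaries2 G QmodZ"
    proof (rule locally_trivial_coboundary[OF p G M f(1) \<pi> surj _ ker])
      fix A assume A: "subgroup A G" "comm_group (G\<lparr>carrier := A\<rparr>)"
      let ?A = "G\<lparr>carrier := A\<rparr>"
      have GA: "group ?A" by (rule subgroup.subgroup_is_group[OF A(1) G])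
      interpret ZA: comm_group "Z2 ?A QmodZ" by (rule comm_group_Z2[OF GA M])
      have "coboundaries2 ?A QmodZ #>\<^bsub>Z2 ?A QmodZ\<^esub> restrict f (A \<times> A) = coboundaries2 ?A QmodZ"
        using res[OF A] res2_coset[OF G M A(1) f(1)] by (simp add: f(2) one)
      moreover have "restrict f (A \<times> A) \<in> carrier (Z2 ?A QmodZ)"
        using f(1) subgroup.subset[OF A(1)] subgroup.m_closed[OF A(1)]
        by (auto simp: Z2_def cocycles2_def subset_iff)
      ultimately have "restrict f (A \<times> A) \<in> coboundaries2 ?A QmodZ"
        by (rule ZA.coset_join1[OF _ _ subgroup_coboundaries2[OF GA M]])
      then obtain c where c: "c \<in> A \<rightarrow> carrier QmodZ"
        "restrict f (A \<times> A) = (\<lambda>(g, h)\<in>A \<times> A. c g \<otimes>\<^bsub>QmodZ\<^esub> c h \<otimes>\<^bsub>QmodZ\<^esub> inv\<^bsub>QmodZ\<^esub> c (g \<otimes>\<^bsub>G\<^esub> h))"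
        by (auto simp: coboundaries2_def)
      have "f (g, h) = c g \<otimes>\<^bsub>QmodZ\<^esub> c h \<otimes>\<^bsub>QmodZ\<^esub> inv\<^bsub>QmodZ\<^esub> c (g \<otimes>\<^bsub>G\<^esub> h)" if "g \<in> A" "h \<in> A" for g h
        using fun_cong[OF c(2), of "(g, h)"] that by simp
      then show "\<exists>c\<in>A \<rightarrow> carrier QmodZ. \<forall>g\<in>A. \<forall>h\<in>A. f (g, h) = c g \<otimes>\<^bsub>QmodZ\<^esub> c h \<otimes>\<^bsub>QmodZ\<^esub> inv\<^bsub>QmodZ\<^esub> c (g \<otimes>\<^bsub>G\<^esub> h)"
        using c(1) by blast
    qed
    then have "\<xi> = coboundaries2 G QmodZ"
      using subgroup_coboundaries2[OF G M] f by (simp add: subgroup.rcos_const[OF _ Z.is_group])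
    then show ?thesis by (simp add: one)
  qed
  moreover have "group (bogomolov_multiplier G)" by (rule group_bogomolov_multiplier[OF G])
  moreover have "\<one>\<^bsub>bogomolov_multiplier G\<^esub> = \<one>\<^bsub>H2 G QmodZ\<^esub>" by (simp add: bogomolov_multiplier_def)
  ultimately show ?thesis unfolding trivial_group_def
    using monoid.one_closed[OF group.is_monoid[OF \<open>group (bogomolov_multiplier G)\<close>]] by auto
qed

text \<open>The kernel of the quotient map is the copy of \<open>L\<close> in
  \<open>free2 p d\<close>, and a wedge of \<open>v\<close> and \<open>w\<close> is the commutator
  of their lifts with zero second component. So \<open>gen\<close> supplies the kernel condition of
  \<open>bogomolov_trivialI\<close>.\<close>

lemma bogomolov_GL_trivial:
  assumes p: "odd p" "p > 1" and L: "L \<in> Gr p d r"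
    and gen: "\<And>a. a \<in> L \<Longrightarrow> (\<zero>\<^bsub>Vspace p d\<^esub>, a) \<in> generate (free2 p d)
      {(\<zero>\<^bsub>Vspace p d\<^esub>, wedge p d v w) | v w. v \<in> carrier (Vspace p d) \<and> w \<in> carrier (Vspace p d) \<and> wedge p d v w \<in> L}"
  shows "trivial_group (bogomolov_multiplier (GL p d L))"
proof -
  let ?N = "{\<zero>\<^bsub>Vspace p d\<^esub>} \<times> L" and ?F = "free2 p d"
  interpret N: normal ?N ?F using central_normal[OF p] L by (simp add: Gr_def)
  show ?thesis
  proof (rule bogomolov_trivialI[OF p group_GL[OF p L], where \<pi> = "\<lambda>x. ?N #>\<^bsub>?F\<^esub> x"])
    show "(\<lambda>x. ?N #>\<^bsub>?F\<^esub> x) \<in> hom ?F (GL p d L)"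
      unfolding GL_def by (rule N.r_coset_hom_Mod)
    show "(\<lambda>x. ?N #>\<^bsub>?F\<^esub> x) ` carrier ?F = carrier (GL p d L)"
      by (simp add: GL_def carrier_FactGroup)
  next
    fix x assume x: "x \<in> carrier ?F" "?N #>\<^bsub>?F\<^esub> x = \<one>\<^bsub>GL p d L\<^esub>"
    then have "x \<in> ?N" using N.coset_join1[OF _ x(1) N.subgroup_axioms] by (simp add: GL_def FactGroup_def)
    then obtain a where a: "a \<in> L" "x = (\<zero>\<^bsub>Vspace p d\<^esub>, a)" by auto
    have "{(\<zero>\<^bsub>Vspace p d\<^esub>, wedge p d v w) | v w. v \<in> carrier (Vspace p d) \<and> w \<in> carrier (Vspace p d) \<and> wedge p d v w \<in> L}
      \<subseteq> {commutator ?F y z | y z. y \<in> carrier ?F \<and> z \<in> carrier ?F \<and> ?N #>\<^bsub>?F\<^esub> commutator ?F y z = \<one>\<^bsub>GL p d L\<^esub>}"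
    proof clarify
      fix v w assume vw: "v \<in> carrier (Vspace p d)" "w \<in> carrier (Vspace p d)" "wedge p d v w \<in> L"
      have c: "(v, \<zero>\<^bsub>Wspace p d\<^esub>) \<in> carrier ?F" "(w, \<zero>\<^bsub>Wspace p d\<^esub>) \<in> carrier ?F"
        using vw p(2) by (auto simp: free2_def Wspace_simps)
      have e: "(\<zero>\<^bsub>Vspace p d\<^esub>, wedge p d v w) = commutator ?F (v, \<zero>\<^bsub>Wspace p d\<^esub>) (w, \<zero>\<^bsub>Wspace p d\<^esub>)"
        by (rule free2_commutator[OF p c, symmetric])
      have "?N #>\<^bsub>?F\<^esub> (\<zero>\<^bsub>Vspace p d\<^esub>, wedge p d v w) = \<one>\<^bsub>GL p d L\<^esub>"
        using vw(3) by (simp add: GL_def FactGroup_def N.rcos_const)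
      then show "\<exists>y z. (\<zero>\<^bsub>Vspace p d\<^esub>, wedge p d v w) = commutator ?F y z \<and> y \<in> carrier ?F \<and> z \<in> carrier ?F \<and>
         ?N #>\<^bsub>?F\<^esub> commutator ?F y z = \<one>\<^bsub>GL p d L\<^esub>"
        using c e by metis
    qed
    from N.mono_generate[OF this] gen[OF a(1)] a(2)
    show "x \<in> generate ?F {commutator ?F y z | y z. y \<in> carrier ?F \<and> z \<in> carrier ?F \<and> ?N #>\<^bsub>?F\<^esub> commutator ?F y z = \<one>\<^bsub>GL p d L\<^esub>}"
      by blast
  qed
qed

section \<open>The lower limit\<close>

lemma catalan_Suc: "catalan (Suc m) = catalan m * (4 * real m + 2) / (real m + 2)"
proof -
  define A B E where "A = Suc (2 * m + 1) choose Suc m" and "B = 2 * m + 1 choose m" and "E = 2 * m choose m"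
  have "Suc (2 * m + 1) * B = A * Suc m" unfolding A_def B_def by (rule Suc_times_binomial_eq)
  then have "A * Suc m = 2 * B * Suc m" by (simp add: algebra_simps)
  then have A: "A = 2 * B" by (simp only: mult_cancel2) simp
  have "B = 2 * m + 1 choose Suc m" using binomial_symmetric[of m "2 * m + 1"] by (simp add: B_def)
  then have "Suc (2 * m) * E = B * Suc m" unfolding E_def using Suc_times_binomial_eq[of "2 * m" m] by simp
  then have "real (Suc (2 * m) * E) = real (B * Suc m)" by (rule arg_cong)
  then have "real A = (4 * real m + 2) * real E / (real m + 1)" unfolding A by (simp add: field_simps)
  moreover have "catalan (Suc m) = real A / (real m + 2)" "catalan m = real E / (real m + 1)"
    by (simp_all add: catalan_def A_def E_def del: binomial_Suc_Suc)
  ultimately show ?thesis by simp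
qed

lemma catalan_ge_1: "catalan m \<ge> 1"
proof (induction m)
  case 0
  then show ?case by (simp add: catalan_def)
next
  case (Suc m)
  have "1 * 1 \<le> catalan m * ((4 * real m + 2) / (real m + 2))"
    using Suc by (intro mult_mono) (auto simp: field_simps)
  then show ?case by (simp add: catalan_Suc)
qed

lemma catalan_2: "catalan 2 = 2"
  by (simp add: catalan_def choose_two)

text \<open>The ratio of consecutive Catalan numbers is at least 2 from index 1 on, while the
  right-hand side at most doubles; for \<open>m = 3\<close> both sides are 5. With
  \<open>m = d - 2\<close> the right-hand side is \<open>c + 1\<close>, the constant that arises for
  \<open>r = c\<close>.\<close>

lemma catalan_ge_choose_two:
  assumes "m \<ge> 3"
  shows "catalan m \<ge> real (m choose 2) + 2"
  using assms
proof (induction m rule: dec_induct)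
  case base
  have "catalan (Suc 2) = 5" unfolding catalan_Suc catalan_2 by simp
  then show ?case by (simp add: choose_two)
next
  case (step m)
  have "m \<le> (m choose 2) + 2"
  proof -
    have "m * 2 \<le> m * (m - 1)" using step.hyps by (intro mult_left_mono) auto
    then show ?thesis using twice_choose_two[of m] by linarith
  qed
  moreover have "Suc m choose 2 = (m choose 2) + m" by (simp add: numeral_2_eq_2)
  ultimately have "real (Suc m choose 2) + 2 \<le> (real (m choose 2) + 2) * 2" by simp
  also have "\<dots> \<le> catalan m * ((4 * real m + 2) / (real m + 2))"
    using step by (intro mult_mono) (auto simp: field_simps)
  finally show ?case by (simp add: catalan_Suc)
qed

text \<open>\<open>card_wedge_spans\<close> bounds the good subspaces from below and
  \<open>card_Gr_le\<close> bounds all of them from above. In the quotient the powers of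
  \<open>p\<close> cancel by the choice of \<open>e\<close>, and what is left tends to
  \<open>(1 / k) ^ r\<close>.\<close>

lemma good_ratio_lower_bound:
  fixes k D :: real
  assumes p: "prime p" "p > 2" and r: "r \<ge> 1" and e: "2 * d + r = e + (d choose 2)"
    and S: "S \<subseteq> indep_lists p d r" and k: "k > 0" "D \<ge> 0"
    and cS: "(real p ^ (2 * d) * (1 - 2 / real p)) ^ r \<le> real (card S)"
    and hS: "(\<Sum>ps\<in>S. real (card (hits p d (wedge_span p d ps)))) \<le> real p ^ (2 * d * r) * real p ^ e * (k + D / real p)"
  shows "((1 - 2 / real p) ^ Suc r * (1 - 1 / real p) / (k + D / real p)) ^ r
    \<le> real (card {L \<in> Gr p d r. trivial_group (bogomolov_multiplier (GL p d L))}) / real (card (Gr p d r))"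
proof -
  have odd: "odd p" "p > 1" using p prime_odd_nat by auto
  have p0: "p > 0" using p by simp
  define P where "P = real p"
  have P: "P > 2" using p by (simp add: P_def)
  define \<G> where "\<G> = {L \<in> Gr p d r. trivial_group (bogomolov_multiplier (GL p d L))}"
  \<comment> \<open>\<open>X ^ r\<close> is the lower bound for \<open>card S\<close>,
    \<open>Y\<close> the upper bound for the sum of the hits, and \<open>Z\<close> a lower bound for
    every factor \<open>P ^ r - P ^ i\<close> in \<open>card_Gr_le\<close>.\<close>
  define X where "X = P ^ (2 * d) * (1 - 2 / P)"
  define Y where "Y = P ^ (2 * d * r) * P ^ e * (k + D / P)"
  define Z where "Z = P ^ r * (1 - 1 / P)"
  have pos: "X > 0" "Y > 0" "Z > 0" using P k by (auto simp: X_def Y_def Z_def intro!: mult_pos_pos add_pos_nonneg)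
  have S': "S \<subseteq> pair_lists p d r" using S by (auto simp: indep_lists_def)
  have "real (card S) > 0" using cS pos(1) by (smt (verit) P_def X_def zero_less_power)
  then have S0: "S \<noteq> {}" by auto
  have ind: "wedge_indep p d ps" if "ps \<in> S" for ps using that S by (auto simp: indep_lists_def)
  have fin: "finite (Gr p d r)" by (rule finite_Gr[OF p(1)])
  have sub: "wedge_span p d ` S \<subseteq> \<G>"
  proof
    fix L assume "L \<in> wedge_span p d ` S"
    then obtain ps where ps: "ps \<in> S" "L = wedge_span p d ps" by auto
    then have psl: "ps \<in> pair_lists p d r" using S' by blast
    then have L: "L \<in> Gr p d r"
      unfolding ps(2) by (intro wedge_span_Gr[OF p(1) ind[OF ps(1)]]) (simp add: pair_lists_def)
    have "trivial_group (bogomolov_multiplier (GL p d L))"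
      by (rule bogomolov_GL_trivial[OF odd L])
        (use wedge_span_generated[OF odd(2) psl] ps(2) in blast)
    then show "L \<in> \<G>" using L by (simp add: \<G>_def)
  qed
  have finG: "finite \<G>" using fin by (simp add: \<G>_def)
  have "X ^ (r * Suc r) \<le> real (card S) ^ Suc r"
    unfolding power_mult using cS pos(1) by (intro power_mono) (auto simp: X_def P_def)
  also have "\<dots> \<le> real (card (wedge_span p d ` S)) * (\<Sum>ps\<in>S. real (card (hits p d (wedge_span p d ps)))) ^ r"
    by (rule card_wedge_spans[OF p0 r S' S0 ind])
  also have "\<dots> \<le> real (card \<G>) * Y ^ r"
    using hS card_mono[OF finG sub] by (intro mult_mono power_mono) (auto simp: Y_def P_def intro!: zero_le_power sum_nonneg)
  finally have 1: "X ^ (r * Suc r) \<le> real (card \<G>) * Y ^ r" .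
  have "Z ^ r = (\<Prod>i<r. Z)" by simp
  also have "\<dots> \<le> (\<Prod>i<r. P ^ r - P ^ i)"
  proof (rule prod_mono, safe)
    fix i assume "i < r"
    then have "P ^ i \<le> P ^ (r - 1)" using P by (intro power_increasing) auto
    also have "P ^ (r - 1) = P ^ r / P" using P r by (simp add: power_diff)
    finally show "Z \<le> P ^ r - P ^ i" by (simp add: Z_def algebra_simps)
  qed (use pos(3) in simp)
  finally have "real (card (Gr p d r)) * Z ^ r \<le> real (card (Gr p d r)) * (\<Prod>i<r. P ^ r - P ^ i)"
    by (rule mult_left_mono) simp
  also have "\<dots> \<le> P ^ ((d choose 2) * r)"
    using card_Gr_le[OF p(1), of d r] by (simp add: P_def card_pairs)
  finally have 2: "real (card (Gr p d r)) * Z ^ r \<le> (P ^ (d choose 2)) ^ r" by (simp add: power_mult)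
  have "wedge_span p d ` S \<noteq> {}" using S0 by simp
  then have "\<G> \<noteq> {}" using sub by blast
  then have "Gr p d r \<noteq> {}" by (auto simp: \<G>_def)
  then have G0: "real (card (Gr p d r)) > 0" using fin by (simp add: card_gt_0_iff)
  \<comment> \<open>The quotient is the \<open>r\<close>-th root of the final bound; assumption
    \<open>e\<close> makes its total exponent of \<open>P\<close> zero.\<close>
  have "(1 - 2 / P) ^ Suc r * (1 - 1 / P) / (k + D / P) = X ^ Suc r * Z / (Y * P ^ (d choose 2))"
  proof -
    have kD: "k + D / P > 0" using k P by (intro add_pos_nonneg) auto
    have "P ^ (2 * d * Suc r) * P ^ r = P ^ (2 * d * r) * P ^ (2 * d + r)"
      by (simp add: power_add)
    also have "\<dots> = P ^ (2 * d * r) * P ^ e * P ^ (d choose 2)" by (simp add: e power_add)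
    finally have eq: "P ^ (2 * d * Suc r) * P ^ r = P ^ (2 * d * r) * P ^ e * P ^ (d choose 2)" .
    have "X ^ Suc r * Z = (P ^ (2 * d * Suc r) * P ^ r) * ((1 - 2 / P) ^ Suc r * (1 - 1 / P))"
      unfolding X_def Z_def power_mult_distrib power_mult by (simp only: ac_simps)
    then have "X ^ Suc r * Z / (Y * P ^ (d choose 2))
      = (P ^ (2 * d * r) * P ^ e * P ^ (d choose 2)) * ((1 - 2 / P) ^ Suc r * (1 - 1 / P))
        / ((P ^ (2 * d * r) * P ^ e * P ^ (d choose 2)) * (k + D / P))"
      unfolding eq Y_def by (simp only: ac_simps)
    also have "\<dots> = (1 - 2 / P) ^ Suc r * (1 - 1 / P) / (k + D / P)"
      using P by (intro mult_divide_mult_cancel_left) auto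
    finally show ?thesis by simp
  qed
  then have "((1 - 2 / P) ^ Suc r * (1 - 1 / P) / (k + D / P)) ^ r
     = X ^ (r * Suc r) * Z ^ r / (Y ^ r * (P ^ (d choose 2)) ^ r)"
    by (simp add: power_divide power_mult_distrib power_mult[symmetric] mult.commute del: power_Suc)
  also have "\<dots> \<le> (real (card \<G>) * Y ^ r) * Z ^ r / (Y ^ r * (P ^ (d choose 2)) ^ r)"
    using 1 pos P by (intro divide_right_mono mult_right_mono) auto
  also have "\<dots> = real (card \<G>) * (Z ^ r / (P ^ (d choose 2)) ^ r)" using pos by simp
  also have "\<dots> \<le> real (card \<G>) * (1 / real (card (Gr p d r)))"
    using 2 G0 P by (intro mult_left_mono) (auto simp: field_simps)
  finally show ?thesis by (simp add: \<G>_def P_def)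
qed

text \<open>The explicit bounds converge to \<open>(1 / k) ^ r\<close> along all natural numbers,
  hence along the odd primes.\<close>

lemma liminf_lower_bound:
  fixes k D c :: real
  assumes k: "k \<ge> 1" "k \<le> c"
    and f: "\<And>p. prime p \<Longrightarrow> p > 2 \<Longrightarrow>
      ((1 - 2 / real p) ^ Suc r * (1 - 1 / real p) / (k + D / real p)) ^ r \<le> f p"
  shows "ereal ((1 / c) ^ r) \<le> Liminf (inf at_top (principal {p :: nat. prime p \<and> p > 2})) (\<lambda>p. ereal (f p))"
proof -
  let ?F = "inf at_top (principal {p :: nat. prime p \<and> p > 2})"
  let ?g = "\<lambda>p::nat. ((1 - 2 / real p) ^ Suc r * (1 - 1 / real p) / (k + D / real p)) ^ r"
  have "?g \<longlonglongrightarrow> ((1 - 0) ^ Suc r * (1 - 0) / (k + 0)) ^ r"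
    using k by (intro tendsto_intros lim_const_over_n) auto
  then have "?g \<longlonglongrightarrow> (1 / k) ^ r" by simp
  then have lim: "(?g \<longlongrightarrow> (1 / k) ^ r) ?F" by (rule tendsto_mono[rotated]) simp
  have "(1 / c) ^ r \<le> (1 / k) ^ r" using k by (intro power_mono) (auto simp: field_simps)
  show ?thesis unfolding le_Liminf_iff
  proof safe
    fix y :: ereal assume y: "y < ereal ((1 / c) ^ r)"
    show "\<forall>\<^sub>F p in ?F. y < ereal (f p)"
    proof (cases y)
      case (real z)
      then have "z < (1 / k) ^ r" using y \<open>(1 / c) ^ r \<le> (1 / k) ^ r\<close> by simp
      then have 1: "\<forall>\<^sub>F p in ?F. z < ?g p" by (rule order_tendstoD(1)[OF lim])
      have 2: "\<forall>\<^sub>F p in ?F. prime p \<and> p > 2" by (simp add: eventually_inf_principal)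
      show ?thesis
      proof (rule eventually_mono[OF eventually_conj[OF 1 2]])
        fix p assume *: "z < ?g p \<and> prime p \<and> p > 2"
        then have "?g p \<le> f p" by (intro f) auto
        with conjunct1[OF *] have "z < f p" by (rule less_le_trans)
        then show "y < ereal (f p)" by (simp add: real)
      qed
    qed (use y in auto)
  qed
qed

text \<open>The relation \<open>n + 4 = 2 d + c\<close> of the outline, which gives the second term
  of \<open>E X\<close> the exponent \<open>r - c + 4\<close>.\<close>

lemma choose_two_diff_two: "d \<ge> 2 \<Longrightarrow> (d choose 2) + 4 = 2 * d + (((d - 2) choose 2) + 1)"
proof -
  assume "d \<ge> 2"
  then obtain m where d: "d = m + 2" by (metis le_add_diff_inverse2)
  have "(m + 2) choose 2 = (m choose 2) + 2 * m + 1" by (simp add: numeral_2_eq_2)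
  then show ?thesis by (simp add: d)
qed

lemma sum_hits_no_support2:
  assumes p: "prime p" and S: "S \<subseteq> pair_lists p d r" and h2: "\<And>ps. ps \<in> S \<Longrightarrow> hits2 p d ps = {}"
  shows "(\<Sum>ps\<in>S. real (card (hits p d (wedge_span p d ps)))) \<le> real p ^ (2 * d * r) * (real r * real p ^ 4)"
proof -
  have "(\<Sum>ps\<in>S. real (card (hits p d (wedge_span p d ps)))) \<le> (\<Sum>ps\<in>S. real r * real p ^ 4)"
  proof (rule sum_mono)
    fix ps assume ps: "ps \<in> S"
    then have "real (card (hits p d (wedge_span p d ps))) \<le> real (r * p ^ 4 + card (hits2 p d ps))"
      using S by (intro of_nat_mono card_hits_le[OF p]) blast
    then show "real (card (hits p d (wedge_span p d ps))) \<le> real r * real p ^ 4" using h2[OF ps] by simp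
  qed
  also have "\<dots> \<le> real (card (pair_lists p d r)) * (real r * real p ^ 4)"
    using card_mono[OF finite_pair_lists S] by (simp add: mult_right_mono)
  finally show ?thesis by (simp add: card_pair_lists)
qed

text \<open>The three summands come from coefficient lists with one nonzero entry, from the main
  term of \<open>card_relations\<close> for the at most \<open>p ^ r\<close> remaining lists, and
  from its error terms.\<close>

lemma sum_hits:
  assumes p: "prime p" and S: "S \<subseteq> pair_lists p d r"
  shows "(\<Sum>ps\<in>S. real (card (hits p d (wedge_span p d ps)))) \<le> real p ^ (2 * d * r) *
    (real r * real p ^ 4 + real p ^ (r + 2 * d) / real p ^ (d choose 2) + real d * 2 ^ (2 * r + 1) * real p ^ 3)"
proof -
  have p0: "p > 0" using prime_gt_0_nat[OF p] .
  have "(\<Sum>ps\<in>S. real (card (hits p d (wedge_span p d ps))))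
      \<le> (\<Sum>ps\<in>pair_lists p d r. real (card (hits p d (wedge_span p d ps))))"
    by (rule sum_mono2[OF finite_pair_lists S]) simp
  also have "\<dots> \<le> (\<Sum>ps\<in>pair_lists p d r. real r * real p ^ 4 + real (card (hits2 p d ps)))"
  proof (rule sum_mono)
    fix ps assume "ps \<in> pair_lists p d r"
    from of_nat_mono[OF card_hits_le[OF p this], where 'a = real]
    show "real (card (hits p d (wedge_span p d ps))) \<le> real r * real p ^ 4 + real (card (hits2 p d ps))" by simp
  qed
  also have "\<dots> = real p ^ (2 * d * r) * (real r * real p ^ 4) + (\<Sum>ps\<in>pair_lists p d r. real (card (hits2 p d ps)))"
    by (simp add: sum.distrib card_pair_lists)
  also have "\<dots> \<le> real p ^ (2 * d * r) * (real r * real p ^ 4) + real p ^ (2 * d * r) *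
     (real (card (support2 p r)) * real p ^ (2 * d) / real p ^ (d choose 2) + real d * 2 ^ (2 * r + 1) * real p ^ 3)"
    by (intro add_left_mono sum_hits2[OF p])
  also have "\<dots> \<le> real p ^ (2 * d * r) * (real r * real p ^ 4) + real p ^ (2 * d * r) *
     (real (p ^ r) * real p ^ (2 * d) / real p ^ (d choose 2) + real d * 2 ^ (2 * r + 1) * real p ^ 3)"
  proof -
    have "card (support2 p r) \<le> p ^ r"
      unfolding card_coeffs[symmetric] by (rule card_mono) (auto simp: support2_def)
    then have "real (card (support2 p r)) \<le> real (p ^ r)" by (rule of_nat_mono)
    then show ?thesis by (intro add_left_mono mult_left_mono add_right_mono divide_right_mono mult_right_mono) auto
  qed
  also have "\<dots> = real p ^ (2 * d * r) * (real r * real p ^ 4 + real p ^ (r + 2 * d) / real p ^ (d choose 2)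
      + real d * 2 ^ (2 * r + 1) * real p ^ 3)"
    by (simp add: power_add algebra_simps)
  finally show ?thesis .
qed

theorem mainTheorem3:
  fixes d r :: nat
  assumes "d \<ge> 2"
    and "1 \<le> r" and "r \<le> d choose 2"
    and "r \<ge> ((d - 2) choose 2) + 1"
  shows "Liminf (inf at_top (principal {p :: nat. prime p \<and> p > 2}))
      (\<lambda>p. ereal (real (card {L \<in> Gr p d r. trivial_group (bogomolov_multiplier (GL p d L))})
             / real (card (Gr p d r))))
    \<ge> ereal ((1 / catalan (d - 2)) ^ r)"
proof -
  define c where "c = ((d - 2) choose 2) + 1"
  define e where "e = 4 + (r - c)"
  have cr: "c \<le> r" using assms(4) by (simp add: c_def)
  have e: "2 * d + r = e + (d choose 2)"
    using choose_two_diff_two[OF assms(1)] cr unfolding e_def c_def by linarith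
  \<comment> \<open>Here \<open>k\<close> bounds the leading coefficient of the average number of
    hits in units of \<open>p ^ e\<close>, and \<open>D\<close> absorbs the lower-order terms
    uniformly in \<open>p\<close>.\<close>
  have "\<exists>k D. 1 \<le> k \<and> k \<le> catalan (d - 2) \<and> D \<ge> 0 \<and> (\<forall>p. prime p \<and> p > 2 \<longrightarrow>
     (\<exists>S\<subseteq>indep_lists p d r. (real p ^ (2 * d) * (1 - 2 / real p)) ^ r \<le> real (card S) \<and>
       (\<Sum>ps\<in>S. real (card (hits p d (wedge_span p d ps)))) \<le> real p ^ (2 * d * r) * real p ^ e * (k + D / real p)))"
  proof -
    consider (one) "r = 1" | (klein) "d = 4" "r = 2" | (generic) "r \<noteq> 1" "\<not> (d = 4 \<and> r = 2)" by blast
    then show ?thesis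
    proof cases
      case one
      then have e4: "e = 4" using cr by (simp add: e_def c_def)
      have "hits2 p d ps = {}" if "ps \<in> indep_lists p d 1" for p ps
      proof -
        \<comment> \<open>A single coefficient cannot have two nonzero entries, so only the term
          \<open>r * p ^ 4\<close> with \<open>r = 1\<close> remains and
          \<open>k = 1\<close>.\<close>
        have "support2 p 1 = {}"
          by (auto simp: support2_def coeffs_def nonzero_count_def length_Suc_conv split: if_splits)
        then show ?thesis using that by (auto simp: hits2_def indep_lists_def pair_lists_def)
      qed
      then have "(\<Sum>ps\<in>indep_lists p d r. real (card (hits p d (wedge_span p d ps))))
          \<le> real p ^ (2 * d * r) * (real r * real p ^ 4)" if "prime p" for p
        using one that by (intro sum_hits_no_support2) (auto simp: indep_lists_def)
      note hits_sum = this
      show ?thesis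
      proof (rule exI[of _ 1], rule exI[of _ 0], intro conjI allI impI)
        show "1 \<le> catalan (d - 2)" by (rule catalan_ge_1)
        fix p :: nat assume p: "prime p \<and> p > 2"
        show "\<exists>S\<subseteq>indep_lists p d r. (real p ^ (2 * d) * (1 - 2 / real p)) ^ r \<le> real (card S) \<and>
          (\<Sum>ps\<in>S. real (card (hits p d (wedge_span p d ps)))) \<le> real p ^ (2 * d * r) * real p ^ e * (1 + 0 / real p)"
        proof (intro exI[of _ "indep_lists p d r"] conjI order.refl)
          show "(real p ^ (2 * d) * (1 - 2 / real p)) ^ r \<le> real (card (indep_lists p d r))"
            using p assms(3) by (intro card_indep_lists) simp_all
          have "real p ^ (2 * d * r) * real p ^ e * (1 + 0 / real p) = real p ^ (2 * d * r) * (real r * real p ^ 4)"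
            using e4 one by simp
          then show "(\<Sum>ps\<in>indep_lists p d r. real (card (hits p d (wedge_span p d ps))))
            \<le> real p ^ (2 * d * r) * real p ^ e * (1 + 0 / real p)" using hits_sum[of p] p by (simp only:)
        qed
      qed auto
    next
      \<comment> \<open>Here \<open>r = c = 2\<close>, and the generic argument would give
        \<open>k = 3\<close>, above the Catalan number 2. Complementary planes have no hits of
        support two, which lowers \<open>k\<close> to 2.\<close>
      case klein
      have "(\<Sum>ps\<in>skew_planes p. real (card (hits p d (wedge_span p d ps))))
          \<le> real p ^ (2 * d * r) * (real r * real p ^ 4)" if "prime p" "p > 2" for p
        using klein that hits2_skew_planes[of p] skew_planes_subset[of p]
        by (intro sum_hits_no_support2) (auto simp: indep_lists_def)
      note hits_sum = this
      have e4: "e = 4" using klein by (simp add: e_def c_def choose_two)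
      show ?thesis
      proof (rule exI[of _ 2], rule exI[of _ 0], intro conjI allI impI)
        show "2 \<le> catalan (d - 2)" using klein catalan_2 by simp
        fix p :: nat assume p: "prime p \<and> p > 2"
        show "\<exists>S\<subseteq>indep_lists p d r. (real p ^ (2 * d) * (1 - 2 / real p)) ^ r \<le> real (card S) \<and>
          (\<Sum>ps\<in>S. real (card (hits p d (wedge_span p d ps)))) \<le> real p ^ (2 * d * r) * real p ^ e * (2 + 0 / real p)"
        proof (intro exI[of _ "skew_planes p"] conjI)
          show "skew_planes p \<subseteq> indep_lists p d r" using klein skew_planes_subset by simp
          show "(real p ^ (2 * d) * (1 - 2 / real p)) ^ r \<le> real (card (skew_planes p))"
            unfolding klein using p by (intro card_skew_planes) simp
          have "real p ^ (2 * d * r) * real p ^ e * (2 + 0 / real p) = real p ^ (2 * d * r) * (real r * real p ^ 4)"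
            using e4 klein by simp
          then show "(\<Sum>ps\<in>skew_planes p. real (card (hits p d (wedge_span p d ps))))
            \<le> real p ^ (2 * d * r) * real p ^ e * (2 + 0 / real p)" using hits_sum[of p] p by (simp only:)
        qed
      qed auto
    next
      case generic
      \<comment> \<open>For \<open>r = c\<close> the terms \<open>r * p ^ 4\<close> and
        \<open>p ^ e\<close> have the same order and add up; for \<open>r > c\<close> the first is
        smaller by a factor of at least \<open>p\<close> and goes into \<open>D\<close>.\<close>
      define k where "k = (if r = c then real r + 1 else 1)"
      define D where "D = real r + real d * 2 ^ (2 * r + 1)"
      have k1: "k \<ge> 1" by (simp add: k_def)
      have kC: "k \<le> catalan (d - 2)"
      proof (cases "r = c")
        case True
        \<comment> \<open>For \<open>d\<close> equal to 2 or 3 the value \<open>c\<close> is 1, so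
          that \<open>r = 1\<close>; for \<open>d = 4\<close> it is 2. All three belong to the cases
          treated before.\<close>
        then have "d - 2 \<noteq> 0" "d - 2 \<noteq> 1" "d - 2 \<noteq> 2"
          using generic assms(1) by (auto simp: c_def choose_two intro: ccontr)
        then have "d - 2 \<ge> 3" by linarith
        from catalan_ge_choose_two[OF this] show ?thesis using True by (simp add: k_def c_def)
      qed (use catalan_ge_1 in \<open>simp add: k_def\<close>)
      have "(\<Sum>ps\<in>indep_lists p d r. real (card (hits p d (wedge_span p d ps))))
          \<le> real p ^ (2 * d * r) * real p ^ e * (k + D / real p)" if p: "prime p" "p > 2" for p
      proof -
        have P: "real p > 2" using p by simp
        have main: "real p ^ (r + 2 * d) / real p ^ (d choose 2) = real p ^ e"
          using e P by (simp add: add.commute[of r] power_add)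
        have low: "real p ^ 3 \<le> real p ^ e / real p"
        proof -
          have "real p ^ 4 \<le> real p ^ e" using P by (intro power_increasing) (auto simp: e_def)
          then show ?thesis using P by (simp add: field_simps eval_nat_numeral)
        qed
        have single: "real r * real p ^ 4 \<le> real p ^ e * ((k - 1) + real r / real p)"
        proof (cases "r = c")
          case True
          then show ?thesis using P by (simp add: k_def e_def algebra_simps)
        next
          case False
          then have "real p ^ 5 \<le> real p ^ e" using P cr by (intro power_increasing) (auto simp: e_def)
          then have "real r * real p ^ 4 * real p \<le> real r * real p ^ e"
            by (simp add: mult_left_mono eval_nat_numeral mult.assoc)
          then show ?thesis using P False by (simp add: k_def field_simps)
        qed
        have "real d * 2 ^ (2 * r + 1) * real p ^ 3 \<le> real d * 2 ^ (2 * r + 1) * (real p ^ e / real p)"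
          by (intro mult_left_mono low) simp
        then have "real r * real p ^ 4 + real p ^ e + real d * 2 ^ (2 * r + 1) * real p ^ 3
          \<le> real p ^ e * ((k - 1) + real r / real p) + real p ^ e + real d * 2 ^ (2 * r + 1) * (real p ^ e / real p)"
          using single by linarith
        also have "\<dots> = real p ^ e * (k + D / real p)"
          by (simp add: D_def add_divide_distrib algebra_simps)
        finally have "real r * real p ^ 4 + real p ^ e + real d * 2 ^ (2 * r + 1) * real p ^ 3 \<le> real p ^ e * (k + D / real p)" .
        then have "real p ^ (2 * d * r) * (real r * real p ^ 4 + real p ^ e + real d * 2 ^ (2 * r + 1) * real p ^ 3)
          \<le> real p ^ (2 * d * r) * (real p ^ e * (k + D / real p))"
          by (rule mult_left_mono) simp
        moreover have "(\<Sum>ps\<in>indep_lists p d r. real (card (hits p d (wedge_span p d ps)))) \<le> real p ^ (2 * d * r) *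
          (real r * real p ^ 4 + real p ^ e + real d * 2 ^ (2 * r + 1) * real p ^ 3)"
          using sum_hits[OF p(1), of "indep_lists p d r" d r] unfolding main by (simp add: indep_lists_def)
        ultimately show ?thesis by (simp only: mult.assoc)
      qed
      moreover have "D \<ge> 0" by (simp add: D_def)
      ultimately show ?thesis using k1 kC card_indep_lists[OF _ assms(3)]
        by - (rule exI[of _ k], rule exI[of _ D], blast)
    qed
  qed
  then obtain k D where kD: "1 \<le> k" "k \<le> catalan (d - 2)" "D \<ge> 0" and
    S: "\<And>p. prime p \<Longrightarrow> p > 2 \<Longrightarrow>
     (\<exists>S\<subseteq>indep_lists p d r. (real p ^ (2 * d) * (1 - 2 / real p)) ^ r \<le> real (card S) \<and>
       (\<Sum>ps\<in>S. real (card (hits p d (wedge_span p d ps)))) \<le> real p ^ (2 * d * r) * real p ^ e * (k + D / real p))"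
    by blast
  show ?thesis
  proof (rule liminf_lower_bound[OF kD(1,2)])
    fix p :: nat assume p: "prime p" "p > 2"
    from S[OF p] obtain S where S: "S \<subseteq> indep_lists p d r" "(real p ^ (2 * d) * (1 - 2 / real p)) ^ r \<le> real (card S)"
      "(\<Sum>ps\<in>S. real (card (hits p d (wedge_span p d ps)))) \<le> real p ^ (2 * d * r) * real p ^ e * (k + D / real p)" by blast
    show "((1 - 2 / real p) ^ Suc r * (1 - 1 / real p) / (k + D / real p)) ^ r
      \<le> real (card {L \<in> Gr p d r. trivial_group (bogomolov_multiplier (GL p d L))}) / real (card (Gr p d r))"
      by (rule good_ratio_lower_bound[OF p assms(2) e S(1) _ kD(3) S(2,3)]) (use kD(1) in simp)
  qed
qed

end
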